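(* Let $\mathcal{G}$ be an edge-weighted graph with vertex weight $\mu$ (as in the context), and let $\Omega\subset\overline{\mathcal{G}}\setminus\mathcal{G}$ be closed. For $t\ge 0$ the semigroup operators $\exp(-t\mathcal{L}_{\Omega,\mu})$ on $l^2(\mu)$ are positivity preserving contractions on $l^p(\mu)$ for $1\le p\le\infty$.
   Context: Graphs. $\mathcal{G}$ is a simple graph with countable vertex set $\mathcal{V}$ and countable edge set $\mathcal{E}$; each vertex has at least one and at most finitely many incident edges. Each edge $[u,v]\in\mathcal{E}$ has a length $R(u,v)=R(v,u)\in(0,\infty)$; $C(u,v)=1/R(u,v)$ for edges and $C(u,v)=0$ otherwise. $u\sim v$ means $[u,v]\in\mathcal{E}$. Metric and completion. A finite path from $u$ to $v$ is a finite sequence of vertices $u=v_0,\dots,v_K=v$ with $[v_k,v_{k+1}]\in\mathcal{E}$. $d(u,v)=\inf_\gamma\sum_k R(v_k,v_{k+1})$, the infimum over finite paths $\gamma$ from $u$ to $v$ ($d(u,v)=\infty$ if there is none). As a metric space $\mathcal{G}$ is identified with its vertex set, and $\overline{\mathcal{G}}$ is the metric completion. Measure. $\mu:\mathcal{V}\to(0,\infty)$ is a vertex weight. $l^p(\mu)$ is the usual real $L^p$ space of functions on $\mathcal{V}$ with respect to the measure giving $v$ mass $\mu(v)$; $\langle f,g\rangle_\mu=\sum_v f(v)g(v)\mu(v)$ on $l^2(\mu)$. Operators. $\mathbb{A}$ is the algebra of functions $\phi:\mathcal{V}\to\mathbb{R}$ such that $\phi(u)\neq\phi(v)$ for only finitely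 many edges $[u,v]$; such functions extend continuously to $\overline{\mathcal{G}}$. $\mathbb{A}_\Omega$ is the set of $\phi\in\mathbb{A}$ whose extension vanishes on $\Omega$, and $\mathcal{D}_\Omega=\mathbb{A}_\Omega\cap l^2(\mu)$. $S_{\Omega,\mu}$ is the operator on $l^2(\mu)$ with domain $\mathcal{D}_\Omega$ acting by $\Delta_\mu f(v)=\frac1{\mu(v)}\sum_{u\sim v}C(u,v)(f(v)-f(u))$. It is symmetric and nonnegative, and $\mathcal{L}_{\Omega,\mu}$ denotes its Friedrichs extension, a nonnegative self-adjoint operator. Convention. An operator $T$ on $l^2(\mu)$ is positivity preserving if $f\ge0$ implies $Tf\ge0$, and is a contraction on $l^p(\mu)$ if $\|Tf\|_p\le\|f\|_p$ for all $f\in l^2(\mu)\cap l^p(\mu)$. *)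

theory Defs
  imports "HOL-Analysis.Analysis" "HOL-Probability.Essential_Supremum"
begin

text \<open>The vertex set is the type \<open>'v\<close>; an edge is a two-element set of vertices. Only the
  values of \<open>R\<close> on pairs of adjacent vertices are meaningful.\<close>

locale weighted_graph =
  fixes E :: "'v set set" and R :: "'v \<Rightarrow> 'v \<Rightarrow> real" and \<mu> :: "'v \<Rightarrow> real"
  assumes countable_vertices: "countable (UNIV :: 'v set)"
    and edges: "e \<in> E \<Longrightarrow> card e = 2"
    and incident_finite: "finite {e \<in> E. v \<in> e}"
    and incident_nonempty: "{e \<in> E. v \<in> e} \<noteq> {}"
    and length_sym: "{u, v} \<in> E \<Longrightarrow> R u v = R v u"
    and length_pos: "{u, v} \<in> E \<Longrightarrow> 0 < R u v"
    and weight_pos: "0 < \<mu> v"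

definition conductance :: "'v set set \<Rightarrow> ('v \<Rightarrow> 'v \<Rightarrow> real) \<Rightarrow> 'v \<Rightarrow> 'v \<Rightarrow> real" where
  "conductance E R u v = (if {u, v} \<in> E then 1 / R u v else 0)"

definition graph_paths :: "'v set set \<Rightarrow> 'v \<Rightarrow> 'v \<Rightarrow> 'v list set" where
  "graph_paths E u v = {p. p \<noteq> [] \<and> hd p = u \<and> last p = v \<and>
     (\<forall>k. Suc k < length p \<longrightarrow> {p ! k, p ! Suc k} \<in> E)}"

definition path_length :: "('v \<Rightarrow> 'v \<Rightarrow> real) \<Rightarrow> 'v list \<Rightarrow> real" where
  "path_length R p = (\<Sum>k<length p - 1. R (p ! k) (p ! Suc k))"

text \<open>The infimum over the empty set of paths is \<open>\<infinity>\<close>.\<close>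

definition graph_dist :: "'v set set \<Rightarrow> ('v \<Rightarrow> 'v \<Rightarrow> real) \<Rightarrow> 'v \<Rightarrow> 'v \<Rightarrow> ennreal" where
  "graph_dist E R u v = (INF p\<in>graph_paths E u v. ennreal (path_length R p))"

text \<open>The metric may take the value \<open>\<infinity>\<close>, so the library's metric spaces do not apply. The
  completion consists of the classes of Cauchy sequences modulo distance tending to zero.\<close>

definition cauchy_seqs :: "('v \<Rightarrow> 'v \<Rightarrow> ennreal) \<Rightarrow> (nat \<Rightarrow> 'v) set" where
  "cauchy_seqs d = {x. \<forall>\<epsilon>>0. \<exists>N. \<forall>m\<ge>N. \<forall>n\<ge>N. d (x m) (x n) < \<epsilon>}"

definition cauchy_rel :: "('v \<Rightarrow> 'v \<Rightarrow> ennreal) \<Rightarrow> ((nat \<Rightarrow> 'v) \<times> (nat \<Rightarrow> 'v)) set" where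
  "cauchy_rel d = {(x, y). x \<in> cauchy_seqs d \<and> y \<in> cauchy_seqs d \<and>
     (\<lambda>n. d (x n) (y n)) \<longlonglongrightarrow> 0}"

definition metric_completion :: "('v \<Rightarrow> 'v \<Rightarrow> ennreal) \<Rightarrow> (nat \<Rightarrow> 'v) set set" where
  "metric_completion d = cauchy_seqs d // cauchy_rel d"

definition completion_embed :: "('v \<Rightarrow> 'v \<Rightarrow> ennreal) \<Rightarrow> 'v \<Rightarrow> (nat \<Rightarrow> 'v) set" where
  "completion_embed d v = cauchy_rel d `` {\<lambda>_. v}"

definition completion_dist ::
    "('v \<Rightarrow> 'v \<Rightarrow> ennreal) \<Rightarrow> (nat \<Rightarrow> 'v) set \<Rightarrow> (nat \<Rightarrow> 'v) set \<Rightarrow> ennreal" where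
  "completion_dist d X Y = (THE l. \<forall>x\<in>X. \<forall>y\<in>Y. (\<lambda>n. d (x n) (y n)) \<longlonglongrightarrow> l)"

definition completion_open ::
    "('v \<Rightarrow> 'v \<Rightarrow> ennreal) \<Rightarrow> (nat \<Rightarrow> 'v) set set \<Rightarrow> bool" where
  "completion_open d U \<longleftrightarrow> U \<subseteq> metric_completion d \<and>
     (\<forall>X\<in>U. \<exists>r>0. \<forall>Y\<in>metric_completion d. completion_dist d X Y < r \<longrightarrow> Y \<in> U)"

definition completion_topology ::
    "('v \<Rightarrow> 'v \<Rightarrow> ennreal) \<Rightarrow> (nat \<Rightarrow> 'v) set topology" where
  "completion_topology d = topology (completion_open d)"

lemma istopology_completion_open: "istopology (completion_open d)"
  unfolding istopology_def
proof (intro conjI allI impI)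
  fix S T assume S: "completion_open d S" and T: "completion_open d T"
  show "completion_open d (S \<inter> T)"
    unfolding completion_open_def
  proof (intro conjI ballI)
    show "S \<inter> T \<subseteq> metric_completion d" using S by (auto simp: completion_open_def)
    fix X assume X: "X \<in> S \<inter> T"
    obtain r where r: "r > 0" "\<forall>Y\<in>metric_completion d. completion_dist d X Y < r \<longrightarrow> Y \<in> S"
      using S X by (auto simp: completion_open_def)
    obtain q where q: "q > 0" "\<forall>Y\<in>metric_completion d. completion_dist d X Y < q \<longrightarrow> Y \<in> T"
      using T X by (auto simp: completion_open_def)
    show "\<exists>r>0. \<forall>Y\<in>metric_completion d. completion_dist d X Y < r \<longrightarrow> Y \<in> S \<inter> T"
      using r q by (intro exI[of _ "min r q"]) auto
  qed
next
  fix K assume K: "\<forall>S\<in>K. completion_open d S"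
  show "completion_open d (\<Union> K)"
    unfolding completion_open_def
  proof (intro conjI ballI)
    show "\<Union> K \<subseteq> metric_completion d" using K by (auto simp: completion_open_def)
    fix X assume "X \<in> \<Union> K"
    then obtain S where "S \<in> K" "X \<in> S" by blast
    then show "\<exists>r>0. \<forall>Y\<in>metric_completion d. completion_dist d X Y < r \<longrightarrow> Y \<in> \<Union> K"
      using K unfolding completion_open_def by (metis UnionI)
  qed
qed

lemma openin_completion_topology: "openin (completion_topology d) = completion_open d"
  by (simp add: completion_topology_def topology_inverse' istopology_completion_open)

lemma topspace_completion_topology: "topspace (completion_topology d) = metric_completion d"
proof -
  have *: "completion_open d (metric_completion d)"
    by (auto simp: completion_open_def intro: zero_less_one)
  show ?thesis
    unfolding topspace_def openin_completion_topology
  proof (rule equalityI)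
    show "\<Union> {S. completion_open d S} \<subseteq> metric_completion d"
      by (auto simp: completion_open_def)
    show "metric_completion d \<subseteq> \<Union> {S. completion_open d S}"
      using * by blast
  qed
qed

text \<open>The values of the extension outside \<open>metric_completion d\<close> are unspecified.\<close>

definition continuous_extension ::
    "('v \<Rightarrow> 'v \<Rightarrow> ennreal) \<Rightarrow> ('v \<Rightarrow> real) \<Rightarrow> (nat \<Rightarrow> 'v) set \<Rightarrow> real" where
  "continuous_extension d \<phi> = (SOME F. continuous_map (completion_topology d) euclideanreal F \<and>
     (\<forall>v. F (completion_embed d v) = \<phi> v))"

definition vertex_measure :: "('v \<Rightarrow> real) \<Rightarrow> 'v measure" where
  "vertex_measure \<mu> = point_measure UNIV (\<lambda>v. ennreal (\<mu> v))"

text \<open>Every vertex has positive mass, so elements of \<open>l\<^sup>p(\<mu>)\<close> are functions and not just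
  classes of functions.\<close>

definition lp_space :: "('v \<Rightarrow> real) \<Rightarrow> ennreal \<Rightarrow> ('v \<Rightarrow> real) set" where
  "lp_space \<mu> p = {f. if p = \<infinity> then esssup (vertex_measure \<mu>) (\<lambda>v. ereal \<bar>f v\<bar>) < \<infinity>
     else integrable (vertex_measure \<mu>) (\<lambda>v. \<bar>f v\<bar> powr enn2real p)}"

definition lp_norm :: "('v \<Rightarrow> real) \<Rightarrow> ennreal \<Rightarrow> ('v \<Rightarrow> real) \<Rightarrow> real" where
  "lp_norm \<mu> p f = (if p = \<infinity> then real_of_ereal (esssup (vertex_measure \<mu>) (\<lambda>v. ereal \<bar>f v\<bar>))
     else (LINT v|vertex_measure \<mu>. \<bar>f v\<bar> powr enn2real p) powr (1 / enn2real p))"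

abbreviation l2_space :: "('v \<Rightarrow> real) \<Rightarrow> ('v \<Rightarrow> real) set" where
  "l2_space \<mu> \<equiv> lp_space \<mu> 2"

abbreviation l2_norm :: "('v \<Rightarrow> real) \<Rightarrow> ('v \<Rightarrow> real) \<Rightarrow> real" where
  "l2_norm \<mu> \<equiv> lp_norm \<mu> 2"

definition l2_inner :: "('v \<Rightarrow> real) \<Rightarrow> ('v \<Rightarrow> real) \<Rightarrow> ('v \<Rightarrow> real) \<Rightarrow> real" where
  "l2_inner \<mu> f g = (LINT v|vertex_measure \<mu>. f v * g v)"

text \<open>Unbounded operators on \<open>l\<^sup>2(\<mu>)\<close> are represented by their graphs, except for the initial
  symmetric operator, which is given by a domain \<open>D\<close> and a map \<open>A\<close>. The form
  \<open>q(f, g) = \<langle>A f, g\<rangle>\<close> on \<open>D\<close> is closed up: \<open>form_approx \<mu> D A s f\<close> says that \<open>s\<close> is a sequence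
  in \<open>D\<close> that converges to \<open>f\<close> in \<open>l\<^sup>2(\<mu>)\<close> and is Cauchy for \<open>q\<close>. The Friedrichs extension is
  the operator associated with the closed form.\<close>

definition form_approx ::
    "('v \<Rightarrow> real) \<Rightarrow> ('v \<Rightarrow> real) set \<Rightarrow> (('v \<Rightarrow> real) \<Rightarrow> ('v \<Rightarrow> real)) \<Rightarrow>
     (nat \<Rightarrow> 'v \<Rightarrow> real) \<Rightarrow> ('v \<Rightarrow> real) \<Rightarrow> bool" where
  "form_approx \<mu> D A s f \<longleftrightarrow> (\<forall>n. s n \<in> D) \<and> f \<in> l2_space \<mu> \<and>
     (\<lambda>n. l2_norm \<mu> (\<lambda>v. s n v - f v)) \<longlonglongrightarrow> 0 \<and>
     (\<forall>\<epsilon>>0. \<exists>N. \<forall>m\<ge>N. \<forall>n\<ge>N.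
        l2_inner \<mu> (A (\<lambda>v. s m v - s n v)) (\<lambda>v. s m v - s n v) < \<epsilon>)"

definition form_domain ::
    "('v \<Rightarrow> real) \<Rightarrow> ('v \<Rightarrow> real) set \<Rightarrow> (('v \<Rightarrow> real) \<Rightarrow> ('v \<Rightarrow> real)) \<Rightarrow> ('v \<Rightarrow> real) set" where
  "form_domain \<mu> D A = {f. \<exists>s. form_approx \<mu> D A s f}"

definition closed_form ::
    "('v \<Rightarrow> real) \<Rightarrow> ('v \<Rightarrow> real) set \<Rightarrow> (('v \<Rightarrow> real) \<Rightarrow> ('v \<Rightarrow> real)) \<Rightarrow>
     ('v \<Rightarrow> real) \<Rightarrow> ('v \<Rightarrow> real) \<Rightarrow> real" where
  "closed_form \<mu> D A f g = (THE l. \<forall>s r. form_approx \<mu> D A s f \<and> form_approx \<mu> D A r g \<longrightarrow>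
     (\<lambda>n. l2_inner \<mu> (A (s n)) (r n)) \<longlonglongrightarrow> l)"

definition friedrichs_extension ::
    "('v \<Rightarrow> real) \<Rightarrow> ('v \<Rightarrow> real) set \<Rightarrow> (('v \<Rightarrow> real) \<Rightarrow> ('v \<Rightarrow> real)) \<Rightarrow>
     (('v \<Rightarrow> real) \<times> ('v \<Rightarrow> real)) set" where
  "friedrichs_extension \<mu> D A = {(f, h). f \<in> form_domain \<mu> D A \<and> h \<in> l2_space \<mu> \<and>
     (\<forall>g\<in>form_domain \<mu> D A. closed_form \<mu> D A f g = l2_inner \<mu> h g)}"

definition bounded_operator :: "('v \<Rightarrow> real) \<Rightarrow> (('v \<Rightarrow> real) \<Rightarrow> ('v \<Rightarrow> real)) \<Rightarrow> bool" where
  "bounded_operator \<mu> T \<longleftrightarrow>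
     (\<forall>f\<in>l2_space \<mu>. T f \<in> l2_space \<mu>) \<and>
     (\<forall>f\<in>l2_space \<mu>. \<forall>g\<in>l2_space \<mu>. \<forall>a b. T (\<lambda>v. a * f v + b * g v) = (\<lambda>v. a * T f v + b * T g v)) \<and>
     (\<exists>K. \<forall>f\<in>l2_space \<mu>. l2_norm \<mu> (T f) \<le> K * l2_norm \<mu> f)"

definition c0_semigroup ::
    "('v \<Rightarrow> real) \<Rightarrow> (real \<Rightarrow> ('v \<Rightarrow> real) \<Rightarrow> ('v \<Rightarrow> real)) \<Rightarrow> bool" where
  "c0_semigroup \<mu> T \<longleftrightarrow>
     (\<forall>t\<ge>0. bounded_operator \<mu> (T t)) \<and>
     (\<forall>f\<in>l2_space \<mu>. T 0 f = f) \<and>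
     (\<forall>s\<ge>0. \<forall>t\<ge>0. \<forall>f\<in>l2_space \<mu>. T (s + t) f = T s (T t f)) \<and>
     (\<forall>f\<in>l2_space \<mu>. ((\<lambda>t. l2_norm \<mu> (\<lambda>v. T t f v - f v)) \<longlongrightarrow> 0) (at_right 0))"

definition generator ::
    "('v \<Rightarrow> real) \<Rightarrow> (real \<Rightarrow> ('v \<Rightarrow> real) \<Rightarrow> ('v \<Rightarrow> real)) \<Rightarrow>
     (('v \<Rightarrow> real) \<times> ('v \<Rightarrow> real)) set" where
  "generator \<mu> T = {(f, g). f \<in> l2_space \<mu> \<and> g \<in> l2_space \<mu> \<and>
     ((\<lambda>t. l2_norm \<mu> (\<lambda>v. (T t f v - f v) / t - g v)) \<longlongrightarrow> 0) (at_right 0)}"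

text \<open>\<open>semigroup_exp \<mu> L t\<close> is \<open>exp(-tL)\<close>: the strongly continuous semigroup on \<open>l\<^sup>2(\<mu>)\<close> whose
  generator is \<open>-L\<close>, domain included. A semigroup is determined by its generator, for \<open>t \<ge> 0\<close> and
  on \<open>l\<^sup>2(\<mu>)\<close>; other values are unspecified.\<close>

definition semigroup_exp ::
    "('v \<Rightarrow> real) \<Rightarrow> (('v \<Rightarrow> real) \<times> ('v \<Rightarrow> real)) set \<Rightarrow>
     real \<Rightarrow> ('v \<Rightarrow> real) \<Rightarrow> ('v \<Rightarrow> real)" where
  "semigroup_exp \<mu> L = (SOME T. c0_semigroup \<mu> T \<and>
     generator \<mu> T = {(f, \<lambda>v. - h v) | f h. (f, h) \<in> L})"

definition positivity_preserving :: "('v \<Rightarrow> real) \<Rightarrow> (('v \<Rightarrow> real) \<Rightarrow> ('v \<Rightarrow> real)) \<Rightarrow> bool" where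
  "positivity_preserving \<mu> T \<longleftrightarrow> (\<forall>f\<in>l2_space \<mu>. (\<forall>v. 0 \<le> f v) \<longrightarrow> (\<forall>v. 0 \<le> T f v))"

definition lp_contraction ::
    "('v \<Rightarrow> real) \<Rightarrow> ennreal \<Rightarrow> (('v \<Rightarrow> real) \<Rightarrow> ('v \<Rightarrow> real)) \<Rightarrow> bool" where
  "lp_contraction \<mu> p T \<longleftrightarrow> (\<forall>f \<in> l2_space \<mu> \<inter> lp_space \<mu> p.
     T f \<in> lp_space \<mu> p \<and> lp_norm \<mu> p (T f) \<le> lp_norm \<mu> p f)"

definition algebra_A :: "'v set set \<Rightarrow> ('v \<Rightarrow> real) set" where
  "algebra_A E = {\<phi>. finite {e \<in> E. \<exists>u v. e = {u, v} \<and> \<phi> u \<noteq> \<phi> v}}"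

definition algebra_A_vanishing ::
    "'v set set \<Rightarrow> ('v \<Rightarrow> 'v \<Rightarrow> real) \<Rightarrow> (nat \<Rightarrow> 'v) set set \<Rightarrow> ('v \<Rightarrow> real) set" where
  "algebra_A_vanishing E R \<Omega> =
     {\<phi> \<in> algebra_A E. \<forall>\<omega>\<in>\<Omega>. continuous_extension (graph_dist E R) \<phi> \<omega> = 0}"

definition laplace_domain ::
    "'v set set \<Rightarrow> ('v \<Rightarrow> 'v \<Rightarrow> real) \<Rightarrow> ('v \<Rightarrow> real) \<Rightarrow> (nat \<Rightarrow> 'v) set set \<Rightarrow>
     ('v \<Rightarrow> real) set" where
  "laplace_domain E R \<mu> \<Omega> = algebra_A_vanishing E R \<Omega> \<inter> l2_space \<mu>"

definition laplacian ::
    "'v set set \<Rightarrow> ('v \<Rightarrow> 'v \<Rightarrow> real) \<Rightarrow> ('v \<Rightarrow> real) \<Rightarrow> ('v \<Rightarrow> real) \<Rightarrow> 'v \<Rightarrow> real" where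
  "laplacian E R \<mu> f v =
     1 / \<mu> v * (\<Sum>u | {u, v} \<in> E. conductance E R u v * (f v - f u))"

definition friedrichs_laplacian ::
    "'v set set \<Rightarrow> ('v \<Rightarrow> 'v \<Rightarrow> real) \<Rightarrow> ('v \<Rightarrow> real) \<Rightarrow> (nat \<Rightarrow> 'v) set set \<Rightarrow>
     (('v \<Rightarrow> real) \<times> ('v \<Rightarrow> real)) set" where
  "friedrichs_laplacian E R \<mu> \<Omega> =
     friedrichs_extension \<mu> (laplace_domain E R \<mu> \<Omega>) (laplacian E R \<mu>)"

end

theory Submission
  imports Defs
begin

text \<open>The quadratic form \<open>q\<close> of the Laplacian decreases under normal contractions, and such contractions
  preserve the domain. The resolvent \<open>(1 + a L)\<^sup>-\<^sup>1 f\<close> of the Friedrichs extension \<open>L\<close>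
  minimises \<open>a * q g g + \<parallel>g - f\<parallel>\<^sup>2\<close>, and a minimising sequence may be replaced by its image under a
  retraction of the real line that fixes the values of \<open>f\<close>. Hence the resolvent preserves the
  inequalities \<open>0 \<le> f\<close> and \<open>f \<le> 1\<close>, and so does the semigroup, which is the limit of the exponentials
  of the Yosida approximations \<open>(1 - (1 + a L)\<^sup>-\<^sup>1) / a\<close>. A positive symmetric operator
  with this property is given by a kernel whose weighted row and column sums are bounded by those
  of the identity, and Jensen's inequality yields the contraction property on \<open>l\<^sup>p\<close>.\<close>

section \<open>Exponentials of contractions\<close>

text \<open>\<open>semigroup_exp\<close> and \<open>continuous_extension\<close> are choices and
  \<open>closed_form\<close> is a definite description, so each needs existence and uniqueness
  before anything can be said about it. For the semigroup this means handling an arbitrary strongly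
  continuous semigroup with the right generator: only boundedness of each single operator is known,
  and a bound that is uniform on time intervals must be extracted by Banach-Steinhaus before its
  orbits can be compared with those of the Yosida construction. Two facts link the graph to the
  form. A function in \<open>algebra_A\<close> is constant on balls of a fixed radius of the path
  metric, so its extension vanishes at a boundary point exactly if the function vanishes from some
  index on along the representing sequences, a condition stable under composition with contractions.
  And a sequence representing a point outside the graph leaves every finite set of vertices, so
  finitely supported functions lie in the domain, which makes it dense.\<close>

definition exp_series :: "(nat \<Rightarrow> 'a::banach) \<Rightarrow> real \<Rightarrow> 'a" where
  "exp_series c s = (\<Sum>k. (s ^ k / fact k) *\<^sub>R c k)"

lemma summable_exp_series:
  fixes c :: "nat \<Rightarrow> 'a::banach"
  assumes "\<And>k. norm (c k) \<le> M"
  shows "summable (\<lambda>k. norm ((s ^ k / fact k) *\<^sub>R c k))" "summable (\<lambda>k. (s ^ k / fact k) *\<^sub>R c k)"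
proof -
  have *: "summable (\<lambda>k. M * (\<bar>s\<bar> ^ k / fact k))"
    using summable_exp[of "\<bar>s\<bar>"] by (intro summable_mult) (simp add: field_simps)
  show 1: "summable (\<lambda>k. norm ((s ^ k / fact k) *\<^sub>R c k))"
  proof (rule summable_comparison_test'[OF *])
    fix n
    show "norm (norm ((s ^ n / fact n) *\<^sub>R c n)) \<le> M * (\<bar>s\<bar> ^ n / fact n)"
      using mult_right_mono[OF assms[of n], of "\<bar>s\<bar> ^ n / fact n"] by (simp add: power_abs mult.commute)
  qed
  then show "summable (\<lambda>k. (s ^ k / fact k) *\<^sub>R c k)" by (rule summable_norm_cancel)
qed

text \<open>Termwise differentiation shifts the coefficient sequence, and the shifted series
  converges uniformly on bounded intervals by the Weierstrass test.\<close>

lemma exp_series_has_vector_derivative: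
  fixes c :: "nat \<Rightarrow> 'a::banach"
  assumes M: "\<And>k. norm (c k) \<le> M"
  shows "(exp_series c has_vector_derivative exp_series (\<lambda>k. c (Suc k)) s) (at s)"
proof -
  \<comment> \<open>The margin 1 puts \<open>s\<close> inside the open interval \<open>S\<close>,
    also when \<open>s\<close> is 0.\<close>
  define r where "r = \<bar>s\<bar> + 1"
  define S where "S = {-r<..<r}"
  have M0: "0 \<le> M" using M[of 0] norm_ge_zero order_trans by blast
  have Ssum: "summable (\<lambda>k. M * (r ^ k / fact k))"
    using summable_exp[of r] by (intro summable_mult) (simp add: field_simps)
  define f' where "f' = (\<lambda>k s h. h *\<^sub>R ((of_nat k * s ^ (k - 1) / fact k) *\<^sub>R c k))"
  have "uniform_limit S (\<lambda>n x. \<Sum>k<n. (x ^ k / fact k) *\<^sub>R c (Suc k))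
      (\<lambda>x. \<Sum>k. (x ^ k / fact k) *\<^sub>R c (Suc k)) sequentially"
  proof (rule Weierstrass_m_test[OF _ Ssum])
    fix n x assume "x \<in> S"
    then have "\<bar>x\<bar> ^ n \<le> r ^ n" by (intro power_mono) (auto simp: S_def)
    then have "\<bar>x\<bar> ^ n / fact n \<le> r ^ n / fact n" by (simp add: divide_right_mono)
    then have "(\<bar>x\<bar> ^ n / fact n) * norm (c (Suc n)) \<le> (r ^ n / fact n) * M"
      by (intro mult_mono M) (auto simp: r_def)
    then show "norm ((x ^ n / fact n) *\<^sub>R c (Suc n)) \<le> M * (r ^ n / fact n)"
      by (simp add: power_abs mult.commute)
  qed
  then have ul: "uniform_limit S (\<lambda>n x. \<Sum>k<n. (x ^ k / fact k) *\<^sub>R c (Suc k)) 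
      (exp_series (\<lambda>k. c (Suc k))) sequentially"
    by (simp add: exp_series_def[abs_def])
  \<comment> \<open>The derivative of the constant term is 0, so one more term is taken on the left
    than on the right.\<close>
  have shift: "(\<Sum>i<Suc n. f' i x h) = h *\<^sub>R (\<Sum>k<n. (x ^ k / fact k) *\<^sub>R c (Suc k))" for n x h
    unfolding f'_def by (simp only: sum.lessThan_Suc_shift scaleR_right.sum)
      (simp del: of_nat_Suc add: fact_Suc)
  have ev: "\<forall>\<^sub>F n in sequentially. \<forall>x\<in>S. \<forall>h. norm (sum (\<lambda>i. f' i x h) {..<n} -
      h *\<^sub>R exp_series (\<lambda>k. c (Suc k)) x) \<le> e * norm h" if "e > 0" for e
  proof -
    have "\<forall>\<^sub>F n in sequentially. \<forall>x\<in>S. norm ((\<Sum>k<n. (x ^ k / fact k) *\<^sub>R c (Suc k)) -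
      exp_series (\<lambda>k. c (Suc k)) x) < e"
      using uniform_limitD[OF ul \<open>e > 0\<close>] by (simp add: dist_norm)
    then have "\<forall>\<^sub>F n in sequentially. \<forall>x\<in>S. \<forall>h. norm (sum (\<lambda>i. f' i x h) {..<Suc n} -
      h *\<^sub>R exp_series (\<lambda>k. c (Suc k)) x) \<le> e * norm h"
    proof eventually_elim
      case (elim n)
      then show ?case
        unfolding shift scaleR_diff_right[symmetric] norm_scaleR
        by (metis abs_ge_zero less_eq_real_def mult.commute mult_right_mono real_norm_def)
    qed
    then show ?thesis by (subst (asm) eventually_sequentially_Suc)
  qed
  have "\<exists>g. \<forall>x\<in>S. (\<lambda>n. (x ^ n / fact n) *\<^sub>R c n) sums g x \<and>
     (g has_derivative (\<lambda>h. h *\<^sub>R exp_series (\<lambda>k. c (Suc k)) x)) (at x within S)"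
  proof (rule has_derivative_series[where f' = f' and x = 0])
    show "convex S" by (simp add: S_def)
    show "((\<lambda>x. (x ^ n / fact n) *\<^sub>R c n) has_derivative f' n x) (at x within S)" for n x
      unfolding f'_def
      by (auto intro!: derivative_eq_intros simp: fun_eq_iff)
    show "0 \<in> S" using abs_ge_zero[of s] unfolding S_def r_def by simp linarith
    show "(\<lambda>n. (0 ^ n / fact n) *\<^sub>R c n) sums exp_series c 0"
      unfolding exp_series_def by (rule summable_sums summable_exp_series M)+
  qed (use ev in auto)
  then obtain g where g: "\<And>x. x \<in> S \<Longrightarrow> (\<lambda>n. (x ^ n / fact n) *\<^sub>R c n) sums g x"
     "\<And>x. x \<in> S \<Longrightarrow> (g has_derivative (\<lambda>h. h *\<^sub>R exp_series (\<lambda>k. c (Suc k)) x)) (at x within S)"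
    by blast
  have sS: "s \<in> S" and oS: "open S" by (auto simp: S_def r_def)
  have "(g has_vector_derivative exp_series (\<lambda>k. c (Suc k)) s) (at s)"
    using g(2)[OF sS] at_within_open[OF sS oS] by (simp add: has_vector_derivative_def)
  moreover have "g x = exp_series c x" if "x \<in> S" for x
    using g(1)[OF that] unfolding exp_series_def by (rule sums_unique)
  ultimately show ?thesis
    by (rule has_vector_derivative_transform_within_open[OF _ oS sS])
qed

locale contraction =
  fixes B :: "'a::{real_inner,banach} \<Rightarrow> 'a"
  assumes lin: "bounded_linear B" and contr: "norm (B x) \<le> norm x"
begin

text \<open>The exponential of \<open>s\<close> times (\<open>B\<close> minus the identity), written
  as the mean of the powers of \<open>B\<close> under the Poisson distribution with parameter
  \<open>s\<close>.\<close>

definition "expm s f = exp (- s) *\<^sub>R exp_series (\<lambda>k. (B ^^ k) f) s"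

lemma norm_pow: "norm ((B ^^ k) f) \<le> norm f"
  by (induction k) (auto intro: order_trans[OF contr])

lemma summable_pow: "summable (\<lambda>k. (s ^ k / fact k) *\<^sub>R (B ^^ k) f)"
  using summable_exp_series(2)[of "\<lambda>k. (B ^^ k) f" "norm f"] norm_pow by simp

lemma bounded_linear_pow: "bounded_linear (B ^^ k)"
  by (induction k) (auto intro: bounded_linear_compose lin bounded_linear_ident simp: o_def id_def)

text \<open>The Poisson weights are nonnegative with sum 1, so a closed half-space that contains all
  iterates of \<open>f\<close> contains \<open>expm s f\<close>. The norm bound and, later, the
  order bounds come from this one fact.\<close>

lemma expm_bl_le:
  fixes \<phi> :: "'a \<Rightarrow> real"
  assumes \<phi>: "bounded_linear \<phi>" and le: "\<And>k. \<phi> ((B ^^ k) f) \<le> c" and s: "0 \<le> s"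
  shows "\<phi> (expm s f) \<le> c"
proof -
  have "\<phi> (expm s f) = exp (- s) * (\<Sum>k. (s ^ k / fact k) * \<phi> ((B ^^ k) f))"
    unfolding expm_def exp_series_def
    using bounded_linear.suminf[OF \<phi> summable_pow[of s f]] \<phi> by (simp add: linear_simps)
  also have "\<dots> \<le> exp (- s) * (\<Sum>k. (s ^ k / fact k) * c)"
  proof (intro mult_left_mono suminf_le)
    show "summable (\<lambda>k. s ^ k / fact k * \<phi> ((B ^^ k) f))"
      using bounded_linear.summable[OF \<phi> summable_pow[of s f]] \<phi> by (simp add: linear_simps)
    show "summable (\<lambda>k. s ^ k / fact k * c)"
      using summable_exp[of s] by (intro summable_mult2) (simp add: field_simps)
  qed (use le s in \<open>auto intro!: mult_left_mono divide_nonneg_nonneg\<close>)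
  also have "(\<Sum>k. (s ^ k / fact k) * c) = exp s * c"
    using sums_unique[OF sums_mult2[OF exp_converges[of s], of c]] by (simp add: divide_inverse mult.commute)
  finally show ?thesis by (simp add: exp_minus field_simps)
qed

lemma expm_0 [simp]: "expm 0 f = f"
proof -
  have "(\<lambda>k. (0 ^ k / fact k) *\<^sub>R (B ^^ k) f) = (\<lambda>k. if k = 0 then f else 0)"
    by (auto simp: fun_eq_iff)
  then show ?thesis using suminf_finite[of "{0}" "\<lambda>k. if k = 0 then f else 0"] by (simp add: expm_def exp_series_def)
qed

lemma expm_commute:
  assumes C: "bounded_linear C" and CB: "\<And>x. C (B x) = B (C x)"
  shows "C (expm s f) = expm s (C f)"
proof -
  have "C ((B ^^ k) f) = (B ^^ k) (C f)" for k
    by (induction k) (auto simp: CB)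
  then show ?thesis
    unfolding expm_def exp_series_def
    using bounded_linear.suminf[OF C summable_pow[of s f]] C by (simp add: linear_simps)
qed

lemma expm_add: "expm s (f + g) = expm s f + expm s g"
  unfolding expm_def exp_series_def
  by (simp add: suminf_add[OF summable_pow summable_pow] linear_simps(1)[OF bounded_linear_pow] flip: scaleR_add_right)

lemma expm_scaleR: "expm s (r *\<^sub>R f) = r *\<^sub>R expm s f"
  using expm_commute[of "\<lambda>x. r *\<^sub>R x" s f] lin by (simp add: linear_simps bounded_linear_scaleR_right)

lemma norm_expm: "0 \<le> s \<Longrightarrow> norm (expm s f) \<le> norm f"
proof -
  assume s: "0 \<le> s"
  \<comment> \<open>Testing against \<open>expm s f\<close> itself turns the norm estimate into a
    bound on a linear functional.\<close>
  have "expm s f \<bullet> expm s f \<le> norm f * norm (expm s f)"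
  proof (rule expm_bl_le[OF bounded_linear_inner_left _ s])
    fix k
    show "(B ^^ k) f \<bullet> expm s f \<le> norm f * norm (expm s f)"
      by (rule order_trans[OF norm_cauchy_schwarz]) (intro mult_right_mono norm_pow norm_ge_zero)
  qed
  then show ?thesis
    by (metis mult_right_le_imp_le norm_eq_sqrt_inner norm_ge_zero order_less_le power2_norm_eq_inner power2_eq_square)
qed

lemma expm_deriv: "((\<lambda>s. expm s f) has_vector_derivative (B (expm s f) - expm s f)) (at s)"
proof -
  have d: "(exp_series (\<lambda>k. (B ^^ k) f) has_vector_derivative exp_series (\<lambda>k. (B ^^ k) (B f)) s) (at s)"
    using exp_series_has_vector_derivative[of "\<lambda>k. (B ^^ k) f" "norm f" s] norm_pow
    by (simp add: funpow_swap1)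
  have "exp (- s) *\<^sub>R exp_series (\<lambda>k. (B ^^ k) (B f)) s = B (expm s f)"
    using expm_commute[OF lin] by (simp add: expm_def)
  then show ?thesis
    unfolding expm_def[abs_def]
    by (auto intro!: derivative_eq_intros d simp: has_real_derivative_iff_has_vector_derivative[symmetric])
qed

lemma expm_sym:
  assumes sym: "\<And>x y. B x \<bullet> y = x \<bullet> B y" and s: "0 \<le> s"
  shows "expm s f \<bullet> g = f \<bullet> expm s g"
proof -
  have p: "(B ^^ k) x \<bullet> y = x \<bullet> (B ^^ k) y" for k x y
    by (induction k arbitrary: x y) (auto simp: sym funpow_swap1)
  have "expm s f \<bullet> g = exp (- s) * (\<Sum>k. (s ^ k / fact k) * ((B ^^ k) f \<bullet> g))"
    unfolding expm_def exp_series_def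
    using bounded_linear.suminf[OF bounded_linear_inner_left summable_pow[of s f], of g] by simp
  also have "\<dots> = f \<bullet> expm s g"
    unfolding expm_def exp_series_def p
    using bounded_linear.suminf[OF bounded_linear_inner_right summable_pow[of s g], of f] by simp
  finally show ?thesis .
qed

end

section \<open>The semigroup of a maximal monotone operator\<close>

text \<open>The derivative of the squared norm is \<open>2 * (w s \<bullet> w' s)\<close>. With
  \<open>K = 0\<close> this gives uniqueness for linear equations, with small \<open>K\<close> the
  convergence of the approximations.\<close>

lemma norm_square_growth:
  fixes w :: "real \<Rightarrow> 'a::real_inner"
  assumes "0 \<le> t"
    and d: "\<And>s. 0 \<le> s \<Longrightarrow> s \<le> t \<Longrightarrow> (w has_vector_derivative w' s) (at s)"
    and le: "\<And>s. 0 \<le> s \<Longrightarrow> s \<le> t \<Longrightarrow> 2 * (w s \<bullet> w' s) \<le> K"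
  shows "(norm (w t))\<^sup>2 \<le> (norm (w 0))\<^sup>2 + K * t"
proof -
  have "((\<lambda>s. w s \<bullet> w s - K * s) has_real_derivative (2 * (w s \<bullet> w' s) - K)) (at s)"
    if "0 \<le> s" "s \<le> t" for s
    unfolding has_real_derivative_iff_has_vector_derivative
    by (rule has_vector_derivative_eq_rhs,
        (rule derivative_intros bounded_bilinear.has_vector_derivative[OF bounded_bilinear_inner] d that)+)
      (auto simp: inner_commute)
  then have "w t \<bullet> w t - K * t \<le> w 0 \<bullet> w 0 - K * 0"
    using le by (intro DERIV_nonpos_imp_nonincreasing[OF \<open>0 \<le> t\<close>]) force
  then show ?thesis by (simp add: power2_norm_eq_inner)
qed

text \<open>The operator is given by its graph because its domain matters. The condition
  \<open>range\<close> says that the equation u + a L u = f is solvable: the second entry of the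
  pair is L u solved from this equation.\<close>

locale maximal_monotone =
  fixes L :: "('a::{real_inner,banach} \<times> 'a) set"
  assumes subsp: "subspace L"
    and mono: "(f, h) \<in> L \<Longrightarrow> 0 \<le> f \<bullet> h"
    and range: "0 < a \<Longrightarrow> \<exists>u. (u, (f - u) /\<^sub>R a) \<in> L"
    and dense: "closure (fst ` L) = UNIV"
begin

lemma L_add: "(f, h) \<in> L \<Longrightarrow> (g, k) \<in> L \<Longrightarrow> (f + g, h + k) \<in> L"
  using subspace_add[OF subsp] by (metis add_Pair)

lemma L_diff: "(f, h) \<in> L \<Longrightarrow> (g, k) \<in> L \<Longrightarrow> (f - g, h - k) \<in> L"
  using subspace_diff[OF subsp] by (metis diff_Pair)

lemma L_scale: "(f, h) \<in> L \<Longrightarrow> (r *\<^sub>R f, r *\<^sub>R h) \<in> L"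
  using subspace_scale[OF subsp] by (metis scaleR_Pair)

text \<open>Monotonicity for the difference of the two pairs reads
  \<open>0 \<le> (u - w) \<bullet> ((f - g) - (u - w))\<close>; Cauchy-Schwarz does the rest. The
  case \<open>f = g\<close> is uniqueness of the resolvent.\<close>

lemma resolvent_nonexpansive:
  assumes a: "0 < a" and "(u, (f - u) /\<^sub>R a) \<in> L" "(w, (g - w) /\<^sub>R a) \<in> L"
  shows "norm (u - w) \<le> norm (f - g)"
proof -
  have "0 \<le> (u - w) \<bullet> ((f - u) /\<^sub>R a - (g - w) /\<^sub>R a)"
    using L_diff[OF assms(2,3)] by (rule mono)
  also have "(f - u) /\<^sub>R a - (g - w) /\<^sub>R a = ((f - g) - (u - w)) /\<^sub>R a"
    by (simp add: algebra_simps)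
  finally have "0 \<le> (u - w) \<bullet> ((f - g) - (u - w))"
    using a by (simp add: zero_le_mult_iff)
  then have "norm (u - w) * norm (u - w) \<le> (u - w) \<bullet> (f - g)"
    by (simp add: inner_diff_right flip: power2_norm_eq_inner power2_eq_square)
  also have "\<dots> \<le> norm (u - w) * norm (f - g)" by (rule norm_cauchy_schwarz)
  finally show ?thesis
    by (cases "norm (u - w) = 0") (auto simp: mult_le_cancel_left)
qed

section \<open>Resolvents and Yosida approximations\<close>

definition "J a f = (THE u. (u, (f - u) /\<^sub>R a) \<in> L)"

lemma J_eqI: "0 < a \<Longrightarrow> (u, (f - u) /\<^sub>R a) \<in> L \<Longrightarrow> J a f = u"
  unfolding J_def
  by (rule the_equality) (use resolvent_nonexpansive[of a _ f _ f] in force)+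

lemma J_in: "0 < a \<Longrightarrow> (J a f, (f - J a f) /\<^sub>R a) \<in> L"
  using range[of a f] J_eqI by metis

lemma J_add: "0 < a \<Longrightarrow> J a (f + g) = J a f + J a g"
  using L_add[OF J_in J_in, of a a f g] by (intro J_eqI) (simp_all add: algebra_simps)

lemma J_scale: "0 < a \<Longrightarrow> J a (r *\<^sub>R f) = r *\<^sub>R J a f"
  using L_scale[OF J_in, of a r f] by (intro J_eqI) (simp_all add: algebra_simps)

lemma J_zero: "0 < a \<Longrightarrow> J a 0 = 0"
  using J_scale[of a 0 0] by simp

lemma norm_J: "0 < a \<Longrightarrow> norm (J a f) \<le> norm f"
  using resolvent_nonexpansive[OF _ J_in J_in, of a f 0] by (simp add: J_zero)

lemma contraction_J: "0 < a \<Longrightarrow> contraction (J a)"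
proof (rule contraction.intro)
  assume a: "0 < a"
  show "bounded_linear (J a)"
    by (rule bounded_linear_intro[where K = 1]) (simp_all add: J_add[OF a] J_scale[OF a] norm_J[OF a])
  show "norm (J a x) \<le> norm x" for x by (rule norm_J[OF a])
qed

text \<open>The Yosida approximation: a bounded operator whose value at \<open>f\<close> is that of
  \<open>L\<close> at the nearby point \<open>J a f\<close>.\<close>

definition "Y a f = (f - J a f) /\<^sub>R a"

lemma bounded_linear_Y: "0 < a \<Longrightarrow> bounded_linear (Y a)"
  unfolding Y_def[abs_def]
  by (intro bounded_linear_const_scaleR bounded_linear_sub bounded_linear_ident
      contraction.lin[OF contraction_J])

lemma Y_in: "0 < a \<Longrightarrow> (J a f, Y a f) \<in> L"
  unfolding Y_def by (rule J_in)

lemma Y_eq: "0 < a \<Longrightarrow> f = J a f + a *\<^sub>R Y a f"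
  by (simp add: Y_def)

text \<open>Since \<open>f\<close> is the resolvent of \<open>f + a *\<^sub>R h\<close>, the Yosida
  approximation on the domain is a resolvent of \<open>h\<close>, hence bounded by
  \<open>norm h\<close> for every \<open>a\<close>. The convergence estimates rest on this uniform
  bound.\<close>

lemma Y_dom:
  assumes a: "0 < a" and fh: "(f, h) \<in> L"
  shows "Y a f = J a h"
proof -
  have "J a (f + a *\<^sub>R h) = f" using assms by (intro J_eqI) simp_all
  then have "f = J a f + a *\<^sub>R J a h" by (simp add: J_add J_scale a)
  then have "f - J a f = a *\<^sub>R J a h" by (simp add: algebra_simps)
  then show ?thesis using a by (simp add: Y_def)
qed

text \<open>The exponential of \<open>- t\<close> times \<open>Y a\<close>: as \<open>Y a\<close> is
  (identity minus \<open>J a\<close>) divided by \<open>a\<close>, the Poisson parameter is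
  \<open>t / a\<close>.\<close>

definition "U a t = contraction.expm (J a) (t / a)"

lemma
  assumes a: "0 < a"
  shows U_0 [simp]: "U a 0 f = f"
    and U_add: "U a t (f + g) = U a t f + U a t g"
    and U_scale: "U a t (r *\<^sub>R f) = r *\<^sub>R U a t f"
    and U_deriv: "((\<lambda>t. U a t f) has_vector_derivative - Y a (U a t f)) (at t)"
    and U_Y: "Y a (U a t f) = U a t (Y a f)"
proof -
  interpret contraction "J a" by (rule contraction_J[OF a])
  show "U a 0 f = f" "U a t (f + g) = U a t f + U a t g" "U a t (r *\<^sub>R f) = r *\<^sub>R U a t f"
    by (simp_all add: U_def expm_add expm_scaleR)
  have "((\<lambda>s. s / a) has_vector_derivative (1 / a)) (at t)"
    using a by (auto intro!: derivative_eq_intros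
        simp flip: has_real_derivative_iff_has_vector_derivative)
  from vector_diff_chain_at[OF this expm_deriv, of f]
  show "((\<lambda>t. U a t f) has_vector_derivative - Y a (U a t f)) (at t)"
    unfolding U_def Y_def o_def
    by (rule has_vector_derivative_eq_rhs) (simp add: divide_inverse_commute scaleR_diff_right)
  show "Y a (U a t f) = U a t (Y a f)"
    unfolding U_def
    by (rule expm_commute[OF bounded_linear_Y[OF a]])
      (simp add: Y_def linear_simps[OF lin])
qed

lemma norm_U: "0 < a \<Longrightarrow> 0 \<le> t \<Longrightarrow> norm (U a t f) \<le> norm f"
  unfolding U_def by (rule contraction.norm_expm[OF contraction_J]) auto

lemma U_diff: "0 < a \<Longrightarrow> U a t (f - g) = U a t f - U a t g"
  using U_add[of a t f "- 1 *\<^sub>R g"] U_scale[of a t "-1" g] by simp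

text \<open>As functions of \<open>s\<close> both sides solve w' = - Y w with the same initial
  value, and the monotone operator \<open>Y a\<close> keeps the norm of their difference from
  growing. No product of exponential series is formed.\<close>

lemma U_semigroup:
  assumes a: "0 < a" and s: "0 \<le> s"
  shows "U a (s + t) f = U a s (U a t f)"
proof -
  define w where "w s = U a (s + t) f - U a s (U a t f)" for s
  have "(w has_vector_derivative - Y a (w r)) (at r)" for r
  proof -
    have "((\<lambda>r. U a (r + t) f) has_vector_derivative - Y a (U a (r + t) f)) (at r)"
      using vector_diff_chain_at[of "\<lambda>r. r + t" 1 r "\<lambda>t. U a t f", OF _ U_deriv[OF a]]
      by (simp add: o_def has_vector_derivative_add_const)
    from has_vector_derivative_diff[OF this U_deriv[OF a, of "U a t f" r]]
    show ?thesis
      unfolding w_def[abs_def]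
      by (rule has_vector_derivative_eq_rhs) (simp add: linear_simps[OF bounded_linear_Y[OF a]])
  qed
  moreover have "2 * (w r \<bullet> - Y a (w r)) \<le> 0" for r
  proof -
    \<comment> \<open>Splitting \<open>w r\<close> by \<open>Y_eq\<close> reduces monotonicity of
      \<open>Y a\<close> to that of \<open>L\<close>.\<close>
    have "w r \<bullet> Y a (w r) = J a (w r) \<bullet> Y a (w r) + a * (Y a (w r) \<bullet> Y a (w r))"
      by (subst Y_eq[OF a, of "w r"]) (simp only: inner_add_left inner_scaleR_left)
    also have "\<dots> \<ge> 0" using mono[OF Y_in[OF a]] a by simp
    finally show ?thesis by simp
  qed
  ultimately have "(norm (w s))\<^sup>2 \<le> (norm (w 0))\<^sup>2 + 0 * s"
    by (intro norm_square_growth[OF s]) auto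
  then have "w s = 0" using a by (simp add: w_def)
  then show ?thesis by (simp add: w_def)
qed

text \<open>The error estimate for the Yosida approximation only needs monotonicity at the points
  \<open>J a u\<close> and \<open>J b v\<close>, from which \<open>u\<close> and \<open>v\<close> differ by \<open>a *\<^sub>R Y a u\<close> and \<open>b *\<^sub>R Y b v\<close>.\<close>

lemma U_cauchy_dom:
  assumes a: "0 < a" and b: "0 < b" and t: "0 \<le> t" and fh: "(f, h) \<in> L"
  shows "(norm (U a t f - U b t f))\<^sup>2 \<le> 2 * (a + b) * (norm h)\<^sup>2 * t"
proof -
  define w where "w s = U a s f - U b s f" for s
  have "(w has_vector_derivative (Y b (U b s f) - Y a (U a s f))) (at s)" for s
    unfolding w_def[abs_def]
    by (rule has_vector_derivative_eq_rhs, (rule derivative_intros U_deriv a b)+) simp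
  moreover have "2 * (w s \<bullet> (Y b (U b s f) - Y a (U a s f))) \<le> 2 * (a + b) * (norm h)\<^sup>2"
    if s: "0 \<le> s" for s
  proof -
    define u v A B where "u = U a s f" "v = U b s f" "A = Y a u" "B = Y b v"
    note d = this
    have nA: "norm A \<le> norm h" and nB: "norm B \<le> norm h"
      unfolding d using a b s fh
      by (auto simp: U_Y Y_dom intro: order_trans[OF norm_U] norm_J)
    have "0 \<le> (J a u - J b v) \<bullet> (A - B)"
      using L_diff[OF Y_in[OF a] Y_in[OF b]] unfolding d by (rule mono)
    moreover have "u - v = (J a u - J b v) + (a *\<^sub>R A - b *\<^sub>R B)"
      using Y_eq[OF a, of u] Y_eq[OF b, of v] unfolding d by (simp add: algebra_simps)
    ultimately have "(u - v) \<bullet> (B - A) \<le> (a *\<^sub>R A - b *\<^sub>R B) \<bullet> (B - A)"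
      by (simp add: inner_add_left inner_diff_right)
    also have "\<dots> = (a + b) * (A \<bullet> B) - a * (A \<bullet> A) - b * (B \<bullet> B)"
      by (simp add: algebra_simps inner_commute)
    also have "\<dots> \<le> (a + b) * (A \<bullet> B)"
      using mult_nonneg_nonneg[of a "A \<bullet> A"] mult_nonneg_nonneg[of b "B \<bullet> B"] a b inner_ge_zero[of A] inner_ge_zero[of B]
      by linarith
    also have "A \<bullet> B \<le> norm h * norm h"
      using norm_cauchy_schwarz[of A B] mult_mono[OF nA nB] by simp
    finally have "(u - v) \<bullet> (B - A) \<le> (a + b) * (norm h)\<^sup>2"
      using a b by (simp add: power2_eq_square)
    then have "2 * ((u - v) \<bullet> (B - A)) \<le> 2 * (a + b) * (norm h)\<^sup>2"
      unfolding mult.assoc by (rule mult_left_mono) simp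
    then show ?thesis
      unfolding w_def d(1,2)[symmetric] d(3,4)[symmetric] .
  qed
  ultimately have "(norm (w t))\<^sup>2 \<le> (norm (w 0))\<^sup>2 + 2 * (a + b) * (norm h)\<^sup>2 * t"
    by (intro norm_square_growth[OF t]) auto
  then show ?thesis using a b by (simp add: w_def)
qed

lemma dense_approx: "e > 0 \<Longrightarrow> \<exists>g h. (g, h) \<in> L \<and> norm (f - g) < e"
proof -
  assume e: "e > 0"
  have "f \<in> closure (fst ` L)" by (simp add: dense)
  then obtain y where "y \<in> fst ` L" "dist y f < e"
    using e unfolding closure_approachable by blast
  then show ?thesis by (force simp: dist_norm norm_minus_commute)
qed

lemma U_cauchy:
  assumes e: "e > 0" and tau: "0 \<le> \<tau>"
  shows "\<exists>d>0. \<forall>a b t. 0 < a \<and> a < d \<and> 0 < b \<and> b < d \<and> 0 \<le> t \<and> t \<le> \<tau> \<longrightarrow> norm (U a t f - U b t f) < e"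
proof -
  obtain g h where gh: "(g, h) \<in> L" "norm (f - g) < e / 3"
    using dense_approx[of "e / 3" f] e by auto
  \<comment> \<open>Chosen so that \<open>4 * d * ((norm h)\<^sup>2 * \<tau> + 1)\<close> is the
    square of \<open>e / 3\<close>; the summand 1 covers \<open>h = 0\<close> and
    \<open>\<tau> = 0\<close>.\<close>
  define d where "d = (e / 3)\<^sup>2 / (4 * ((norm h)\<^sup>2 * \<tau> + 1))"
  have pos: "(norm h)\<^sup>2 * \<tau> + 1 > 0" using tau by (simp add: add_nonneg_pos)
  then have d0: "d > 0" using e by (simp add: d_def)
  have "norm (U a t f - U b t f) < e"
    if H: "0 < a" "a < d" "0 < b" "b < d" "0 \<le> t" "t \<le> \<tau>" for a b t
  proof -
    have "(norm (U a t g - U b t g))\<^sup>2 \<le> 2 * (a + b) * (norm h)\<^sup>2 * t"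
      using H by (intro U_cauchy_dom gh) auto
    also have "\<dots> = (2 * (a + b)) * ((norm h)\<^sup>2 * t)" by simp
    also have "\<dots> \<le> (4 * d) * ((norm h)\<^sup>2 * \<tau>)"
      using H d0 by (intro mult_mono[of "2 * (a + b)" "4 * d"]) (auto intro: mult_left_mono)
    also have "\<dots> < (4 * d) * ((norm h)\<^sup>2 * \<tau> + 1)" using d0 by simp
    also have "\<dots> = (e / 3)\<^sup>2" using pos by (simp add: d_def field_simps)
    finally have 1: "norm (U a t g - U b t g) < e / 3"
      by (rule power2_less_imp_less) (use e in simp)
    have "norm (U a t (f - g)) < e / 3" "norm (U b t (f - g)) < e / 3"
      using norm_U[of a t "f - g"] norm_U[of b t "f - g"] H gh by auto
    moreover have eq: "U a t f - U b t f = U a t (f - g) + (U a t g - U b t g) - U b t (f - g)"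
      using H by (simp add: U_diff)
    ultimately show ?thesis
      unfolding eq using 1 norm_triangle_ineq[of "U a t (f - g)" "U a t g - U b t g"]
        norm_triangle_ineq4[of "U a t (f - g) + (U a t g - U b t g)" "U b t (f - g)"] by linarith
  qed
  then show ?thesis using d0 by blast
qed

section \<open>The limit semigroup\<close>

definition "T t f = lim (\<lambda>n. U (inverse (real (Suc n))) t f)"

text \<open>The limit along a sequence defines \<open>T\<close>, but the Cauchy estimate makes the
  whole family converge, uniformly on bounded time intervals. The uniformity yields continuity in
  \<open>t\<close> afterwards.\<close>

lemma T_uniform:
  assumes e: "e > 0" and tau: "0 \<le> \<tau>"
  shows "\<exists>d>0. \<forall>a t. 0 < a \<and> a < d \<and> 0 \<le> t \<and> t \<le> \<tau> \<longrightarrow> norm (U a t f - T t f) \<le> e"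
proof -
  let ?s = "\<lambda>n. inverse (real (Suc n))"
  have small: "\<exists>N. \<forall>n\<ge>N. ?s n < d" if "d > 0" for d
    using LIMSEQ_inverse_real_of_nat that unfolding LIMSEQ_iff by fastforce
  have lim: "(\<lambda>n. U (?s n) t f) \<longlonglongrightarrow> T t f" if t: "0 \<le> t" for t
  proof -
    have "Cauchy (\<lambda>n. U (?s n) t f)"
    proof (rule CauchyI)
      fix e :: real assume "e > 0"
      then obtain d where d: "d > 0" "\<And>a b. 0 < a \<Longrightarrow> a < d \<Longrightarrow> 0 < b \<Longrightarrow> b < d \<Longrightarrow> norm (U a t f - U b t f) < e"
        using U_cauchy[of e t f] t by (meson order_refl)
      then show "\<exists>N. \<forall>m\<ge>N. \<forall>n\<ge>N. norm (U (?s m) t f - U (?s n) t f) < e"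
        using small[of d] by (metis inverse_positive_iff_positive of_nat_0_less_iff zero_less_Suc)
    qed
    then show ?thesis unfolding T_def by (simp add: Cauchy_convergent_iff convergent_LIMSEQ_iff)
  qed
  obtain d where d: "d > 0" "\<And>a b t. 0 < a \<Longrightarrow> a < d \<Longrightarrow> 0 < b \<Longrightarrow> b < d \<Longrightarrow> 0 \<le> t \<Longrightarrow> t \<le> \<tau>
      \<Longrightarrow> norm (U a t f - U b t f) < e"
    using U_cauchy[OF e tau, of f] by blast
  have "norm (U a t f - T t f) \<le> e" if H: "0 < a" "a < d" "0 \<le> t" "t \<le> \<tau>" for a t
  proof (rule LIMSEQ_le_const2)
    show "(\<lambda>n. norm (U a t f - U (?s n) t f)) \<longlonglongrightarrow> norm (U a t f - T t f)"
      using H by (intro tendsto_intros lim)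
    show "\<exists>N. \<forall>n\<ge>N. norm (U a t f - U (?s n) t f) \<le> e"
      using small[OF d(1)] d(2)[of a "?s _" t] H
      by (metis inverse_positive_iff_positive less_eq_real_def of_nat_0_less_iff zero_less_Suc)
  qed
  then show ?thesis using d(1) by blast
qed

lemma U_tendsto_T: "0 \<le> t \<Longrightarrow> ((\<lambda>a. U a t f) \<longlongrightarrow> T t f) (at_right 0)"
proof (rule tendstoI)
  fix e :: real assume "0 \<le> t" "0 < e"
  then obtain d where "d > 0" "\<And>a. 0 < a \<Longrightarrow> a < d \<Longrightarrow> norm (U a t f - T t f) \<le> e / 2"
    using T_uniform[of "e / 2" t f] by auto
  then show "\<forall>\<^sub>F a in at_right 0. dist (U a t f) (T t f) < e"
    unfolding eventually_at_right_field
    using \<open>0 < e\<close> by (intro exI[of _ d]) (force simp: dist_norm)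
qed

lemma ev_pos: "\<forall>\<^sub>F a::real in at_right 0. 0 < a"
  by (simp add: eventually_at_right_less)

lemma T_0 [simp]: "T 0 f = f"
  by (rule tendsto_unique[OF _ U_tendsto_T])
    (auto intro!: tendsto_eventually eventually_mono[OF ev_pos])

lemma T_add: "0 \<le> t \<Longrightarrow> T t (f + g) = T t f + T t g"
  by (rule tendsto_unique[OF _ U_tendsto_T Lim_transform_eventually[OF tendsto_add[OF U_tendsto_T U_tendsto_T]]])
    (auto intro!: eventually_mono[OF ev_pos] simp: U_add)

lemma T_scale: "0 \<le> t \<Longrightarrow> T t (r *\<^sub>R f) = r *\<^sub>R T t f"
  by (rule tendsto_unique[OF _ U_tendsto_T Lim_transform_eventually[OF tendsto_scaleR[OF tendsto_const U_tendsto_T]]])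
    (auto intro!: eventually_mono[OF ev_pos] simp: U_scale)

lemma norm_T: "0 \<le> t \<Longrightarrow> norm (T t f) \<le> norm f"
  by (rule tendsto_upperbound[OF tendsto_norm[OF U_tendsto_T]])
    (auto intro!: eventually_mono[OF ev_pos] simp: norm_U)

lemma bounded_linear_T: "0 \<le> t \<Longrightarrow> bounded_linear (T t)"
  by (rule bounded_linear_intro[where K = 1]) (auto simp: T_add T_scale norm_T)

text \<open>\<open>U a s (U a t f)\<close> differs from \<open>U a s (T t f)\<close> by the image of
  a null family, which stays null because \<open>U a s\<close> is a contraction.\<close>

lemma T_semigroup:
  assumes s: "0 \<le> s" and t: "0 \<le> t"
  shows "T (s + t) f = T s (T t f)"
proof -
  have "((\<lambda>a. norm (U a t f - T t f)) \<longlongrightarrow> 0) (at_right 0)"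
    using tendsto_diff[OF U_tendsto_T[OF t, of f] tendsto_const[of "T t f"]]
    by (simp add: tendsto_norm_zero)
  then have "((\<lambda>a. U a s (U a t f - T t f)) \<longlongrightarrow> 0) (at_right 0)"
    by (rule Lim_null_comparison[rotated]) (auto intro!: eventually_mono[OF ev_pos] norm_U s)
  from tendsto_add[OF this U_tendsto_T[OF s, of "T t f"]]
  have "((\<lambda>a. U a (s + t) f) \<longlongrightarrow> 0 + T s (T t f)) (at_right 0)"
    by (rule Lim_transform_eventually)
      (auto intro!: eventually_mono[OF ev_pos] simp: U_semigroup s t U_diff)
  then show ?thesis
    using tendsto_unique[OF _ U_tendsto_T] s t by fastforce
qed

lemma T_continuous: "continuous_on {0..\<tau>} (\<lambda>t. T t f)"
proof (cases "0 \<le> \<tau>")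
  case True
  have "uniform_limit {0..\<tau>} (\<lambda>a t. U a t f) (\<lambda>t. T t f) (at_right 0)"
  proof (rule uniform_limitI)
    fix e :: real assume e: "0 < e"
    then obtain d where "d > 0" "\<And>a t. 0 < a \<Longrightarrow> a < d \<Longrightarrow> 0 \<le> t \<Longrightarrow> t \<le> \<tau> \<Longrightarrow> norm (U a t f - T t f) \<le> e / 2"
      using T_uniform[of "e / 2" \<tau> f] True by auto
    then show "\<forall>\<^sub>F a in at_right 0. \<forall>t\<in>{0..\<tau>}. dist (U a t f) (T t f) < e"
      unfolding eventually_at_right_field
      using e by (intro exI[of _ d]) (force simp: dist_norm)
  qed
  moreover have "\<forall>\<^sub>F a in at_right 0. continuous_on {0..\<tau>} (\<lambda>t. U a t f)"
    by (rule eventually_mono[OF ev_pos])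
      (auto intro!: continuous_at_imp_continuous_on has_vector_derivative_continuous[OF U_deriv])
  ultimately show ?thesis by (intro uniform_limit_theorem[of _ _ "at_right 0"]) auto
qed auto

section \<open>Strong limits at zero and the generator\<close>

lemma T_continuous_0: "((\<lambda>t. T t f) \<longlongrightarrow> f) (at_right 0)"
proof -
  have "((\<lambda>t. T t f) \<longlongrightarrow> T 0 f) (at 0 within {0..1})"
    using T_continuous[of 1 f] unfolding continuous_on_def by (metis atLeastAtMost_iff order_refl zero_le_one)
  then show ?thesis by (simp add: at_within_Icc_at_right)
qed

text \<open>On the domain the error is \<open>a * norm (J a h)\<close>, at most
  \<open>a * norm h\<close>; density and the contraction bound carry the limit over to all
  \<open>f\<close>.\<close>

lemma J_tendsto: "((\<lambda>a. J a f) \<longlongrightarrow> f) (at_right 0)"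
proof (rule tendstoI)
  fix e :: real assume e: "0 < e"
  obtain g h where gh: "(g, h) \<in> L" "norm (f - g) < e / 3"
    using dense_approx[of "e / 3" f] e by auto
  define d where "d = e / 3 / (norm h + 1)"
  have np: "norm h + 1 > 0" by (simp add: add_nonneg_pos)
  have "dist (J a f) f < e" if a: "0 < a" "a < d" for a
  proof -
    have "norm (g - J a g) = a * norm (J a h)"
      using Y_eq[OF a(1), of g] Y_dom[OF a(1) gh(1)] a
      by (metis add_diff_cancel_left' abs_of_pos norm_scaleR)
    also have "\<dots> \<le> a * norm h" using a by (simp add: norm_J)
    also have "\<dots> < d * (norm h + 1)"
      using a np by (intro mult_strict_mono) auto
    also have "\<dots> = e / 3" using np unfolding d_def by (metis less_irrefl nonzero_eq_divide_eq)
    finally have 1: "norm (g - J a g) < e / 3" .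
    have 2: "norm (J a (f - g)) < e / 3" using norm_J[OF a(1), of "f - g"] gh by simp
    have "J a f - f = J a (f - g) - (g - J a g) - (f - g)"
      using J_add[OF a(1), of "f - g" g] by simp
    then show ?thesis
      using 1 2 gh(2) norm_triangle_ineq4[of "J a (f - g) - (g - J a g)" "f - g"]
        norm_triangle_ineq4[of "J a (f - g)" "g - J a g"] by (simp add: dist_norm)
  qed
  moreover have "d > 0" using e np by (simp add: d_def)
  ultimately show "\<forall>\<^sub>F a in at_right 0. dist (J a f) f < e"
    unfolding eventually_at_right_field by auto
qed

text \<open>The mean value inequality is applied before the limit in \<open>a\<close>: the curve
  \<open>U a s f + s *\<^sub>R h\<close> has derivative \<open>h - U a s (J a h)\<close>, which is
  small for small \<open>s\<close> and \<open>a\<close>.\<close>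

lemma T_generator:
  assumes fh: "(f, h) \<in> L"
  shows "((\<lambda>t. (T t f - f) /\<^sub>R t) \<longlongrightarrow> - h) (at_right 0)"
proof (rule tendstoI)
  fix e :: real assume e: "0 < e"
  have "\<forall>\<^sub>F t in at_right 0. dist (T t h) h < e / 4"
    using tendstoD[OF T_continuous_0, of "e / 4" h] e by (simp del: less_divide_eq_numeral1)
  then obtain \<tau> where \<tau>: "\<tau> > 0" "\<And>t. 0 < t \<Longrightarrow> t < \<tau> \<Longrightarrow> norm (T t h - h) < e / 4"
    unfolding eventually_at_right_field dist_norm by auto
  obtain d where d: "d > 0" "\<And>a t. 0 < a \<Longrightarrow> a < d \<Longrightarrow> 0 \<le> t \<Longrightarrow> t \<le> \<tau> \<Longrightarrow> norm (U a t h - T t h) \<le> e / 4"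
    using T_uniform[of "e / 4" \<tau> h] e \<tau> by auto
  \<comment> \<open>The factor \<open>3 * e / 4\<close> collects three errors: replacing
    \<open>J a h\<close> by \<open>h\<close>, then \<open>U a s h\<close> by \<open>T s h\<close>,
    then \<open>T s h\<close> by \<open>h\<close>.\<close>
  have "norm (T t f - f + t *\<^sub>R h) \<le> t * (3 * e / 4)" if t: "0 < t" "t < \<tau>" for t
  proof (rule tendsto_upperbound)
    show "((\<lambda>a. norm (U a t f - f + t *\<^sub>R h)) \<longlongrightarrow> norm (T t f - f + t *\<^sub>R h)) (at_right 0)"
      using t by (intro tendsto_intros U_tendsto_T) auto
    have "\<forall>\<^sub>F a in at_right 0. 0 < a \<and> a < d \<and> dist (J a h) h < e / 4"
      using tendstoD[OF J_tendsto, of "e / 4" h] e d(1) ev_pos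
      by (auto simp: eventually_conj_iff intro: eventually_at_rightI[of 0 d])
    then show "\<forall>\<^sub>F a in at_right 0. norm (U a t f - f + t *\<^sub>R h) \<le> t * (3 * e / 4)"
    proof eventually_elim
      case (elim a)
      then have a: "0 < a" "a < d" by auto
      have "norm ((U a t f + t *\<^sub>R h) - (U a 0 f + 0 *\<^sub>R h)) \<le> (3 * e / 4) * norm (t - 0)"
      proof (rule differentiable_bound[of "{0..t}" _ "\<lambda>s y. y *\<^sub>R (h - U a s (J a h))"])
        fix s assume s: "s \<in> {0..t}"
        have "((\<lambda>s. U a s f + s *\<^sub>R h) has_vector_derivative (h - U a s (J a h))) (at s)"
          by (rule has_vector_derivative_eq_rhs, (rule derivative_intros U_deriv a)+)
            (simp add: U_Y Y_dom[OF _ fh] a)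
        then show "((\<lambda>s. U a s f + s *\<^sub>R h) has_derivative (\<lambda>y. y *\<^sub>R (h - U a s (J a h)))) (at s within {0..t})"
          using has_vector_derivative_at_within has_vector_derivative_def by blast
        have "norm (U a s (J a h - h)) < e / 4"
          using norm_U[of a s "J a h - h"] elim s a by (auto simp: dist_norm)
        moreover have "norm (U a s h - T s h) \<le> e / 4" using d(2) a s t by auto
        moreover have "norm (T s h - h) \<le> e / 4"
          using \<tau>(2)[of s] s t e by (cases "s = 0") auto
        moreover have "h - U a s (J a h) = - (U a s (J a h - h) + (U a s h - T s h) + (T s h - h))"
          using a by (simp add: U_diff)
        ultimately have "norm (h - U a s (J a h)) \<le> 3 * e / 4"
          using norm_triangle_ineq[of "U a s (J a h - h) + (U a s h - T s h)" "T s h - h"]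
            norm_triangle_ineq[of "U a s (J a h - h)" "U a s h - T s h"]
          by (simp only: norm_minus_cancel)
        then show "onorm (\<lambda>y. y *\<^sub>R (h - U a s (J a h))) \<le> 3 * e / 4"
          using e by (intro onorm_le) (metis abs_ge_zero mult.commute mult_right_mono norm_scaleR real_norm_def)
      qed (use t in auto)
      then show ?case using t a by (simp add: algebra_simps)
    qed
  qed auto
  then have "dist ((T t f - f) /\<^sub>R t) (- h) < e" if t: "0 < t" "t < \<tau>" for t
  proof -
    have "(T t f - f) /\<^sub>R t - (- h) = (T t f - f + t *\<^sub>R h) /\<^sub>R t" using t by (simp add: algebra_simps)
    then have "norm ((T t f - f) /\<^sub>R t - (- h)) = norm (T t f - f + t *\<^sub>R h) / t"
      using t by (simp add: divide_inverse_commute)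
    also have "\<dots> \<le> 3 * e / 4"
      using \<open>\<And>t. 0 < t \<Longrightarrow> t < \<tau> \<Longrightarrow> norm (T t f - f + t *\<^sub>R h) \<le> t * (3 * e / 4)\<close>[OF t] t
      by (simp add: divide_le_eq mult.commute)
    finally show ?thesis using e by (simp add: dist_norm)
  qed
  then show "\<forall>\<^sub>F t in at_right 0. dist ((T t f - f) /\<^sub>R t) (- h) < e"
    unfolding eventually_at_right_field using \<tau>(1) by blast
qed

text \<open>A dissipative extension of \<open>- L\<close> coincides with \<open>- L\<close>, because \<open>1 + L\<close> is onto.\<close>

lemma generator_T:
  assumes lim: "((\<lambda>t. (T t f - f) /\<^sub>R t) \<longlongrightarrow> g) (at_right 0)"
  shows "(f, - g) \<in> L"
proof -
  \<comment> \<open>\<open>u\<close> solves (1 + L) u = f - g, so the difference quotients of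
    \<open>x = f - u\<close> converge to \<open>x\<close> itself, while the contraction property
    makes their inner products with \<open>x\<close> nonpositive. Hence
    \<open>x = 0\<close>.\<close>
  obtain u where u: "(u, (f - g) - u) \<in> L" using range[of 1 "f - g"] by auto
  define x where "x = f - u"
  have "((\<lambda>t. (T t f - f) /\<^sub>R t - (T t u - u) /\<^sub>R t) \<longlongrightarrow> g - - ((f - g) - u)) (at_right 0)"
    by (intro tendsto_diff lim T_generator u)
  then have "((\<lambda>t. (T t x - x) /\<^sub>R t) \<longlongrightarrow> x) (at_right 0)"
    unfolding x_def
    by (rule Lim_transform_eventually[THEN tendsto_eq_rhs])
      (auto intro!: eventually_mono[OF ev_pos] simp: linear_simps[OF bounded_linear_T] algebra_simps)
  then have "((\<lambda>t. x \<bullet> ((T t x - x) /\<^sub>R t)) \<longlongrightarrow> x \<bullet> x) (at_right 0)"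
    by (intro tendsto_intros)
  then have "x \<bullet> x \<le> 0"
  proof (rule tendsto_upperbound)
    have "x \<bullet> ((T t x - x) /\<^sub>R t) \<le> 0" if t: "0 < t" for t
    proof -
      have "x \<bullet> T t x \<le> x \<bullet> x"
        using norm_cauchy_schwarz[of x "T t x"] mult_left_mono[OF norm_T[of t x], of "norm x"] t
        by (simp flip: power2_norm_eq_inner power2_eq_square)
      then show ?thesis using t by (simp add: inner_diff_right mult_le_0_iff)
    qed
    then show "\<forall>\<^sub>F t in at_right 0. x \<bullet> ((T t x - x) /\<^sub>R t) \<le> 0"
      by (intro eventually_mono[OF ev_pos])
  qed auto
  then have "x = 0" using inner_gt_zero_iff[of x] by linarith
  then show ?thesis using u by (simp add: x_def)
qed

lemma T_symmetric:
  assumes J: "\<And>a x y. 0 < a \<Longrightarrow> J a x \<bullet> y = x \<bullet> J a y" and t: "0 \<le> t"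
  shows "T t f \<bullet> g = f \<bullet> T t g"
proof (rule tendsto_unique)
  show "((\<lambda>a. U a t f \<bullet> g) \<longlongrightarrow> T t f \<bullet> g) (at_right 0)"
    by (intro tendsto_intros U_tendsto_T t)
  have "((\<lambda>a. f \<bullet> U a t g) \<longlongrightarrow> f \<bullet> T t g) (at_right 0)"
    by (intro tendsto_intros U_tendsto_T t)
  then show "((\<lambda>a. U a t f \<bullet> g) \<longlongrightarrow> f \<bullet> T t g) (at_right 0)"
  proof (rule Lim_transform_eventually)
    have "U a t f \<bullet> g = f \<bullet> U a t g" if "0 < a" for a
      unfolding U_def using that t by (intro contraction.expm_sym[OF contraction_J] J) auto
    then show "\<forall>\<^sub>F a in at_right 0. f \<bullet> U a t g = U a t f \<bullet> g"
      by (intro eventually_mono[OF ev_pos]) simp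
  qed
qed auto

text \<open>A closed half-space containing all resolvent iterates of \<open>f\<close> contains their
  Poisson means and then the limit \<open>T t f\<close>. Order bounds at a vertex are of this
  form.\<close>

lemma T_functional_le:
  fixes \<phi> :: "'a \<Rightarrow> real"
  assumes \<phi>: "bounded_linear \<phi>" and le: "\<And>a k. 0 < a \<Longrightarrow> \<phi> ((J a ^^ k) f) \<le> c" and t: "0 \<le> t"
  shows "\<phi> (T t f) \<le> c"
proof (rule tendsto_upperbound)
  show "((\<lambda>a. \<phi> (U a t f)) \<longlongrightarrow> \<phi> (T t f)) (at_right 0)"
    by (intro bounded_linear.tendsto[OF \<phi>] U_tendsto_T t)
  have "\<phi> (U a t f) \<le> c" if "0 < a" for a
    unfolding U_def using that t by (intro contraction.expm_bl_le[OF contraction_J \<phi>] le) auto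
  then show "\<forall>\<^sub>F a in at_right 0. \<phi> (U a t f) \<le> c"
    by (rule eventually_mono[OF ev_pos])
qed auto

end

section \<open>Uniqueness of the semigroup\<close>

text \<open>Banach-Steinhaus by Baire: the closed sets \<open>F k\<close> exhaust the space, so one
  of them contains a ball, and subtracting the image of its centre bounds the operators near
  0.\<close>

lemma uniform_boundedness:
  fixes A :: "nat \<Rightarrow> 'a::banach \<Rightarrow> 'b::real_normed_vector"
  assumes lin: "\<And>n. bounded_linear (A n)" and bdd: "\<And>x. \<exists>K. \<forall>n. norm (A n x) \<le> K"
  shows "\<exists>M. \<forall>n x. norm (A n x) \<le> M * norm x"
proof -
  define F where "F k = {x. \<forall>n. norm (A n x) \<le> real k}" for k
  have cl: "closed (F k)" for k
    unfolding F_def Collect_all_eq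
    by (intro closed_INT ballI closed_Collect_le continuous_intros)
      (auto intro!: linear_continuous_on lin)
  have un: "(\<Union>k. F k) = UNIV"
  proof -
    have "\<exists>k. x \<in> F k" for x
    proof -
      obtain K where "\<And>n. norm (A n x) \<le> K" using bdd by blast
      then show ?thesis
        unfolding F_def using real_arch_simple[of K] by (auto intro: order_trans)
    qed
    then show ?thesis by auto
  qed
  have "\<exists>k. interior (F k) \<noteq> {}"
  proof (rule ccontr)
    assume "\<not> ?thesis"
    then have *: "closedin euclidean S \<and> euclidean interior_of S = {}" if "S \<in> range F" for S
      using that cl by auto
    have "(euclidean :: 'a topology) interior_of \<Union> (range F) = {}"
      by (rule Baire_category_alt) (use * in \<open>auto simp: completely_metrizable_space_euclidean\<close>)
    then show False using un by simp
  qed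
  then obtain k x0 where "x0 \<in> interior (F k)" by blast
  then obtain r where r: "r > 0" "cball x0 r \<subseteq> F k"
    using open_contains_cball[of "interior (F k)"] interior_subset by blast
  have "norm (A n x) \<le> (2 * real k / r) * norm x" for n x
  proof (cases "x = 0")
    case True
    then show ?thesis by (simp add: linear_simps[OF lin])
  next
    case False
    \<comment> \<open>Rescaled to the radius of the ball, so that \<open>A n y\<close> is a
      difference of two images of norm at most \<open>k\<close>.\<close>
    define y where "y = (r / norm x) *\<^sub>R x"
    have "norm y = r" using False r by (simp add: y_def)
    then have "x0 + y \<in> F k" "x0 \<in> F k" using r by (auto simp: subset_iff dist_norm)
    then have "norm (A n (x0 + y)) \<le> k" "norm (A n x0) \<le> k" by (auto simp: F_def)
    moreover have "A n y = A n (x0 + y) - A n x0" by (simp add: linear_simps[OF lin])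
    ultimately have "norm (A n y) \<le> 2 * real k"
      using norm_triangle_ineq4[of "A n (x0 + y)" "A n x0"] by simp
    moreover have "norm (A n y) = (r / norm x) * norm (A n x)"
      using r by (simp add: y_def linear_simps[OF lin])
    ultimately show ?thesis using False r by (simp add: field_simps)
  qed
  then show ?thesis by blast
qed

text \<open>Orbits of semigroups are differentiated from the right only. A linear slack
  \<open>e * t\<close> exceeds the right slope strictly, so the last time at which the slackened
  inequality holds cannot lie before \<open>b\<close>.\<close>

lemma right_derivative_nonpos_decreasing:
  fixes \<phi> :: "real \<Rightarrow> real"
  assumes b: "0 \<le> b" and cont: "continuous_on {0..b} \<phi>"
    and d: "\<And>t. 0 \<le> t \<Longrightarrow> t < b \<Longrightarrow> \<exists>d\<le>0. ((\<lambda>h. (\<phi> (t + h) - \<phi> t) / h) \<longlongrightarrow> d) (at_right 0)"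
  shows "\<phi> b \<le> \<phi> 0"
proof (rule field_le_epsilon)
  fix e' :: real assume "0 < e'"
  \<comment> \<open>This ensures \<open>e * b \<le> e'\<close>; the summand 1 covers
    \<open>b = 0\<close>.\<close>
  define e where "e = e' / (b + 1)"
  have e: "0 < e" using b \<open>0 < e'\<close> by (simp add: e_def)
  define A where "A = {t \<in> {0..b}. \<phi> t - e * t \<le> \<phi> 0}"
  have "closed A"
    unfolding A_def by (intro continuous_closed_preimage_constant continuous_on_closed_Collect_le continuous_intros cont closed_real_atLeastAtMost)
  then have "compact A"
    by (auto simp: A_def compact_eq_bounded_closed intro: bounded_subset[of "{0..b}"])
  moreover have "A \<noteq> {}" using b by (auto simp: A_def)
  ultimately obtain s where s: "s \<in> A" "\<And>t. t \<in> A \<Longrightarrow> t \<le> s"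
    using compact_attains_sup by metis
  have "s = b"
  proof (rule ccontr)
    assume "s \<noteq> b"
    then have sb: "0 \<le> s" "s < b" using s by (auto simp: A_def)
    obtain d where d: "d \<le> 0" "((\<lambda>h. (\<phi> (s + h) - \<phi> s) / h) \<longlongrightarrow> d) (at_right 0)"
      using d[OF sb] by blast
    have "\<forall>\<^sub>F h in at_right 0. (\<phi> (s + h) - \<phi> s) / h < e"
      by (rule order_tendstoD[OF d(2)]) (use d e in linarith)
    moreover have "\<forall>\<^sub>F h in at_right 0. 0 < h \<and> h < b - s"
      using sb by (auto simp: eventually_at_right_field intro: exI[of _ "b - s"])
    ultimately have "\<forall>\<^sub>F h in at_right 0. (\<phi> (s + h) - \<phi> s) / h < e \<and> 0 < h \<and> h < b - s"
      by (rule eventually_conj)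
    then obtain h where h: "(\<phi> (s + h) - \<phi> s) / h < e" "0 < h" "h < b - s"
      using eventually_happens[of _ "at_right (0::real)"] by auto
    then have "\<phi> (s + h) - \<phi> s < e * h" by (simp add: divide_less_eq)
    then have "s + h \<in> A" using s h sb by (auto simp: A_def algebra_simps)
    then show False using s(2)[of "s + h"] h by simp
  qed
  then have "\<phi> b \<le> \<phi> 0 + e * b" using s by (auto simp: A_def)
  also have "e * b \<le> e'" using b \<open>0 < e'\<close> by (simp add: e_def field_simps)
  finally show "\<phi> b \<le> \<phi> 0 + e'" by simp
qed

text \<open>Without a bound near 0 there are times \<open>t n\<close> tending to 0 whose operators
  violate ever larger bounds, whereas strong continuity bounds every sequence
  \<open>S (t n) g\<close>; this contradicts Banach-Steinhaus. The semigroup law then propagates the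
  bound in steps of length \<open>d\<close>.\<close>

lemma c0_locally_bounded:
  fixes S :: "real \<Rightarrow> 'a::banach \<Rightarrow> 'a"
  assumes lin: "\<And>t. 0 \<le> t \<Longrightarrow> bounded_linear (S t)"
    and S0: "\<And>f. S 0 f = f"
    and add: "\<And>s t f. 0 \<le> s \<Longrightarrow> 0 \<le> t \<Longrightarrow> S (s + t) f = S s (S t f)"
    and c0: "\<And>f. ((\<lambda>t. S t f) \<longlongrightarrow> f) (at_right 0)"
  shows "\<exists>M\<ge>0. \<forall>t\<in>{0..\<tau>}. \<forall>f. norm (S t f) \<le> M * norm f"
proof -
  have "\<exists>d>0. \<exists>M. \<forall>t\<in>{0..d}. \<forall>f. norm (S t f) \<le> M * norm f"
  proof (rule ccontr)
    assume H: "\<not> ?thesis"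
    have "\<exists>t f. 0 \<le> t \<and> t \<le> inverse (real (Suc n)) \<and> \<not> norm (S t f) \<le> real n * norm f" for n
    proof -
      have "0 < inverse (real (Suc n))" by simp
      then have "\<exists>t\<in>{0..inverse (real (Suc n))}. \<exists>f. \<not> norm (S t f) \<le> real n * norm f"
        using H by blast
      then show ?thesis by auto
    qed
    then obtain t f where t: "\<And>n. 0 \<le> t n" "\<And>n. t n \<le> inverse (real (Suc n))"
        "\<And>n. \<not> norm (S (t n) (f n)) \<le> real n * norm (f n)"
      by metis
    have t0: "t \<longlonglongrightarrow> 0"
      by (rule tendsto_sandwich[OF _ _ tendsto_const LIMSEQ_inverse_real_of_nat])
        (use t(1,2) in auto)
    have "\<exists>K. \<forall>n. norm (S (t n) g) \<le> K" for g
    proof -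
      have "(\<lambda>n. S (t n) g) \<longlonglongrightarrow> g"
      proof (rule tendstoI)
        fix e :: real assume e: "0 < e"
        obtain b where b: "0 < b" "\<And>s. 0 < s \<Longrightarrow> s < b \<Longrightarrow> dist (S s g) g < e"
          using tendstoD[OF c0 e, of g] unfolding eventually_at_right_field by auto
        have "\<forall>\<^sub>F n in sequentially. t n < b" by (rule order_tendstoD[OF t0]) (rule b)
        then show "\<forall>\<^sub>F n in sequentially. dist (S (t n) g) g < e"
        proof eventually_elim
          case (elim n)
          then show ?case using b(2)[of "t n"] t(1)[of n] S0[of g] e by (cases "t n = 0") auto
        qed
      qed
      then have "Bseq (\<lambda>n. S (t n) g)" using convergentI convergent_imp_Bseq by blast
      then show ?thesis by (auto simp: Bseq_def)
    qed
    then obtain M where M: "\<And>n g. norm (S (t n) g) \<le> M * norm g"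
      using uniform_boundedness[of "\<lambda>n. S (t n)"] lin t(1) by blast
    obtain n where n: "M \<le> real n" using real_arch_simple by blast
    then have "norm (S (t n) (f n)) \<le> real n * norm (f n)"
      using M[of n "f n"] mult_right_mono[OF n norm_ge_zero[of "f n"]] by linarith
    then show False using t(3) by blast
  qed
  then obtain d M0 where d: "d > 0" and M0: "\<And>t f. 0 \<le> t \<Longrightarrow> t \<le> d \<Longrightarrow> norm (S t f) \<le> M0 * norm f"
    by (metis atLeastAtMost_iff)
  \<comment> \<open>At least 1, so that its powers increase with the number of steps.\<close>
  define M where "M = max M0 1"
  have M: "norm (S t f) \<le> M * norm f" if "0 \<le> t" "t \<le> d" for t f
    using M0[OF that, of f] mult_right_mono[of M0 M "norm f"] by (simp add: M_def)
  have M1: "1 \<le> M" by (simp add: M_def)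
  have iter: "norm (S t f) \<le> M ^ Suc n * norm f" if "0 \<le> t" "t \<le> real (Suc n) * d" for n t f
    using that
  proof (induction n arbitrary: t)
    case 0
    then show ?case using M by simp
  next
    case (Suc n)
    show ?case
    proof (cases "t \<le> d")
      case True
      have "M ^ 1 \<le> M ^ Suc (Suc n)" by (rule power_increasing[OF _ M1]) simp
      then have "M * norm f \<le> M ^ Suc (Suc n) * norm f" by (simp add: mult_right_mono)
      then show ?thesis using M[of t f] True Suc.prems by linarith
    next
      case False
      have "norm (S t f) = norm (S d (S (t - d) f))"
        using add[of d "t - d" f] False d by simp
      also have "\<dots> \<le> M * norm (S (t - d) f)" using M[of d "S (t - d) f"] d by simp
      also have "\<dots> \<le> M * (M ^ Suc n * norm f)"
        using Suc.IH[of "t - d"] Suc.prems False M1 by (intro mult_left_mono) (auto simp: algebra_simps)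
      finally show ?thesis by simp
    qed
  qed
  obtain n where "\<tau> / d \<le> real n" using real_arch_simple by blast
  then have "\<tau> \<le> real (Suc n) * d" using d by (simp add: divide_le_eq algebra_simps)
  then show ?thesis
    using iter[of _ n] M1 by (intro exI[of _ "M ^ Suc n"]) force
qed

text \<open>The increment from \<open>s\<close> to \<open>s + r\<close> is \<open>S s\<close>
  applied to \<open>S r f - f\<close>, so the local bound makes the estimate uniform in
  \<open>s\<close>. With the smaller of two times as base point this includes continuity from the
  left.\<close>

lemma c0_continuous:
  fixes S :: "real \<Rightarrow> 'a::banach \<Rightarrow> 'a"
  assumes lin: "\<And>t. 0 \<le> t \<Longrightarrow> bounded_linear (S t)"
    and S0: "\<And>f. S 0 f = f"
    and add: "\<And>s t f. 0 \<le> s \<Longrightarrow> 0 \<le> t \<Longrightarrow> S (s + t) f = S s (S t f)"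
    and c0: "\<And>f. ((\<lambda>t. S t f) \<longlongrightarrow> f) (at_right 0)"
  shows "continuous_on {0..\<tau>} (\<lambda>t. S t f)"
  unfolding continuous_on_iff
proof (intro ballI allI impI)
  fix x e :: real assume x: "x \<in> {0..\<tau>}" and e: "0 < e"
  obtain M where M: "0 \<le> M" "\<And>t f. 0 \<le> t \<Longrightarrow> t \<le> \<tau> \<Longrightarrow> norm (S t f) \<le> M * norm f"
    using c0_locally_bounded[OF lin S0 add c0, of \<tau>] by auto
  have "e / (M + 1) > 0" using e M by simp
  from tendstoD[OF c0 this, of f]
  obtain b where b: "0 < b" "\<And>s. 0 < s \<Longrightarrow> s < b \<Longrightarrow> dist (S s f) f < e / (M + 1)"
    unfolding eventually_at_right_field by auto
  have *: "dist (S (s + r) f) (S s f) < e" if "0 \<le> s" "s \<le> \<tau>" "0 < r" "r < b" for s r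
  proof -
    have "dist (S (s + r) f) (S s f) = norm (S s (S r f - f))"
      using that by (simp add: dist_norm add linear_simps[OF lin])
    also have "\<dots> \<le> M * norm (S r f - f)" using that M by simp
    also have "\<dots> \<le> (M + 1) * norm (S r f - f)" by (simp add: mult_right_mono)
    also have "\<dots> < (M + 1) * (e / (M + 1))"
      using b(2)[OF that(3,4)] M unfolding dist_norm by (intro mult_strict_left_mono) auto
    also have "\<dots> = e" using M by simp
    finally show ?thesis .
  qed
  have "dist (S y f) (S x f) < e" if "y \<in> {0..\<tau>}" "dist y x < b" for y
  proof (cases y x rule: linorder_cases)
    case less
    then show ?thesis using *[of y "x - y"] x that by (simp add: dist_commute dist_real_def)
  next
    case greater
    then show ?thesis using *[of x "y - x"] x that by (simp add: dist_real_def)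
  qed (use e in simp)
  then show "\<exists>d>0. \<forall>x'\<in>{0..\<tau>}. dist x' x < d \<longrightarrow> dist (S x' f) (S x f) < e"
    using b(1) by blast
qed

context maximal_monotone
begin

text \<open>Two solutions of \<open>w' = - L w\<close> are compared by means of \<open>\<parallel>w\<parallel>\<^sup>2\<close>, which has a nonpositive
  right derivative.\<close>

lemma semigroup_unique:
  assumes lin: "\<And>t. 0 \<le> t \<Longrightarrow> bounded_linear (S t)"
    and S0: "\<And>f. S 0 f = f"
    and add: "\<And>s t f. 0 \<le> s \<Longrightarrow> 0 \<le> t \<Longrightarrow> S (s + t) f = S s (S t f)"
    and c0: "\<And>f. ((\<lambda>t. S t f) \<longlongrightarrow> f) (at_right 0)"
    and gen: "\<And>f g. ((\<lambda>t. (S t f - f) /\<^sub>R t) \<longlongrightarrow> g) (at_right 0) \<longleftrightarrow> (f, - g) \<in> L"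
    and \<tau>: "0 \<le> \<tau>"
  shows "S \<tau> f = T \<tau> f"
proof -
  have dom: "S \<tau> f = T \<tau> f" if fk: "(f, k) \<in> L" for f k
  proof -
    define w where "w t = S t f - T t f" for t
    have cont: "continuous_on {0..\<tau>} w"
      unfolding w_def[abs_def] by (intro continuous_intros c0_continuous[OF lin S0 add c0] T_continuous)
    \<comment> \<open>Stated for a general \<open>V\<close> because it serves both \<open>S\<close>
      and \<open>T\<close>: an orbit that starts in the domain stays there, and its right derivative
      at \<open>t\<close> is \<open>V t (- k)\<close>.\<close>
    have right: "((\<lambda>h. (V (t + h) f - V t f) /\<^sub>R h) \<longlongrightarrow> V t (- k)) (at_right 0) \<and> (V t f, V t k) \<in> L"
      if t: "0 \<le> t" and V: "\<And>t. 0 \<le> t \<Longrightarrow> bounded_linear (V t)"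
        "\<And>s t f. 0 \<le> s \<Longrightarrow> 0 \<le> t \<Longrightarrow> V (s + t) f = V s (V t f)"
        "((\<lambda>t. (V t f - f) /\<^sub>R t) \<longlongrightarrow> - k) (at_right 0)"
        "\<And>f g. ((\<lambda>t. (V t f - f) /\<^sub>R t) \<longlongrightarrow> g) (at_right 0) \<Longrightarrow> (f, - g) \<in> L"
      for t V
    proof -
      have "((\<lambda>h. V t ((V h f - f) /\<^sub>R h)) \<longlongrightarrow> V t (- k)) (at_right 0)"
        by (rule bounded_linear.tendsto[OF V(1)[OF t] V(3)])
      then have 1: "((\<lambda>h. (V (t + h) f - V t f) /\<^sub>R h) \<longlongrightarrow> V t (- k)) (at_right 0)"
        by (rule Lim_transform_eventually)
          (auto intro!: eventually_mono[OF ev_pos] simp: V(2) t linear_simps[OF V(1)])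
      then have "((\<lambda>h. (V h (V t f) - V t f) /\<^sub>R h) \<longlongrightarrow> V t (- k)) (at_right 0)"
        by (rule Lim_transform_eventually)
          (use t in \<open>auto intro!: eventually_mono[OF ev_pos] simp: V(2)[symmetric] add.commute\<close>)
      from V(4)[OF this] 1 show ?thesis using t by (simp add: linear_simps[OF V(1)])
    qed
    have "w \<tau> \<bullet> w \<tau> \<le> w 0 \<bullet> w 0"
    proof (rule right_derivative_nonpos_decreasing[OF \<tau>])
      show "continuous_on {0..\<tau>} (\<lambda>t. w t \<bullet> w t)" by (intro continuous_intros cont)
      fix t :: real assume t: "0 \<le> t" "t < \<tau>"
      have S: "((\<lambda>h. (S (t + h) f - S t f) /\<^sub>R h) \<longlongrightarrow> S t (- k)) (at_right 0)" "(S t f, S t k) \<in> L"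
        using right[of t S] t lin add gen[of f "- k"] fk gen by auto
      have T: "((\<lambda>h. (T (t + h) f - T t f) /\<^sub>R h) \<longlongrightarrow> T t (- k)) (at_right 0)" "(T t f, T t k) \<in> L"
        using right[of t T] t bounded_linear_T T_semigroup T_generator[OF fk] generator_T by auto
      have neg: "w t \<bullet> (S t (- k) - T t (- k)) \<le> 0"
        using mono[OF L_diff[OF S(2) T(2)]] t
        by (simp add: w_def linear_simps[OF lin] linear_simps[OF bounded_linear_T] inner_diff_right)
      have q: "((\<lambda>h. (w (t + h) - w t) /\<^sub>R h) \<longlongrightarrow> S t (- k) - T t (- k)) (at_right 0)"
        using tendsto_diff[OF S(1) T(1)] by (rule Lim_transform_eventually) (simp add: w_def algebra_simps)
      have "(w \<longlongrightarrow> w t) (at t within {t..\<tau>})"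
        using cont t unfolding continuous_on_def
        by (metis atLeastAtMost_iff atLeastatMost_subset_iff less_imp_le order_refl tendsto_within_subset)
      then have "(w \<longlongrightarrow> w t) (at_right t)" using t by (simp add: at_within_Icc_at_right)
      then have "((\<lambda>h. w (t + h)) \<longlongrightarrow> w t) (at_right 0)"
        by (simp add: filterlim_at_right_to_0[of w _ t] add.commute)
      \<comment> \<open>Product rule for right derivatives: a difference of squared norms is the
        inner product of the sum and the increment.\<close>
      then have "((\<lambda>h. (w (t + h) + w t) \<bullet> ((w (t + h) - w t) /\<^sub>R h)) \<longlongrightarrow>
          (w t + w t) \<bullet> (S t (- k) - T t (- k))) (at_right 0)"
        by (intro tendsto_intros q)
      then have "((\<lambda>h. (w (t + h) \<bullet> w (t + h) - w t \<bullet> w t) / h) \<longlongrightarrow>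
          (w t + w t) \<bullet> (S t (- k) - T t (- k))) (at_right 0)"
        by (rule Lim_transform_eventually)
          (auto intro!: always_eventually simp: inner_add_left inner_add_right inner_diff_left inner_diff_right inner_commute divide_inverse_commute)
      then show "\<exists>d\<le>0. ((\<lambda>h. (w (t + h) \<bullet> w (t + h) - w t \<bullet> w t) / h) \<longlongrightarrow> d) (at_right 0)"
        using neg by (intro exI conjI) (auto simp: inner_add_left)
    qed
    also have "w 0 = 0" by (simp add: w_def S0)
    finally have "w \<tau> = 0" by (metis inner_gt_zero_iff inner_zero_left not_less)
    then show ?thesis by (simp add: w_def)
  qed
  \<comment> \<open>Initial values outside the domain are reached by density, both operators being
    bounded.\<close>
  have "closed {f. S \<tau> f = T \<tau> f}"
    by (intro closed_Collect_eq linear_continuous_on lin bounded_linear_T \<tau>)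
  moreover have "fst ` L \<subseteq> {f. S \<tau> f = T \<tau> f}" using dom by auto
  ultimately have "closure (fst ` L) \<subseteq> {f. S \<tau> f = T \<tau> f}" by (simp add: closure_minimal)
  moreover have "f \<in> closure (fst ` L)" by (simp add: dense)
  ultimately show ?thesis by blast
qed

end

section \<open>The operator of a closable form\<close>

lemma nonneg_quadratic_linear_zero:
  fixes B c :: real
  assumes c: "0 \<le> c" and H: "\<And>r. 0 \<le> r * B + r\<^sup>2 * c"
  shows "B = 0"
proof -
  \<comment> \<open>The denominator is \<open>c + 1\<close> because \<open>c\<close> may be 0; the
    value is still negative unless \<open>B = 0\<close>.\<close>
  have "0 \<le> (- B / (c + 1)) * B + (- B / (c + 1))\<^sup>2 * c" by (rule H)
  also have "\<dots> = - (B\<^sup>2 / (c + 1)\<^sup>2)"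
    using c by (simp add: field_simps power2_eq_square add_pos_nonneg)
      (simp add: divide_simps add_nonneg_eq_0_iff; algebra)
  finally have "B\<^sup>2 / (c + 1)\<^sup>2 \<le> 0" by simp
  then show ?thesis using c by (auto simp: divide_le_0_iff)
qed

locale symmetric_form =
  fixes D :: "'a::{real_inner,banach} set" and A :: "'a \<Rightarrow> 'a"
  assumes subspace_D: "subspace D"
    and A_add: "f \<in> D \<Longrightarrow> g \<in> D \<Longrightarrow> A (f + g) = A f + A g"
    and A_scale: "f \<in> D \<Longrightarrow> A (r *\<^sub>R f) = r *\<^sub>R A f"
    and A_sym: "f \<in> D \<Longrightarrow> g \<in> D \<Longrightarrow> A f \<bullet> g = f \<bullet> A g"
    and A_nonneg: "f \<in> D \<Longrightarrow> 0 \<le> A f \<bullet> f"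
    and dense_D: "closure D = UNIV"
begin

definition "q f g = A f \<bullet> g"
definition "p f = sqrt (q f f)"

lemmas D_add = subspace_add[OF subspace_D]
  and D_diff = subspace_diff[OF subspace_D]
  and D_scale = subspace_scale[OF subspace_D]
  and D_0 = subspace_0[OF subspace_D]

lemma A_diff: "f \<in> D \<Longrightarrow> g \<in> D \<Longrightarrow> A (f - g) = A f - A g"
  using A_add[of f "(-1) *\<^sub>R g"] A_scale[of g "-1"] D_scale[of g "-1"] by simp

lemma q_sym: "f \<in> D \<Longrightarrow> g \<in> D \<Longrightarrow> q f g = q g f"
  by (metis q_def A_sym inner_commute)

lemma q_nonneg: "f \<in> D \<Longrightarrow> 0 \<le> q f f"
  by (simp add: q_def A_nonneg)

lemmas q_simps = q_def A_add A_scale A_diff D_add D_diff D_scale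
  inner_add_left inner_add_right inner_diff_left inner_diff_right

lemma p_square: "f \<in> D \<Longrightarrow> (p f)\<^sup>2 = q f f"
  by (simp add: p_def q_nonneg)

lemma p_nonneg: "f \<in> D \<Longrightarrow> 0 \<le> p f"
  by (simp add: p_def q_nonneg)

lemma q_combine:
  "f \<in> D \<Longrightarrow> g \<in> D \<Longrightarrow> q (f + r *\<^sub>R g) (f + r *\<^sub>R g) = q f f + r * (2 * q f g) + r\<^sup>2 * q g g"
  using q_sym[of f g] by (simp add: q_simps power2_eq_square algebra_simps)

text \<open>The form may be degenerate, so \<open>q g g = 0\<close> is a case of its own: there the
  form along \<open>f + r *\<^sub>R g\<close> is affine in \<open>r\<close> and bounded below, hence
  constant.\<close>

lemma q_Cauchy_Schwarz:
  assumes f: "f \<in> D" and g: "g \<in> D"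
  shows "\<bar>q f g\<bar> \<le> p f * p g"
proof (cases "q g g = 0")
  case True
  have nn: "0 \<le> q f f + r * (2 * q f g)" for r
    using q_nonneg[OF D_add[OF f D_scale[OF g]], of r] True by (simp add: q_combine f g)
  have "q f g = 0"
  proof (rule ccontr)
    assume n: "q f g \<noteq> 0"
    \<comment> \<open>At this \<open>r\<close> the affine expression takes the value -1.\<close>
    show False using nn[of "- (q f f + 1) / (2 * q f g)"] n by simp
  qed
  then show ?thesis using p_nonneg f g by simp
next
  case False
  then have pos: "q g g > 0" using q_nonneg[OF g] by simp
  define r where "r = - q f g / q g g"
  have "0 \<le> q f f + r * (2 * q f g) + r\<^sup>2 * q g g"
    using q_nonneg[OF D_add[OF f D_scale[OF g]], of r] by (simp add: q_combine f g)
  also have "\<dots> = q f f - (q f g)\<^sup>2 / q g g"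
    using pos by (simp add: r_def field_simps power2_eq_square)
  finally have "(q f g)\<^sup>2 \<le> q f f * q g g" using pos by (simp add: field_simps)
  then have "\<bar>q f g\<bar> \<le> sqrt (q f f * q g g)" by (simp add: real_le_rsqrt)
  then show ?thesis by (simp add: p_def real_sqrt_mult)
qed

lemma p_triangle: assumes f: "f \<in> D" and g: "g \<in> D" shows "p (f + g) \<le> p f + p g"
proof -
  have "(p (f + g))\<^sup>2 = (p f)\<^sup>2 + 2 * q f g + (p g)\<^sup>2"
    using q_combine[OF f g, of 1] f g by (simp add: p_square D_add)
  also have "\<dots> \<le> (p f + p g)\<^sup>2"
    using q_Cauchy_Schwarz[OF f g] by (simp add: power2_sum)
  finally show ?thesis by (rule power2_le_imp_le) (simp add: p_nonneg f g)
qed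

lemma p_diff_le: assumes f: "f \<in> D" and g: "g \<in> D" shows "\<bar>p f - p g\<bar> \<le> p (f - g)"
proof -
  have "p (g - f) = p (f - g)" using f g by (simp add: p_def q_simps)
  then show ?thesis
    using p_triangle[of "f - g" g] p_triangle[of "g - f" f] f g by (simp add: D_diff)
qed

section \<open>Form-Cauchy sequences and closability\<close>

definition approx :: "(nat \<Rightarrow> 'a) \<Rightarrow> 'a \<Rightarrow> bool" where
  "approx s f \<longleftrightarrow> (\<forall>n. s n \<in> D) \<and> s \<longlonglongrightarrow> f \<and>
     (\<forall>\<epsilon>>0. \<exists>N. \<forall>m\<ge>N. \<forall>n\<ge>N. q (s m - s n) (s m - s n) < \<epsilon>)"

lemma approx_D: "approx s f \<Longrightarrow> s n \<in> D"
  and approx_tendsto: "approx s f \<Longrightarrow> s \<longlonglongrightarrow> f"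
  by (auto simp: approx_def)

text \<open>The Cauchy condition in terms of \<open>q\<close> is the one in
  \<open>form_approx\<close>; the one in terms of \<open>p\<close> obeys a triangle
  inequality.\<close>

lemma approx_p:
  "approx s f \<longleftrightarrow> (\<forall>n. s n \<in> D) \<and> s \<longlonglongrightarrow> f \<and>
     (\<forall>\<epsilon>>0. \<exists>N. \<forall>m\<ge>N. \<forall>n\<ge>N. p (s m - s n) < \<epsilon>)"
  (is "_ \<longleftrightarrow> ?D \<and> ?l \<and> ?r")
proof (cases ?D)
  case True
  have iff: "q (s m - s n) (s m - s n) < \<epsilon>\<^sup>2 \<longleftrightarrow> p (s m - s n) < \<epsilon>" if "\<epsilon> > 0" for m n \<epsilon>
    using True that unfolding p_def
    by (metis less_eq_real_def real_sqrt_abs real_sqrt_less_iff abs_of_pos)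
  have iff': "q (s m - s n) (s m - s n) < \<epsilon> \<longleftrightarrow> p (s m - s n) < sqrt \<epsilon>" for m n \<epsilon>
    by (simp add: p_def)
  show ?thesis
    unfolding approx_def
    by (metis iff iff' zero_less_power real_sqrt_gt_zero)
qed (auto simp: approx_def)

lemma approx_add: assumes "approx s f" "approx r g" shows "approx (\<lambda>n. s n + r n) (f + g)"
  unfolding approx_p
proof (intro conjI allI impI)
  show "s n + r n \<in> D" for n using assms by (simp add: approx_D D_add)
  show "(\<lambda>n. s n + r n) \<longlonglongrightarrow> f + g" using assms by (intro tendsto_intros approx_tendsto)
  fix e :: real assume "e > 0"
  then have "e / 2 > 0" by simp
  then obtain N N' where N: "\<And>m n. m \<ge> N \<Longrightarrow> n \<ge> N \<Longrightarrow> p (s m - s n) < e / 2"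
    "\<And>m n. m \<ge> N' \<Longrightarrow> n \<ge> N' \<Longrightarrow> p (r m - r n) < e / 2"
    using assms unfolding approx_p by metis
  have "p (s m + r m - (s n + r n)) < e" if "m \<ge> max N N'" "n \<ge> max N N'" for m n
  proof -
    have eq: "s m + r m - (s n + r n) = (s m - s n) + (r m - r n)" by simp
    have "p (s m + r m - (s n + r n)) \<le> p (s m - s n) + p (r m - r n)"
      unfolding eq using p_triangle[of "s m - s n" "r m - r n"] assms by (simp add: approx_D D_diff)
    then show ?thesis using N(1)[of m n] N(2)[of m n] that by simp
  qed
  then show "\<exists>N. \<forall>m\<ge>N. \<forall>n\<ge>N. p (s m + r m - (s n + r n)) < e" by blast
qed

lemma approx_scale: assumes "approx s f" shows "approx (\<lambda>n. c *\<^sub>R s n) (c *\<^sub>R f)"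
  unfolding approx_def
proof (intro conjI allI impI)
  show "c *\<^sub>R s n \<in> D" for n using assms by (simp add: approx_D D_scale)
  show "(\<lambda>n. c *\<^sub>R s n) \<longlonglongrightarrow> c *\<^sub>R f" using assms by (intro tendsto_intros approx_tendsto)
  fix e :: real assume e: "e > 0"
  then have "e / (c\<^sup>2 + 1) > 0" by (simp add: add_nonneg_pos)
  then obtain N where N: "\<And>m n. m \<ge> N \<Longrightarrow> n \<ge> N \<Longrightarrow> q (s m - s n) (s m - s n) < e / (c\<^sup>2 + 1)"
    using assms unfolding approx_def by metis
  have "q (c *\<^sub>R s m - c *\<^sub>R s n) (c *\<^sub>R s m - c *\<^sub>R s n) < e" if "m \<ge> N" "n \<ge> N" for m n
  proof -
    have sD: "s m - s n \<in> D" using assms by (simp add: approx_D D_diff)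
    have "q (c *\<^sub>R s m - c *\<^sub>R s n) (c *\<^sub>R s m - c *\<^sub>R s n) = c\<^sup>2 * q (s m - s n) (s m - s n)"
      using A_scale[OF sD, of c]
      by (simp add: q_def power2_eq_square flip: scaleR_diff_right)
    also have "\<dots> \<le> (c\<^sup>2 + 1) * q (s m - s n) (s m - s n)"
      using q_nonneg[OF sD] by (simp add: algebra_simps)
    also have "\<dots> < (c\<^sup>2 + 1) * (e / (c\<^sup>2 + 1))"
      using N[OF that] by (intro mult_strict_left_mono) (auto simp: add_nonneg_pos)
    also have "\<dots> = e" by (simp add: add_nonneg_eq_0_iff)
    finally show ?thesis .
  qed
  then show "\<exists>N. \<forall>m\<ge>N. \<forall>n\<ge>N. q (c *\<^sub>R s m - c *\<^sub>R s n) (c *\<^sub>R s m - c *\<^sub>R s n) < e" by blast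
qed

lemma approx_diff: "approx s f \<Longrightarrow> approx r g \<Longrightarrow> approx (\<lambda>n. s n - r n) (f - g)"
  using approx_add[of s f "\<lambda>n. (-1) *\<^sub>R r n" "(-1) *\<^sub>R g"] approx_scale[of r g "-1"] by simp

lemma approx_const: "f \<in> D \<Longrightarrow> approx (\<lambda>_. f) f"
  using D_0 A_scale[of 0 0] by (auto simp: approx_def q_def)

lemma approx_p_convergent: assumes "approx s f" shows "convergent (\<lambda>n. p (s n))"
proof -
  have "Cauchy (\<lambda>n. p (s n))"
  proof (rule CauchyI)
    fix e :: real assume "e > 0"
    then obtain N where "\<And>m n. m \<ge> N \<Longrightarrow> n \<ge> N \<Longrightarrow> p (s m - s n) < e"
      using assms unfolding approx_p by metis
    then show "\<exists>N. \<forall>m\<ge>N. \<forall>n\<ge>N. norm (p (s m) - p (s n)) < e"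
      using p_diff_le approx_D[OF assms] unfolding real_norm_def by (meson order_le_less_trans)
  qed
  then show ?thesis by (rule Cauchy_convergent)
qed

lemma approx_p_bounded: assumes "approx s f" shows "\<exists>K>0. \<forall>n. p (s n) \<le> K"
proof -
  have "Bseq (\<lambda>n. p (s n))" by (rule convergent_imp_Bseq[OF approx_p_convergent[OF assms]])
  then show ?thesis unfolding Bseq_def by (auto intro: abs_le_D1)
qed

text \<open>Here it matters that the form comes from an operator: for fixed \<open>n\<close>,
  \<open>q (s m) (r n)\<close> equals \<open>s m \<bullet> A (r n)\<close>, which converges in
  \<open>m\<close> by convergence in the Hilbert space alone. The Cauchy condition makes the error
  uniform in \<open>m\<close>.\<close>

lemma approx_pairing:
  assumes s: "approx s f" and r: "approx r g"
  shows "(\<lambda>n. f \<bullet> A (r n) - q (s n) (r n)) \<longlonglongrightarrow> 0"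
proof (rule LIMSEQ_I)
  fix e :: real assume e: "e > 0"
  obtain K where K: "K > 0" "\<And>n. p (r n) \<le> K" using approx_p_bounded[OF r] by blast
  then have "e / (2 * K) > 0" using e by simp
  then obtain N where N: "\<And>m n. m \<ge> N \<Longrightarrow> n \<ge> N \<Longrightarrow> p (s m - s n) < e / (2 * K)"
    using s unfolding approx_p by metis
  have "\<bar>f \<bullet> A (r n) - q (s n) (r n)\<bar> \<le> e / 2" if n: "n \<ge> N" for n
  proof (rule LIMSEQ_le_const2)
    show "(\<lambda>m. \<bar>s m \<bullet> A (r n) - q (s n) (r n)\<bar>) \<longlonglongrightarrow> \<bar>f \<bullet> A (r n) - q (s n) (r n)\<bar>"
      using approx_tendsto[OF s] by (intro tendsto_intros)
    have "\<bar>s m \<bullet> A (r n) - q (s n) (r n)\<bar> \<le> e / 2" if m: "m \<ge> N" for m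
    proof -
      have "s m \<bullet> A (r n) - q (s n) (r n) = q (s m - s n) (r n)"
        using approx_D[OF s] approx_D[OF r] by (simp add: q_simps A_sym)
      also have "\<bar>\<dots>\<bar> \<le> p (s m - s n) * p (r n)"
        using approx_D[OF s] approx_D[OF r] by (intro q_Cauchy_Schwarz D_diff)
      also have "\<dots> \<le> e / (2 * K) * K"
        using N[OF m n] K approx_D[OF s] approx_D[OF r]
        by (intro mult_mono) (auto intro: p_nonneg D_diff simp: e less_imp_le)
      also have "\<dots> = e / 2" using K by simp
      finally show ?thesis .
    qed
    then show "\<exists>N. \<forall>m\<ge>N. \<bar>s m \<bullet> A (r n) - q (s n) (r n)\<bar> \<le> e / 2" by blast
  qed
  then have "\<forall>n\<ge>N. norm (f \<bullet> A (r n) - q (s n) (r n) - 0) < e"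
    using e by (simp add: order_le_less_trans[of _ "e / 2"])
  then show "\<exists>N. \<forall>n\<ge>N. norm (f \<bullet> A (r n) - q (s n) (r n) - 0) < e" by blast
qed

text \<open>With limit 0 the first term in \<open>approx_pairing\<close> vanishes, which leaves
  \<open>q (z n) (z n)\<close> as a null sequence.\<close>

lemma closable:
  assumes "approx z 0"
  shows "(\<lambda>n. p (z n)) \<longlonglongrightarrow> 0"
proof -
  have "(\<lambda>n. - (p (z n))\<^sup>2) \<longlonglongrightarrow> 0"
    using approx_pairing[OF assms assms] approx_D[OF assms] by (simp add: p_square)
  from tendsto_real_sqrt[OF tendsto_minus[OF this]]
  show ?thesis using approx_D[OF assms] by (simp add: p_nonneg)
qed

text \<open>Polarisation reduces this to the convergence of the seminorms along sums and
  differences.\<close>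

lemma approx_q_convergent:
  assumes s: "approx s f" and r: "approx r g"
  shows "convergent (\<lambda>n. q (s n) (r n))"
proof -
  have "q (s n) (r n) = ((p (s n + r n))\<^sup>2 - (p (s n - r n))\<^sup>2) / 4" for n
    using approx_D[OF s] approx_D[OF r] q_sym[of "s n" "r n"]
    by (simp add: p_square D_add D_diff) (simp add: q_simps)
  moreover have "convergent (\<lambda>n. ((p (s n + r n))\<^sup>2 - (p (s n - r n))\<^sup>2) / 4)"
  proof -
    obtain l l' where "(\<lambda>n. p (s n + r n)) \<longlonglongrightarrow> l" "(\<lambda>n. p (s n - r n)) \<longlonglongrightarrow> l'"
      using approx_p_convergent[OF approx_add[OF s r]] approx_p_convergent[OF approx_diff[OF s r]]
      unfolding convergent_def by blast
    then have "(\<lambda>n. ((p (s n + r n))\<^sup>2 - (p (s n - r n))\<^sup>2) / 4) \<longlonglongrightarrow> (l\<^sup>2 - l'\<^sup>2) / 4"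
      by (intro tendsto_intros) auto
    then show ?thesis by (rule convergentI)
  qed
  ultimately show ?thesis by (simp only:)
qed

text \<open>Two approximations of one vector differ by an approximation of 0, which closability
  makes negligible. So the closed form does not depend on the sequences.\<close>

lemma approx_q_unique:
  assumes s: "approx s f" and r: "approx r g" and s': "approx s' f" and r': "approx r' g"
    and lim: "(\<lambda>n. q (s n) (r n)) \<longlonglongrightarrow> l"
  shows "(\<lambda>n. q (s' n) (r' n)) \<longlonglongrightarrow> l"
proof -
  note DD = approx_D[OF s] approx_D[OF r] approx_D[OF s'] approx_D[OF r']
  obtain K where K: "\<And>n. p (r' n) \<le> K" using approx_p_bounded[OF r'] by blast
  obtain K' where K': "\<And>n. p (s n) \<le> K'" using approx_p_bounded[OF s] by blast
  have "(\<lambda>n. p (s' n - s n) * K + K' * p (r' n - r n)) \<longlonglongrightarrow> 0 * K + K' * 0"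
    using approx_diff[OF s' s] approx_diff[OF r' r] by (intro tendsto_intros closable) auto
  then have lim0: "(\<lambda>n. p (s' n - s n) * K + K' * p (r' n - r n)) \<longlonglongrightarrow> 0" by simp
  have "(\<lambda>n. q (s' n) (r' n) - q (s n) (r n)) \<longlonglongrightarrow> 0"
  proof (rule Lim_null_comparison[OF always_eventually lim0], intro allI)
    fix n
    have "q (s' n) (r' n) - q (s n) (r n) = q (s' n - s n) (r' n) + q (s n) (r' n - r n)"
      using DD by (simp add: q_simps)
    moreover have "\<bar>q (s' n - s n) (r' n)\<bar> \<le> p (s' n - s n) * K"
      using DD by (intro order_trans[OF q_Cauchy_Schwarz] mult_left_mono K p_nonneg D_diff)
    moreover have "\<bar>q (s n) (r' n - r n)\<bar> \<le> K' * p (r' n - r n)"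
      using DD by (intro order_trans[OF q_Cauchy_Schwarz] mult_right_mono K' p_nonneg D_diff)
    ultimately show "norm (q (s' n) (r' n) - q (s n) (r n)) \<le> p (s' n - s n) * K + K' * p (r' n - r n)"
      by simp
  qed
  from tendsto_add[OF this lim] show ?thesis by simp
qed

text \<open>For \<open>g \<in> D\<close> the closed form is \<open>f \<bullet> A g\<close>, so the Friedrichs extension is the adjoint of \<open>A\<close>
  restricted to the form domain.\<close>

definition "friedrichs = {(f, h). (\<exists>s. approx s f) \<and> (\<forall>g\<in>D. f \<bullet> A g = h \<bullet> g)}"

lemma friedrichs_tendsto:
  assumes fh: "(f, h) \<in> friedrichs" and s: "approx s f" and r: "approx r g"
  shows "(\<lambda>n. q (s n) (r n)) \<longlonglongrightarrow> h \<bullet> g"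
proof -
  have eq: "f \<bullet> A (r n) = h \<bullet> r n" for n using fh approx_D[OF r] by (auto simp: friedrichs_def)
  have "(\<lambda>n. h \<bullet> r n - (f \<bullet> A (r n) - q (s n) (r n))) \<longlonglongrightarrow> h \<bullet> g - 0"
    by (intro tendsto_diff approx_pairing[OF s r] tendsto_inner tendsto_const approx_tendsto[OF r])
  then show ?thesis by (simp add: eq)
qed

text \<open>The right-hand side is the condition in \<open>friedrichs_extension\<close> with the
  closed form written as a limit; constant sequences recover the condition on
  \<open>D\<close>.\<close>

lemma friedrichs_iff:
  "(f, h) \<in> friedrichs \<longleftrightarrow> (\<exists>s. approx s f) \<and>
     (\<forall>s r g. approx s f \<longrightarrow> approx r g \<longrightarrow> (\<lambda>n. q (s n) (r n)) \<longlonglongrightarrow> h \<bullet> g)"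
proof (intro iffI conjI allI impI)
  assume H: "(\<exists>s. approx s f) \<and> (\<forall>s r g. approx s f \<longrightarrow> approx r g \<longrightarrow> (\<lambda>n. q (s n) (r n)) \<longlonglongrightarrow> h \<bullet> g)"
  then obtain s where s: "approx s f" by blast
  have "f \<bullet> A g = h \<bullet> g" if g: "g \<in> D" for g
  proof (rule LIMSEQ_unique)
    show "(\<lambda>n. q (s n) g) \<longlonglongrightarrow> h \<bullet> g" using H s approx_const[OF g] by blast
    have "(\<lambda>n. s n \<bullet> A g) \<longlonglongrightarrow> f \<bullet> A g" by (intro tendsto_intros approx_tendsto s)
    then show "(\<lambda>n. q (s n) g) \<longlonglongrightarrow> f \<bullet> A g" using approx_D[OF s] g by (simp add: q_def A_sym)
  qed
  then show "(f, h) \<in> friedrichs" using s by (auto simp: friedrichs_def)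
qed (auto simp: friedrichs_tendsto, auto simp: friedrichs_def)

lemma friedrichs_symmetric:
  assumes "(f, h) \<in> friedrichs" "(g, k) \<in> friedrichs"
  shows "h \<bullet> g = f \<bullet> k"
proof -
  obtain s r where s: "approx s f" and r: "approx r g" using assms by (auto simp: friedrichs_def)
  have "(\<lambda>n. q (s n) (r n)) \<longlonglongrightarrow> h \<bullet> g" by (rule friedrichs_tendsto[OF assms(1) s r])
  moreover have "(\<lambda>n. q (s n) (r n)) \<longlonglongrightarrow> k \<bullet> f"
    using friedrichs_tendsto[OF assms(2) r s] approx_D[OF s] approx_D[OF r] by (simp add: q_sym)
  ultimately show ?thesis by (metis LIMSEQ_unique inner_commute)
qed

text \<open>The resolvent is the minimiser of \<open>a * q g g + \<parallel>g - f\<parallel>\<^sup>2\<close>. A minimising sequence can be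
  taken inside every closed set onto which this functional can be improved.\<close>

lemma resolvent_exists:
  assumes a: "0 < a" and C: "closed C"
    and improve: "\<And>g. g \<in> D \<Longrightarrow> \<exists>g'\<in>D \<inter> C. q g' g' \<le> q g g \<and> norm (g' - f) \<le> norm (g - f)"
  shows "\<exists>u\<in>C. (u, (f - u) /\<^sub>R a) \<in> friedrichs"
proof -
  define \<Phi> where "\<Phi> g = a * q g g + (g - f) \<bullet> (g - f)" for g
  define m where "m = Inf (\<Phi> ` D)"
  have bdd: "bdd_below (\<Phi> ` D)"
    using q_nonneg a by (auto intro!: bdd_belowI2[of _ 0] simp: \<Phi>_def)
  have m: "m \<le> \<Phi> g" if "g \<in> D" for g
    unfolding m_def by (rule cINF_lower[OF bdd that])
  have "\<exists>g\<in>D \<inter> C. \<Phi> g < m + inverse (real (Suc n))" for n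
  proof -
    have "\<Phi> ` D \<noteq> {}" using D_0 by blast
    then obtain g where g: "g \<in> D" "\<Phi> g < m + inverse (real (Suc n))"
      using cInf_lessD[of "\<Phi> ` D" "m + inverse (real (Suc n))"] unfolding m_def by auto
    obtain g' where g': "g' \<in> D \<inter> C" "q g' g' \<le> q g g" "norm (g' - f) \<le> norm (g - f)"
      using improve[OF g(1)] by blast
    have "(norm (g' - f))\<^sup>2 \<le> (norm (g - f))\<^sup>2" using g'(3) by (simp add: power_mono)
    then have "\<Phi> g' \<le> \<Phi> g"
      using g'(2) a unfolding \<Phi>_def power2_norm_eq_inner by (intro add_mono mult_left_mono) auto
    then show ?thesis using g g' by (intro bexI[of _ g']) auto
  qed
  then obtain s where s: "\<And>n. s n \<in> D" "\<And>n. s n \<in> C" "\<And>n. \<Phi> (s n) < m + inverse (real (Suc n))"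
    by (metis IntD1 IntD2)
  \<comment> \<open>Parallelogram identity for \<open>\<Phi>\<close>: the midpoint lies in
    \<open>D\<close>, where \<open>\<Phi>\<close> is at least \<open>m\<close>, so two
    near-minimisers are close both in norm and in the form.\<close>
  have key: "a * q (s i - s j) (s i - s j) + (s i - s j) \<bullet> (s i - s j) \<le>
      2 * (inverse (real (Suc i)) + inverse (real (Suc j)))" for i j
  proof -
    let ?g = "(1/2) *\<^sub>R (s i + s j)"
    have "4 * \<Phi> ?g + (a * q (s i - s j) (s i - s j) + (s i - s j) \<bullet> (s i - s j)) = 2 * \<Phi> (s i) + 2 * \<Phi> (s j)"
    proof -
      have "q ?g ?g = (q (s i) (s i) + 2 * q (s i) (s j) + q (s j) (s j)) / 4"
        "q (s i - s j) (s i - s j) = q (s i) (s i) - 2 * q (s i) (s j) + q (s j) (s j)"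
        using s(1) q_sym[of "s i" "s j"] by (simp_all add: q_simps add_divide_distrib)
      then show ?thesis
        unfolding \<Phi>_def by (simp only:) (simp add: inner_simps inner_commute algebra_simps add_divide_distrib)
    qed
    moreover have "m \<le> \<Phi> ?g" using s(1) by (intro m D_scale D_add)
    ultimately have "a * q (s i - s j) (s i - s j) + (s i - s j) \<bullet> (s i - s j) \<le> 2 * ((\<Phi> (s i) - m) + (\<Phi> (s j) - m))"
      by (simp only: ring_distribs)
    also have "\<dots> \<le> 2 * (inverse (real (Suc i)) + inverse (real (Suc j)))"
      using s(3)[of i] s(3)[of j] by (intro mult_left_mono add_mono) (auto simp: algebra_simps less_imp_le)
    finally show ?thesis .
  qed
  have small: "\<exists>N. \<forall>i\<ge>N. \<forall>j\<ge>N. 2 * (inverse (real (Suc i)) + inverse (real (Suc j))) < e" if e: "e > 0" for e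
  proof -
    obtain N where N: "inverse (real (Suc N)) < e / 4" using reals_Archimedean[of "e / 4"] e by auto
    have "inverse (real (Suc i)) < e / 4" if "i \<ge> N" for i
    proof (rule order_le_less_trans[OF _ N])
      show "inverse (real (Suc i)) \<le> inverse (real (Suc N))" using that by (intro le_imp_inverse_le) auto
    qed
    moreover have "2 * (x + y) < e" if "x < e / 4" "y < e / 4" for x y using that by argo
    ultimately have "2 * (inverse (real (Suc i)) + inverse (real (Suc j))) < e" if "i \<ge> N" "j \<ge> N" for i j
      using that by blast
    then show ?thesis by blast
  qed
  have "Cauchy s"
  proof (rule CauchyI)
    fix e :: real assume e: "e > 0"
    then obtain N where N: "\<And>i j. i \<ge> N \<Longrightarrow> j \<ge> N \<Longrightarrow> 2 * (inverse (real (Suc i)) + inverse (real (Suc j))) < e\<^sup>2"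
      using small[of "e\<^sup>2"] by auto
    have "norm (s i - s j) < e" if "i \<ge> N" "j \<ge> N" for i j
    proof (rule power2_less_imp_less)
      have "0 \<le> a * q (s i - s j) (s i - s j)" using a s(1) by (simp add: q_nonneg D_diff)
      then show "(norm (s i - s j))\<^sup>2 < e\<^sup>2"
        using key[of i j] N[OF that] unfolding power2_norm_eq_inner by linarith
    qed (use e in simp)
    then show "\<exists>N. \<forall>i\<ge>N. \<forall>j\<ge>N. norm (s i - s j) < e" by blast
  qed
  then obtain u where u: "s \<longlonglongrightarrow> u" using Cauchy_convergent_iff convergent_def by blast
  have uC: "u \<in> C" using closed_sequentially[OF C] s(2) u by blast
  have app: "approx s u"
    unfolding approx_def
  proof (intro conjI allI impI u s(1))
    fix e :: real assume e: "e > 0"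
    then have "a * e > 0" using a by simp
    then obtain N where N: "\<And>i j. i \<ge> N \<Longrightarrow> j \<ge> N \<Longrightarrow> 2 * (inverse (real (Suc i)) + inverse (real (Suc j))) < a * e"
      using small by blast
    have "q (s i - s j) (s i - s j) < e" if "i \<ge> N" "j \<ge> N" for i j
    proof -
      have "a * q (s i - s j) (s i - s j) < a * e"
        using key[of i j] N[OF that] inner_ge_zero[of "s i - s j"] by linarith
      then show ?thesis using a by simp
    qed
    then show "\<exists>N. \<forall>m\<ge>N. \<forall>n\<ge>N. q (s m - s n) (s m - s n) < e" by blast
  qed
  \<comment> \<open>First variation. The limit \<open>u\<close> need not lie in \<open>D\<close>, so
    the perturbation is applied to \<open>s n\<close>, at the cost of an error
    \<open>inverse (real (Suc n))\<close> that vanishes in the limit.\<close>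
  have "a * (u \<bullet> A g) + (u - f) \<bullet> g = 0" if g: "g \<in> D" for g
  proof -
    define c where "c = a * q g g + g \<bullet> g"
    have "0 \<le> r * (2 * (a * (u \<bullet> A g) + (u - f) \<bullet> g)) + r\<^sup>2 * c" for r
    proof (rule LIMSEQ_le_const)
      have "(\<lambda>n. inverse (real (Suc n)) + (r * (2 * (a * (s n \<bullet> A g) + (s n - f) \<bullet> g)) + r\<^sup>2 * c)) \<longlonglongrightarrow>
          0 + (r * (2 * (a * (u \<bullet> A g) + (u - f) \<bullet> g)) + r\<^sup>2 * c)"
        by (intro tendsto_intros u LIMSEQ_inverse_real_of_nat)
      then show "(\<lambda>n. inverse (real (Suc n)) + (r * (2 * (a * (s n \<bullet> A g) + (s n - f) \<bullet> g)) + r\<^sup>2 * c)) \<longlonglongrightarrow>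
          r * (2 * (a * (u \<bullet> A g) + (u - f) \<bullet> g)) + r\<^sup>2 * c" by simp
      have "0 \<le> inverse (real (Suc n)) + (r * (2 * (a * (s n \<bullet> A g) + (s n - f) \<bullet> g)) + r\<^sup>2 * c)" for n
      proof -
        have "m \<le> \<Phi> (s n + r *\<^sub>R g)" using s(1) g by (intro m D_add D_scale)
        also have "\<dots> = \<Phi> (s n) + (r * (2 * (a * (s n \<bullet> A g) + (s n - f) \<bullet> g)) + r\<^sup>2 * c)"
          unfolding \<Phi>_def c_def q_combine[OF s(1) g]
          using A_sym[OF s(1) g, of n]
          by (simp add: q_def inner_simps inner_commute power2_eq_square algebra_simps)
        finally show ?thesis using s(3)[of n] by linarith
      qed
      then show "\<exists>N. \<forall>n\<ge>N. 0 \<le> inverse (real (Suc n)) + (r * (2 * (a * (s n \<bullet> A g) + (s n - f) \<bullet> g)) + r\<^sup>2 * c)"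
        by blast
    qed
    moreover have "0 \<le> c" using a q_nonneg[OF g] by (simp add: c_def)
    ultimately show ?thesis using nonneg_quadratic_linear_zero[of c] by fastforce
  qed
  then have "u \<bullet> A g = ((f - u) /\<^sub>R a) \<bullet> g" if "g \<in> D" for g
    using that a by (simp add: field_simps inner_diff_left)
  then show ?thesis using uC app by (auto simp: friedrichs_def)
qed

sublocale maximal_monotone friedrichs
proof
  show "subspace friedrichs"
    unfolding subspace_def
  proof (intro conjI ballI allI)
    have "approx (\<lambda>_. 0) 0" using approx_const[OF D_0] .
    then show "0 \<in> friedrichs" by (auto simp: friedrichs_def zero_prod_def)
    fix x y and c :: real assume x: "x \<in> friedrichs"
    show "c *\<^sub>R x \<in> friedrichs"
      using x approx_scale by (cases x) (fastforce simp: friedrichs_def)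
    assume y: "y \<in> friedrichs"
    show "x + y \<in> friedrichs"
      using x y approx_add by (cases x; cases y) (fastforce simp: friedrichs_def inner_add_left)
  qed
  show "0 \<le> f \<bullet> h" if fh: "(f, h) \<in> friedrichs" for f h
  proof -
    obtain s where s: "approx s f" using fh by (auto simp: friedrichs_def)
    have "0 \<le> h \<bullet> f"
      by (rule LIMSEQ_le_const[OF friedrichs_tendsto[OF fh s s]]) (use approx_D[OF s] in \<open>auto intro: q_nonneg\<close>)
    then show ?thesis by (simp add: inner_commute)
  qed
  show "\<exists>u. (u, (f - u) /\<^sub>R a) \<in> friedrichs" if "0 < a" for a f
    using resolvent_exists[OF that closed_UNIV] by auto
  have "(f, A f) \<in> friedrichs" if "f \<in> D" for f
    using approx_const[OF that] that by (auto simp: friedrichs_def A_sym)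
  then have "D \<subseteq> fst ` friedrichs" by force
  then show "closure (fst ` friedrichs) = UNIV"
    using closure_mono[of D] dense_D by blast
qed

lemma J_symmetric:
  assumes a: "0 < a" shows "J a x \<bullet> y = x \<bullet> J a y"
  using friedrichs_symmetric[OF J_in[OF a, of x] J_in[OF a, of y]] a
  by (simp add: inner_diff_left inner_diff_right)

lemma J_invariant:
  assumes a: "0 < a" and C: "closed C"
    and improve: "\<And>g. g \<in> D \<Longrightarrow> \<exists>g'\<in>D \<inter> C. q g' g' \<le> q g g \<and> norm (g' - f) \<le> norm (g - f)"
  shows "J a f \<in> C"
  using resolvent_exists[OF a C improve] J_eqI[OF a] by metis

end

section \<open>The Hilbert space of square summable functions\<close>

text \<open>Completeness and inner products live in type classes, so the Hilbert space has to be a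
  type. The weight is a variable and cannot enter it; it is absorbed by \<open>emb\<close> and
  \<open>fn\<close>, and coordinates refer to the normalised indicators of vertices.\<close>

typedef 'v ell2 = "{f :: 'v \<Rightarrow> real. (\<lambda>v. (f v)\<^sup>2) summable_on UNIV}"
  morphisms coord Abs_ell2
  by (rule exI[of _ "\<lambda>_. 0"]) simp

lemma coord_summable: "(\<lambda>v. (coord x v)\<^sup>2) summable_on UNIV"
  using coord[of x] by simp

lemma summable_on_mult_squares:
  fixes f g :: "'v \<Rightarrow> real"
  assumes "(\<lambda>v. (f v)\<^sup>2) summable_on A" "(\<lambda>v. (g v)\<^sup>2) summable_on A"
  shows "(\<lambda>v. f v * g v) summable_on A"
proof -
  have "(\<lambda>v. (f v)\<^sup>2 + (g v)\<^sup>2) summable_on A" by (intro summable_on_add assms)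
  then have "(\<lambda>v. norm (f v * g v)) summable_on A"
  proof (rule Infinite_Sum.abs_summable_on_comparison_test')
    fix v
    have "2 * \<bar>f v * g v\<bar> \<le> (f v)\<^sup>2 + (g v)\<^sup>2"
      using sum_squares_bound[of "\<bar>f v\<bar>" "\<bar>g v\<bar>"] by (simp add: abs_mult)
    then show "norm (f v * g v) \<le> (f v)\<^sup>2 + (g v)\<^sup>2" by simp
  qed
  then show ?thesis by (rule abs_summable_summable)
qed

lemma coord_mult_summable: "(\<lambda>v. coord x v * coord y v) summable_on UNIV"
  by (intro summable_on_mult_squares coord_summable)

lemma summable_on_square_add:
  fixes f g :: "'v \<Rightarrow> real"
  assumes "(\<lambda>v. (f v)\<^sup>2) summable_on A" "(\<lambda>v. (g v)\<^sup>2) summable_on A"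
  shows "(\<lambda>v. (a * f v + b * g v)\<^sup>2) summable_on A"
proof -
  have "(\<lambda>v. a\<^sup>2 * (f v)\<^sup>2 + (2 * a * b) * (f v * g v) + b\<^sup>2 * (g v)\<^sup>2) summable_on A"
    by (intro summable_on_add summable_on_cmult_right summable_on_mult_squares assms)
  then show ?thesis by (simp add: power2_eq_square algebra_simps)
qed

instantiation ell2 :: (type) real_vector
begin

definition "0 = Abs_ell2 (\<lambda>_. 0)"
definition "x + y = Abs_ell2 (\<lambda>v. coord x v + coord y v)"
definition "- x = Abs_ell2 (\<lambda>v. - coord x v)"
definition "x - y = Abs_ell2 (\<lambda>v. coord x v - coord y v)"
definition "scaleR r x = Abs_ell2 (\<lambda>v. r * coord x v)"

text \<open>One membership proof serves all the vector operations.\<close>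

lemma coord_lincomb: "coord (Abs_ell2 (\<lambda>v. a * coord x v + b * coord y v)) = (\<lambda>v. a * coord x v + b * coord y v)"
  by (rule Abs_ell2_inverse) (simp add: summable_on_square_add coord_summable)

lemma coord_0 [simp]: "coord 0 v = 0"
  by (simp add: zero_ell2_def Abs_ell2_inverse)

lemma coord_plus [simp]: "coord (x + y) v = coord x v + coord y v"
  using fun_cong[OF coord_lincomb[of 1 x 1 y]] by (simp add: plus_ell2_def)

lemma coord_uminus [simp]: "coord (- x) v = - coord x v"
  using fun_cong[OF coord_lincomb[of "-1" x 0 x]] by (simp add: uminus_ell2_def)

lemma coord_minus [simp]: "coord (x - y) v = coord x v - coord y v"
  using fun_cong[OF coord_lincomb[of 1 x "-1" y]] by (simp add: minus_ell2_def)

lemma coord_scaleR [simp]: "coord (r *\<^sub>R x) v = r * coord x v"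
  using fun_cong[OF coord_lincomb[of r x 0 x]] by (simp add: scaleR_ell2_def)

lemma coord_eqI: "(\<And>v. coord x v = coord y v) \<Longrightarrow> x = y"
  using coord_inject by (metis ext)

instance
  by standard (auto intro!: coord_eqI simp: algebra_simps)

end

instantiation ell2 :: (type) real_inner
begin

definition "inner x y = (\<Sum>\<^sub>\<infinity>v. coord x v * coord y v)"
definition "norm (x :: 'a ell2) = sqrt (x \<bullet> x)"
definition "dist (x :: 'a ell2) y = norm (x - y)"
definition "sgn (x :: 'a ell2) = x /\<^sub>R norm x"
definition "(uniformity :: ('a ell2 \<times> 'a ell2) filter) = (INF e\<in>{0<..}. principal {(x, y). dist x y < e})"
definition "open (U :: 'a ell2 set) \<longleftrightarrow> (\<forall>x\<in>U. \<forall>\<^sub>F (x', y) in uniformity. x' = x \<longrightarrow> y \<in> U)"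

instance
proof
  fix x y z :: "'a ell2" and r :: real
  show "x \<bullet> y = y \<bullet> x" by (simp add: inner_ell2_def mult.commute)
  show "(x + y) \<bullet> z = x \<bullet> z + y \<bullet> z"
    by (simp add: inner_ell2_def distrib_right infsum_add coord_mult_summable)
  show "r *\<^sub>R x \<bullet> y = r * (x \<bullet> y)"
    by (simp add: inner_ell2_def mult.assoc infsum_cmult_right')
  show nn: "0 \<le> x \<bullet> x" by (auto simp: inner_ell2_def intro: infsum_nonneg)
  show "(x \<bullet> x = 0) = (x = 0)"
  proof
    assume H: "x \<bullet> x = 0"
    have "coord x v * coord x v = 0" for v
      by (rule nonneg_infsum_le_0D[where A = UNIV]) (use H coord_mult_summable[of x x] in \<open>auto simp: inner_ell2_def\<close>)
    then show "x = 0" by (auto intro: coord_eqI)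
  qed (simp add: inner_ell2_def)
qed (simp_all add: norm_ell2_def dist_ell2_def sgn_ell2_def uniformity_ell2_def open_ell2_def)

end

lemma norm_ell2_square: "(norm x)\<^sup>2 = (\<Sum>\<^sub>\<infinity>v. (coord x v)\<^sup>2)"
  unfolding power2_norm_eq_inner inner_ell2_def by (simp add: power2_eq_square)

lemma sum_coord_square_le: "finite F \<Longrightarrow> (\<Sum>v\<in>F. (coord x v)\<^sup>2) \<le> (norm x)\<^sup>2"
  unfolding norm_ell2_square by (rule finite_sum_le_infsum) (auto simp: coord_summable)

lemma abs_coord_le: "\<bar>coord x v\<bar> \<le> norm x"
  by (rule power2_le_imp_le) (use sum_coord_square_le[of "{v}" x] in simp_all)

lemma bounded_linear_coord: "bounded_linear (\<lambda>x. coord x v)"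
  by (rule bounded_linear_intro[where K = 1]) (auto simp: abs_coord_le)

lemma norm_ell2_leI:
  assumes "0 \<le> c" "\<And>F. finite F \<Longrightarrow> (\<Sum>v\<in>F. (coord x v)\<^sup>2) \<le> c\<^sup>2"
  shows "norm x \<le> c"
proof -
  have "(norm x)\<^sup>2 \<le> c\<^sup>2"
    unfolding norm_ell2_square by (rule infsum_le_finite_sums[OF coord_summable]) (rule assms)
  then show ?thesis using assms(1) by (rule power2_le_imp_le)
qed

instance ell2 :: (type) banach
proof
  fix X :: "nat \<Rightarrow> 'a ell2" assume X: "Cauchy X"
  define f where "f v = lim (\<lambda>n. coord (X n) v)" for v
  have f: "(\<lambda>n. coord (X n) v) \<longlonglongrightarrow> f v" for v
  proof -
    have "Cauchy (\<lambda>n. coord (X n) v)"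
      using bounded_linear.Cauchy[OF bounded_linear_coord X] .
    then show ?thesis unfolding f_def by (simp add: Cauchy_convergent_iff convergent_LIMSEQ_iff)
  qed
  \<comment> \<open>Coordinatewise limits respect the Cauchy bound on finite sums, and finite sums
    determine the norm by \<open>norm_ell2_leI\<close>.\<close>
  have fin: "(\<Sum>v\<in>F. (coord (X n) v - f v)\<^sup>2) \<le> e\<^sup>2"
    if "finite F" "n \<ge> N" and N: "\<And>m n. m \<ge> N \<Longrightarrow> n \<ge> N \<Longrightarrow> norm (X m - X n) < e" for F n N e
  proof (rule LIMSEQ_le_const2)
    show "(\<lambda>m. \<Sum>v\<in>F. (coord (X n) v - coord (X m) v)\<^sup>2) \<longlonglongrightarrow> (\<Sum>v\<in>F. (coord (X n) v - f v)\<^sup>2)"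
      by (intro tendsto_intros f)
    have "(\<Sum>v\<in>F. (coord (X n) v - coord (X m) v)\<^sup>2) \<le> e\<^sup>2" if "m \<ge> N" for m
    proof -
      have "(\<Sum>v\<in>F. (coord (X n) v - coord (X m) v)\<^sup>2) \<le> (norm (X n - X m))\<^sup>2"
        using sum_coord_square_le[OF \<open>finite F\<close>, of "X n - X m"] by simp
      also have "\<dots> \<le> e\<^sup>2" using N[OF \<open>n \<ge> N\<close> that] by (intro power_mono) auto
      finally show ?thesis .
    qed
    then show "\<exists>N. \<forall>m\<ge>N. (\<Sum>v\<in>F. (coord (X n) v - coord (X m) v)\<^sup>2) \<le> e\<^sup>2" by blast
  qed
  obtain N1 where N1: "\<And>m n. m \<ge> N1 \<Longrightarrow> n \<ge> N1 \<Longrightarrow> norm (X m - X n) < 1"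
    using CauchyD[OF X zero_less_one] by blast
  have "(\<lambda>v. (coord (X N1) v - f v)\<^sup>2) summable_on UNIV"
    using fin[OF _ order_refl N1] by (intro nonneg_bdd_above_summable_on) (auto intro!: bdd_aboveI2)
  \<comment> \<open>The limit \<open>f\<close> is a member of the space minus a square summable
    difference.\<close>
  then have "(\<lambda>v. (1 * coord (X N1) v + (-1) * (coord (X N1) v - f v))\<^sup>2) summable_on UNIV"
    by (intro summable_on_square_add coord_summable)
  then have cf: "coord (Abs_ell2 f) = f" by (simp add: Abs_ell2_inverse)
  have "X \<longlonglongrightarrow> Abs_ell2 f"
  proof (rule LIMSEQ_I)
    fix e :: real assume e: "0 < e"
    then obtain N where N: "\<And>m n. m \<ge> N \<Longrightarrow> n \<ge> N \<Longrightarrow> norm (X m - X n) < e / 2"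
      using CauchyD[OF X, of "e / 2"] by auto
    have "norm (X n - Abs_ell2 f) \<le> e / 2" if "n \<ge> N" for n
      using fin[OF _ that N] e by (intro norm_ell2_leI) (auto simp: cf)
    then show "\<exists>N. \<forall>n\<ge>N. norm (X n - Abs_ell2 f) < e"
      using e by (intro exI[of _ N]) (force intro: order_le_less_trans)
  qed
  then show "convergent X" by (rule convergentI)
qed

section \<open>Identification with \<open>l\<^sup>2(\<mu>)\<close>\<close>

lemma integrable_count_space_iff:
  fixes f :: "'v \<Rightarrow> real"
  shows "integrable (count_space UNIV) f \<longleftrightarrow> f summable_on UNIV"
  using abs_summable_equivalent[of f UNIV] summable_on_iff_abs_summable_on_real[of f UNIV]
  by (simp add: Infinite_Set_Sum.abs_summable_on_def)

lemma integral_count_space_infsum: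
  fixes f :: "'v \<Rightarrow> real"
  assumes "f summable_on UNIV"
  shows "integral\<^sup>L (count_space UNIV) f = infsum f UNIV"
  using infsetsum_infsum[of f UNIV] assms integrable_count_space_iff[of f]
  by (simp add: Infinite_Set_Sum.abs_summable_on_def infsetsum_def)

locale weights =
  fixes \<mu> :: "'v \<Rightarrow> real"
  assumes \<mu>_pos: "0 < \<mu> v"
begin

lemma \<mu>_nonneg: "0 \<le> \<mu> v" using \<mu>_pos[of v] by simp

lemma integrable_vertex_measure_iff:
  fixes f :: "'v \<Rightarrow> real"
  shows "integrable (vertex_measure \<mu>) f \<longleftrightarrow> (\<lambda>v. \<mu> v * f v) summable_on UNIV"
  unfolding vertex_measure_def point_measure_def
  by (subst integrable_real_density) (auto simp: \<mu>_nonneg integrable_count_space_iff)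

lemma integral_vertex_measure:
  fixes f :: "'v \<Rightarrow> real"
  assumes "(\<lambda>v. \<mu> v * f v) summable_on UNIV"
  shows "integral\<^sup>L (vertex_measure \<mu>) f = (\<Sum>\<^sub>\<infinity>v. \<mu> v * f v)"
  unfolding vertex_measure_def point_measure_def
  by (subst integral_real_density) (auto simp: \<mu>_nonneg integral_count_space_infsum[OF assms])

lemma lp_space_iff:
  "p \<noteq> \<infinity> \<Longrightarrow> f \<in> lp_space \<mu> p \<longleftrightarrow> (\<lambda>v. \<mu> v * \<bar>f v\<bar> powr enn2real p) summable_on UNIV"
  by (simp add: lp_space_def integrable_vertex_measure_iff)

lemma enn2real_2: "enn2real 2 = 2"
  by (metis enn2real_ennreal ennreal_numeral zero_le_numeral)

lemma l2_iff: "f \<in> l2_space \<mu> \<longleftrightarrow> (\<lambda>v. \<mu> v * (f v)\<^sup>2) summable_on UNIV"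
  by (simp add: lp_space_iff enn2real_2)

text \<open>A unitary map from \<open>l2_space \<mu>\<close> to the unweighted space.
  \<open>Abs_ell2\<close> is meaningful only for arguments from that set, whence the premise in the
  lemmas below.\<close>

definition "emb f = Abs_ell2 (\<lambda>v. sqrt (\<mu> v) * f v)"
definition "fn x = (\<lambda>v. coord x v / sqrt (\<mu> v))"

lemma coord_emb: "f \<in> l2_space \<mu> \<Longrightarrow> coord (emb f) v = sqrt (\<mu> v) * f v"
  unfolding emb_def by (subst Abs_ell2_inverse) (auto simp: l2_iff power_mult_distrib \<mu>_nonneg)

lemma fn_in_l2: "fn x \<in> l2_space \<mu>"
  using coord_summable[of x] \<mu>_pos[THEN less_imp_neq]
  by (simp add: l2_iff fn_def power_divide \<mu>_nonneg)

lemma fn_emb [simp]: "f \<in> l2_space \<mu> \<Longrightarrow> fn (emb f) = f"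
  using \<mu>_pos[THEN less_imp_neq] by (auto simp: fn_def coord_emb fun_eq_iff)

lemma emb_fn [simp]: "emb (fn x) = x"
proof (rule coord_eqI)
  fix v show "coord (emb (fn x)) v = coord x v"
    using \<mu>_pos[of v] by (subst coord_emb[OF fn_in_l2]) (simp add: fn_def)
qed

lemma l2_lincomb: "f \<in> l2_space \<mu> \<Longrightarrow> g \<in> l2_space \<mu> \<Longrightarrow> (\<lambda>v. a * f v + b * g v) \<in> l2_space \<mu>"
proof -
  assume f: "f \<in> l2_space \<mu>" and g: "g \<in> l2_space \<mu>"
  have eq: "\<mu> v * (a * f v + b * g v)\<^sup>2 = (a * (sqrt (\<mu> v) * f v) + b * (sqrt (\<mu> v) * g v))\<^sup>2" for v
  proof -
    have "a * (sqrt (\<mu> v) * f v) + b * (sqrt (\<mu> v) * g v) = sqrt (\<mu> v) * (a * f v + b * g v)"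
      by (simp add: algebra_simps)
    then show ?thesis by (simp add: power_mult_distrib \<mu>_nonneg)
  qed
  show ?thesis
    unfolding l2_iff eq
    by (rule summable_on_square_add) (use f g in \<open>simp_all add: l2_iff power_mult_distrib \<mu>_nonneg\<close>)
qed

lemma emb_lincomb:
  "f \<in> l2_space \<mu> \<Longrightarrow> g \<in> l2_space \<mu> \<Longrightarrow> emb (\<lambda>v. a * f v + b * g v) = a *\<^sub>R emb f + b *\<^sub>R emb g"
  by (rule coord_eqI) (simp add: coord_emb l2_lincomb algebra_simps)

lemma fn_lincomb: "fn (a *\<^sub>R x + b *\<^sub>R y) = (\<lambda>v. a * fn x v + b * fn y v)"
  by (simp add: fn_def add_divide_distrib)

lemma l2_diff: "f \<in> l2_space \<mu> \<Longrightarrow> g \<in> l2_space \<mu> \<Longrightarrow> (\<lambda>v. f v - g v) \<in> l2_space \<mu>"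
  using l2_lincomb[of f g 1 "-1"] by simp

lemma emb_diff: "f \<in> l2_space \<mu> \<Longrightarrow> g \<in> l2_space \<mu> \<Longrightarrow> emb (\<lambda>v. f v - g v) = emb f - emb g"
  using emb_lincomb[of f g 1 "-1"] by simp

lemma l2_scale: "f \<in> l2_space \<mu> \<Longrightarrow> (\<lambda>v. a * f v) \<in> l2_space \<mu>"
  using l2_lincomb[of f f a 0] by simp

lemma emb_scale: "f \<in> l2_space \<mu> \<Longrightarrow> emb (\<lambda>v. a * f v) = a *\<^sub>R emb f"
  using emb_lincomb[of f f a 0] by simp

lemma l2_uminus: "f \<in> l2_space \<mu> \<Longrightarrow> (\<lambda>v. - f v) \<in> l2_space \<mu>"
  using l2_scale[of f "-1"] by simp

lemma emb_uminus: "f \<in> l2_space \<mu> \<Longrightarrow> emb (\<lambda>v. - f v) = - emb f"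
  using emb_scale[of f "-1"] by simp

lemma l2_inner_emb:
  assumes "f \<in> l2_space \<mu>" "g \<in> l2_space \<mu>"
  shows "l2_inner \<mu> f g = emb f \<bullet> emb g"
proof -
  have eq: "coord (emb f) v * coord (emb g) v = \<mu> v * (f v * g v)" for v
    using assms \<mu>_nonneg[of v] by (simp add: coord_emb mult.assoc[symmetric])
  have "(\<lambda>v. \<mu> v * (f v * g v)) summable_on UNIV"
    using coord_mult_summable[of "emb f" "emb g"] by (simp add: eq)
  from integral_vertex_measure[OF this] show ?thesis
    by (simp add: l2_inner_def inner_ell2_def eq)
qed

lemma l2_norm_emb:
  assumes "f \<in> l2_space \<mu>"
  shows "l2_norm \<mu> f = norm (emb f)"
proof -
  have "(\<lambda>v. \<bar>f v\<bar> powr 2) = (\<lambda>v. f v * f v)" by (simp add: power2_eq_square)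
  then show ?thesis
    using l2_inner_emb[OF assms assms]
    by (simp add: lp_norm_def enn2real_2 norm_ell2_def l2_inner_def powr_half_sqrt)
qed

end

section \<open>Transfer of forms and semigroups to functions\<close>

locale l2_form = weights \<mu> for \<mu> :: "'v \<Rightarrow> real" +
  fixes D :: "('v \<Rightarrow> real) set" and A :: "('v \<Rightarrow> real) \<Rightarrow> 'v \<Rightarrow> real"
  assumes D_l2: "D \<subseteq> l2_space \<mu>"
    and A_l2: "f \<in> D \<Longrightarrow> A f \<in> l2_space \<mu>"
    and D_zero: "(\<lambda>v. 0) \<in> D"
    and D_lincomb: "f \<in> D \<Longrightarrow> g \<in> D \<Longrightarrow> (\<lambda>v. a * f v + b * g v) \<in> D"
    and A_lincomb: "f \<in> D \<Longrightarrow> g \<in> D \<Longrightarrow> A (\<lambda>v. a * f v + b * g v) = (\<lambda>v. a * A f v + b * A g v)"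
    and A_symm: "f \<in> D \<Longrightarrow> g \<in> D \<Longrightarrow> l2_inner \<mu> (A f) g = l2_inner \<mu> f (A g)"
    and A_nonnegative: "f \<in> D \<Longrightarrow> 0 \<le> l2_inner \<mu> (A f) f"
    and dense_in_l2: "closure (emb ` D) = UNIV"
begin

abbreviation "D' \<equiv> emb ` D"
abbreviation "A' x \<equiv> emb (A (fn x))"

lemma in_l2: "f \<in> D \<Longrightarrow> f \<in> l2_space \<mu>" using D_l2 by blast

lemma D'_fn: "x \<in> D' \<longleftrightarrow> fn x \<in> D"
proof
  assume "fn x \<in> D"
  then show "x \<in> D'" using imageI[of "fn x" D emb] by simp
qed (auto simp: in_l2)

lemma D_diff': "f \<in> D \<Longrightarrow> g \<in> D \<Longrightarrow> (\<lambda>v. f v - g v) \<in> D"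
  using D_lincomb[of f g 1 "-1"] by simp

sublocale F: symmetric_form D' A'
proof
  have lc: "fn (a *\<^sub>R x + b *\<^sub>R y) = (\<lambda>v. a * fn x v + b * fn y v)" for a b x y
    by (rule fn_lincomb)
  have D'_lc: "a *\<^sub>R x + b *\<^sub>R y \<in> D'" if "x \<in> D'" "y \<in> D'" for a b x y
    using that D_lincomb unfolding D'_fn lc by blast
  have A'_lc: "A' (a *\<^sub>R x + b *\<^sub>R y) = a *\<^sub>R A' x + b *\<^sub>R A' y" if "x \<in> D'" "y \<in> D'" for a b x y
    using that unfolding D'_fn lc by (simp add: A_lincomb A_l2 emb_lincomb)
  have z: "0 \<in> D'"
  proof -
    have "emb (\<lambda>v. 0) = 0" using emb_scale[of "fn 0" 0] fn_in_l2[of 0] by simp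
    then show ?thesis using imageI[OF D_zero, of emb] by simp
  qed
  show "subspace D'"
  proof (rule subspaceI[OF z])
    show "x + y \<in> D'" if "x \<in> D'" "y \<in> D'" for x y using D'_lc[OF that, of 1 1] by simp
    show "c *\<^sub>R x \<in> D'" if "x \<in> D'" for c x using D'_lc[OF that that, of c 0] by simp
  qed
  fix x y and r :: real assume x: "x \<in> D'"
  show "A' (r *\<^sub>R x) = r *\<^sub>R A' x" using A'_lc[OF x x, of r 0] by simp
  show "0 \<le> A' x \<bullet> x"
    using x A_nonnegative[of "fn x"] unfolding D'_fn by (simp add: l2_inner_emb A_l2 fn_in_l2)
  assume y: "y \<in> D'"
  show "A' (x + y) = A' x + A' y" using A'_lc[OF x y, of 1 1] by simp
  show "A' x \<bullet> y = x \<bullet> A' y"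
    using x y A_symm[of "fn x" "fn y"] unfolding D'_fn by (simp add: l2_inner_emb A_l2 fn_in_l2)
qed (rule dense_in_l2)

lemma q_emb: "f \<in> D \<Longrightarrow> g \<in> D \<Longrightarrow> F.q (emb f) (emb g) = l2_inner \<mu> (A f) g"
  by (simp add: F.q_def in_l2 l2_inner_emb A_l2)

lemma form_approx_iff:
  "form_approx \<mu> D A s f \<longleftrightarrow> (\<forall>n. s n \<in> D) \<and> f \<in> l2_space \<mu> \<and> F.approx (\<lambda>n. emb (s n)) (emb f)"
proof (cases "(\<forall>n. s n \<in> D) \<and> f \<in> l2_space \<mu>")
  case True
  then have s: "s n \<in> D" "s n \<in> l2_space \<mu>" and f: "f \<in> l2_space \<mu>" for n by (auto intro: in_l2)
  have 1: "l2_norm \<mu> (\<lambda>v. s n v - f v) = norm (emb (s n) - emb f)" for n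
    using s f by (simp add: l2_norm_emb l2_diff emb_diff)
  have 2: "l2_inner \<mu> (A (\<lambda>v. s m v - s n v)) (\<lambda>v. s m v - s n v)
    = F.q (emb (s m) - emb (s n)) (emb (s m) - emb (s n))" for m n
    using q_emb[of "\<lambda>v. s m v - s n v" "\<lambda>v. s m v - s n v"] s D_diff' by (simp add: emb_diff)
  have 3: "((\<lambda>n. norm (emb (s n) - emb f)) \<longlonglongrightarrow> 0) \<longleftrightarrow> (\<lambda>n. emb (s n)) \<longlonglongrightarrow> emb f"
    by (simp add: tendsto_norm_zero_iff LIM_zero_iff)
  show ?thesis unfolding form_approx_def F.approx_def 1 2 3 using s f by simp
qed (auto simp: form_approx_def)

lemma approx_form_approx: "F.approx s x \<Longrightarrow> form_approx \<mu> D A (\<lambda>n. fn (s n)) (fn x)"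
  using F.approx_D D'_fn fn_in_l2 by (simp add: form_approx_iff)

lemma form_domain_iff: "f \<in> form_domain \<mu> D A \<longleftrightarrow> f \<in> l2_space \<mu> \<and> (\<exists>s. F.approx s (emb f))"
proof
  assume "f \<in> form_domain \<mu> D A"
  then show "f \<in> l2_space \<mu> \<and> (\<exists>s. F.approx s (emb f))"
    by (auto simp: form_domain_def form_approx_iff)
next
  assume "f \<in> l2_space \<mu> \<and> (\<exists>s. F.approx s (emb f))"
  then obtain s where "F.approx s (emb f)" and f: "f \<in> l2_space \<mu>" by blast
  from approx_form_approx[OF this(1)] show "f \<in> form_domain \<mu> D A"
    unfolding form_domain_def fn_emb[OF f] by blast
qed

text \<open>The definite description has a unique solution only if some approximating sequences
  exist; the images of \<open>s\<close> and \<open>r\<close> under \<open>fn\<close> supply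
  them.\<close>

lemma closed_form_tendsto:
  assumes s: "F.approx s (emb f)" and r: "F.approx r (emb g)" and fg: "f \<in> l2_space \<mu>" "g \<in> l2_space \<mu>"
  shows "(\<lambda>n. F.q (s n) (r n)) \<longlonglongrightarrow> closed_form \<mu> D A f g"
proof -
  obtain l where l: "(\<lambda>n. F.q (s n) (r n)) \<longlonglongrightarrow> l"
    using F.approx_q_convergent[OF s r] by (auto simp: convergent_def)
  have eq: "F.q (emb (s' n)) (emb (r' n)) = l2_inner \<mu> (A (s' n)) (r' n)"
    if "form_approx \<mu> D A s' f" "form_approx \<mu> D A r' g" for s' r' n
    using that by (simp add: q_emb form_approx_iff)
  have "closed_form \<mu> D A f g = l"
    unfolding closed_form_def
  proof (rule the_equality)
    show "\<forall>s r. form_approx \<mu> D A s f \<and> form_approx \<mu> D A r g \<longrightarrow> (\<lambda>n. l2_inner \<mu> (A (s n)) (r n)) \<longlonglongrightarrow> l"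
    proof (intro allI impI)
      fix s' r' assume H: "form_approx \<mu> D A s' f \<and> form_approx \<mu> D A r' g"
      then have "(\<lambda>n. F.q (emb (s' n)) (emb (r' n))) \<longlonglongrightarrow> l"
        by (intro F.approx_q_unique[OF s r _ _ l]) (simp_all add: form_approx_iff)
      then show "(\<lambda>n. l2_inner \<mu> (A (s' n)) (r' n)) \<longlonglongrightarrow> l" using eq H by simp
    qed
  next
    fix l' assume H: "\<forall>s r. form_approx \<mu> D A s f \<and> form_approx \<mu> D A r g \<longrightarrow> (\<lambda>n. l2_inner \<mu> (A (s n)) (r n)) \<longlonglongrightarrow> l'"
    have a: "form_approx \<mu> D A (\<lambda>n. fn (s n)) f" "form_approx \<mu> D A (\<lambda>n. fn (r n)) g"
      using approx_form_approx[OF s] approx_form_approx[OF r] fg by simp_all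
    then have "(\<lambda>n. l2_inner \<mu> (A (fn (s n))) (fn (r n))) \<longlonglongrightarrow> l'" using H by blast
    then have "(\<lambda>n. F.q (s n) (r n)) \<longlonglongrightarrow> l'" using eq[OF a] by simp
    then show "l' = l" using l LIMSEQ_unique by blast
  qed
  then show ?thesis using l by simp
qed

lemma friedrichs_extension_iff:
  "(f, h) \<in> friedrichs_extension \<mu> D A \<longleftrightarrow>
     f \<in> l2_space \<mu> \<and> h \<in> l2_space \<mu> \<and> (emb f, emb h) \<in> F.friedrichs"
proof (cases "f \<in> l2_space \<mu> \<and> h \<in> l2_space \<mu> \<and> (\<exists>s. F.approx s (emb f))")
  case True
  then obtain s where s: "F.approx s (emb f)" and f: "f \<in> l2_space \<mu>" and h: "h \<in> l2_space \<mu>" by blast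
  have "(\<forall>g\<in>form_domain \<mu> D A. closed_form \<mu> D A f g = l2_inner \<mu> h g) \<longleftrightarrow>
    (\<forall>s r x. F.approx s (emb f) \<longrightarrow> F.approx r x \<longrightarrow> (\<lambda>n. F.q (s n) (r n)) \<longlonglongrightarrow> emb h \<bullet> x)" (is "?l \<longleftrightarrow> ?r")
  proof
    assume ?l
    show ?r
    proof (intro allI impI)
      fix s r x assume a: "F.approx s (emb f)" "F.approx r x"
      have "fn x \<in> form_domain \<mu> D A" using a by (auto simp: form_domain_iff fn_in_l2)
      then have "closed_form \<mu> D A f (fn x) = l2_inner \<mu> h (fn x)" using \<open>?l\<close> by blast
      moreover have "(\<lambda>n. F.q (s n) (r n)) \<longlonglongrightarrow> closed_form \<mu> D A f (fn x)"
        using a f by (intro closed_form_tendsto) (auto simp: fn_in_l2)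
      ultimately show "(\<lambda>n. F.q (s n) (r n)) \<longlonglongrightarrow> emb h \<bullet> x"
        by (simp add: l2_inner_emb h fn_in_l2)
    qed
  next
    assume ?r
    show ?l
    proof
      fix g assume "g \<in> form_domain \<mu> D A"
      then obtain r where r: "F.approx r (emb g)" and g: "g \<in> l2_space \<mu>" by (auto simp: form_domain_iff)
      show "closed_form \<mu> D A f g = l2_inner \<mu> h g"
        using LIMSEQ_unique[OF closed_form_tendsto[OF s r f g]] \<open>?r\<close> s r
        by (simp add: l2_inner_emb h g)
    qed
  qed
  then show ?thesis
    using True by (simp add: friedrichs_extension_def F.friedrichs_iff form_domain_iff)
qed (auto simp: friedrichs_extension_def F.friedrichs_iff form_domain_iff)

text \<open>The negative of the Friedrichs extension, in the form in which
  \<open>semigroup_exp\<close> prescribes the generator.\<close>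

definition "G = {(f, \<lambda>v. - h v) | f h. (f, h) \<in> friedrichs_extension \<mu> D A}"

lemma G_iff: "(f, g) \<in> G \<longleftrightarrow> f \<in> l2_space \<mu> \<and> g \<in> l2_space \<mu> \<and> (emb f, - emb g) \<in> F.friedrichs"
proof
  assume "(f, g) \<in> G"
  then show "f \<in> l2_space \<mu> \<and> g \<in> l2_space \<mu> \<and> (emb f, - emb g) \<in> F.friedrichs"
    by (auto simp: G_def friedrichs_extension_iff emb_uminus l2_uminus)
next
  assume H: "f \<in> l2_space \<mu> \<and> g \<in> l2_space \<mu> \<and> (emb f, - emb g) \<in> F.friedrichs"
  then have "(f, \<lambda>v. - g v) \<in> friedrichs_extension \<mu> D A"
    by (simp add: friedrichs_extension_iff emb_uminus l2_uminus)
  then show "(f, g) \<in> G" unfolding G_def by force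
qed

text \<open>The two norms are compared for \<open>0 < t\<close> only, and \<open>at_right 0\<close>
  sees no other times.\<close>

lemma generator_iff:
  assumes "\<And>t. 0 \<le> t \<Longrightarrow> S t f \<in> l2_space \<mu>" "f \<in> l2_space \<mu>" "g \<in> l2_space \<mu>"
  shows "(f, g) \<in> generator \<mu> S \<longleftrightarrow>
    ((\<lambda>t. (emb (S t f) - emb f) /\<^sub>R t) \<longlongrightarrow> emb g) (at_right 0)"
proof -
  have eq: "l2_norm \<mu> (\<lambda>v. (S t f v - f v) / t - g v) = norm ((emb (S t f) - emb f) /\<^sub>R t - emb g)"
    if "0 < t" for t
  proof -
    have S: "S t f \<in> l2_space \<mu>" using assms(1) that by simp
    have "(\<lambda>v. (S t f v - f v) / t - g v) = (\<lambda>v. (1 / t) * (S t f v - f v) - g v)" by simp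
    then show ?thesis
      using S assms l2_diff[OF S assms(2)]
      by (simp only: l2_norm_emb l2_diff l2_scale emb_diff emb_scale inverse_eq_divide)
  qed
  have "(f, g) \<in> generator \<mu> S \<longleftrightarrow>
      ((\<lambda>t. norm ((emb (S t f) - emb f) /\<^sub>R t - emb g)) \<longlongrightarrow> 0) (at_right 0)"
    unfolding generator_def using assms
    by (auto intro!: tendsto_cong eventually_mono[OF F.ev_pos] eq)
  then show ?thesis
    by (simp add: tendsto_norm_zero_iff LIM_zero_iff)
qed

definition "Tf t f = fn (F.T t (emb f))"

lemma Tf_l2: "Tf t f \<in> l2_space \<mu>" by (simp add: Tf_def fn_in_l2)

lemma bounded_operator_Tf: "0 \<le> t \<Longrightarrow> bounded_operator \<mu> (Tf t)"
  unfolding bounded_operator_def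
proof (intro conjI ballI allI exI)
  fix f g and a b :: real assume t: "0 \<le> t" and f: "f \<in> l2_space \<mu>"
  show "Tf t f \<in> l2_space \<mu>" by (rule Tf_l2)
  show "l2_norm \<mu> (Tf t f) \<le> 1 * l2_norm \<mu> f"
    using F.norm_T[OF t] by (simp add: l2_norm_emb Tf_l2 f) (simp add: Tf_def)
  assume g: "g \<in> l2_space \<mu>"
  have "emb (Tf t (\<lambda>v. a * f v + b * g v)) = emb (\<lambda>v. a * Tf t f v + b * Tf t g v)"
    by (simp only: emb_lincomb Tf_l2) (simp add: Tf_def emb_lincomb f g F.T_add F.T_scale t)
  then have "fn (emb (Tf t (\<lambda>v. a * f v + b * g v))) = fn (emb (\<lambda>v. a * Tf t f v + b * Tf t g v))"
    by (rule arg_cong)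
  then show "Tf t (\<lambda>v. a * f v + b * g v) = (\<lambda>v. a * Tf t f v + b * Tf t g v)"
    by (simp only: fn_emb Tf_l2 l2_lincomb)
qed

lemma c0_semigroup_Tf: "c0_semigroup \<mu> Tf"
  unfolding c0_semigroup_def
proof (intro conjI ballI allI impI)
  show "bounded_operator \<mu> (Tf t)" if "0 \<le> t" for t using that by (rule bounded_operator_Tf)
  fix f assume f: "f \<in> l2_space \<mu>"
  show "Tf 0 f = f" using f by (simp add: Tf_def)
  show "Tf (s + t) f = Tf s (Tf t f)" if "0 \<le> s" "0 \<le> t" for s t
    using that by (simp add: Tf_def F.T_semigroup)
  have "l2_norm \<mu> (\<lambda>v. Tf t f v - f v) = norm (F.T t (emb f) - emb f)" for t
    by (simp only: l2_norm_emb l2_diff Tf_l2 f emb_diff) (simp add: Tf_def)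
  moreover have "((\<lambda>t. norm (F.T t (emb f) - emb f)) \<longlongrightarrow> 0) (at_right 0)"
    using F.T_continuous_0[of "emb f"] by (simp add: tendsto_norm_zero_iff LIM_zero_iff)
  ultimately show "((\<lambda>t. l2_norm \<mu> (\<lambda>v. Tf t f v - f v)) \<longlongrightarrow> 0) (at_right 0)" by simp
qed

lemma generator_Tf: "generator \<mu> Tf = G"
proof -
  have "(f, g) \<in> generator \<mu> Tf \<longleftrightarrow> (f, g) \<in> G" for f g
  proof (cases "f \<in> l2_space \<mu> \<and> g \<in> l2_space \<mu>")
    case True
    then have "(f, g) \<in> generator \<mu> Tf \<longleftrightarrow>
      ((\<lambda>t. (F.T t (emb f) - emb f) /\<^sub>R t) \<longlongrightarrow> emb g) (at_right 0)"
      using generator_iff[of Tf f g] Tf_l2 by (simp add: Tf_def)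
    also have "\<dots> \<longleftrightarrow> (emb f, - emb g) \<in> F.friedrichs"
      using F.T_generator[of "emb f" "- emb g"] F.generator_T by auto
    finally show ?thesis using True by (simp add: G_iff)
  qed (auto simp: generator_def G_iff)
  then show ?thesis by auto
qed

text \<open>The chosen family is known to satisfy its specification only because \<open>Tf\<close>
  does; uniqueness, applied to its transport \<open>S'\<close> to \<open>ell2\<close>, then
  identifies the two on \<open>l2_space \<mu>\<close>. Off that set the choice is arbitrary.\<close>

theorem semigroup_exp_eq:
  assumes t: "0 \<le> t"
  shows "bounded_operator \<mu> (semigroup_exp \<mu> (friedrichs_extension \<mu> D A) t)"
    and "f \<in> l2_space \<mu> \<Longrightarrow> semigroup_exp \<mu> (friedrichs_extension \<mu> D A) t f = Tf t f"
proof -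
  define S where "S = semigroup_exp \<mu> (friedrichs_extension \<mu> D A)"
  have "\<exists>T. c0_semigroup \<mu> T \<and> generator \<mu> T = G" using c0_semigroup_Tf generator_Tf by blast
  then have "c0_semigroup \<mu> S \<and> generator \<mu> S = G"
    unfolding S_def semigroup_exp_def G_def by (rule someI_ex)
  then have bo: "\<And>t. 0 \<le> t \<Longrightarrow> bounded_operator \<mu> (S t)" and S0: "\<And>f. f \<in> l2_space \<mu> \<Longrightarrow> S 0 f = f"
    and Sadd: "\<And>s t f. 0 \<le> s \<Longrightarrow> 0 \<le> t \<Longrightarrow> f \<in> l2_space \<mu> \<Longrightarrow> S (s + t) f = S s (S t f)"
    and c0: "\<And>f. f \<in> l2_space \<mu> \<Longrightarrow> ((\<lambda>t. l2_norm \<mu> (\<lambda>v. S t f v - f v)) \<longlongrightarrow> 0) (at_right 0)"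
    and gen: "generator \<mu> S = G"
    by (auto simp: c0_semigroup_def)
  show "bounded_operator \<mu> (semigroup_exp \<mu> (friedrichs_extension \<mu> D A) t)"
    using bo[OF t] by (simp add: S_def)
  have Sl2: "S t f \<in> l2_space \<mu>" if "0 \<le> t" "f \<in> l2_space \<mu>" for t f
    using bo[OF that(1)] that(2) by (auto simp: bounded_operator_def)
  define S' where "S' t x = emb (S t (fn x))" for t x
  have S'_eq: "S' \<tau> x = F.T \<tau> x" if "0 \<le> \<tau>" for \<tau> x
  proof (rule F.semigroup_unique)
    show "bounded_linear (S' t)" if t: "0 \<le> t" for t
    proof -
      have lc: "S' t (a *\<^sub>R x + b *\<^sub>R y) = a *\<^sub>R S' t x + b *\<^sub>R S' t y" for a b x y
      proof -
        have "fn (a *\<^sub>R x + b *\<^sub>R y) = (\<lambda>v. a * fn x v + b * fn y v)"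
          by (rule fn_lincomb)
        moreover have "S t (\<lambda>v. a * fn x v + b * fn y v) = (\<lambda>v. a * S t (fn x) v + b * S t (fn y) v)"
          using bo[OF t] fn_in_l2 unfolding bounded_operator_def by blast
        ultimately show ?thesis by (simp add: S'_def emb_lincomb Sl2 t fn_in_l2)
      qed
      obtain K where K: "\<And>f. f \<in> l2_space \<mu> \<Longrightarrow> l2_norm \<mu> (S t f) \<le> K * l2_norm \<mu> f"
        using bo[OF t] unfolding bounded_operator_def by blast
      show ?thesis
      proof (rule bounded_linear_intro)
        show "S' t (x + y) = S' t x + S' t y" for x y using lc[of 1 x 1 y] by simp
        show "S' t (r *\<^sub>R x) = r *\<^sub>R S' t x" for r x using lc[of r x 0 x] by simp
        show "norm (S' t x) \<le> norm x * K" for x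
          using K[OF fn_in_l2, of x] by (simp add: l2_norm_emb fn_in_l2 Sl2 t S'_def mult.commute)
      qed
    qed
    show "S' 0 x = x" for x by (simp add: S'_def S0 fn_in_l2)
    show "S' (s + t) x = S' s (S' t x)" if "0 \<le> s" "0 \<le> t" for s t x
      using that by (simp add: S'_def Sadd fn_in_l2 Sl2)
    show "((\<lambda>t. S' t x) \<longlongrightarrow> x) (at_right 0)" for x
    proof -
      have "l2_norm \<mu> (\<lambda>v. S t (fn x) v - fn x v) = norm (S' t x - x)" if "0 < t" for t
        using that Sl2[of t "fn x"] by (simp add: S'_def l2_norm_emb l2_diff emb_diff fn_in_l2)
      then have "((\<lambda>t. norm (S' t x - x)) \<longlongrightarrow> 0) (at_right 0)"
        by (intro Lim_transform_eventually[OF c0[OF fn_in_l2[of x]]] eventually_mono[OF F.ev_pos])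
      then show ?thesis by (simp add: tendsto_norm_zero_iff LIM_zero_iff)
    qed
    show "(((\<lambda>t. (S' t x - x) /\<^sub>R t) \<longlongrightarrow> y) (at_right 0)) \<longleftrightarrow> (x, - y) \<in> F.friedrichs" for x y
      using generator_iff[of S "fn x" "fn y"] Sl2 fn_in_l2 G_iff[of "fn x" "fn y"]
      by (simp add: gen S'_def)
  qed (rule that)
  show "semigroup_exp \<mu> (friedrichs_extension \<mu> D A) t f = Tf t f" if f: "f \<in> l2_space \<mu>"
  proof -
    have "S t f = fn (S' t (emb f))" using f Sl2[OF t f] by (simp add: S'_def)
    also have "\<dots> = Tf t f" by (simp only: S'_eq[OF t] Tf_def)
    finally show ?thesis by (simp add: S_def)
  qed
qed

end

section \<open>The completion of a graph\<close>

locale distance =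
  fixes d :: "'v \<Rightarrow> 'v \<Rightarrow> ennreal"
  assumes d_refl: "d x x = 0" and d_sym: "d x y = d y x" and d_triangle: "d x z \<le> d x y + d y z"
begin

lemma cauchy_seqsD: "x \<in> cauchy_seqs d \<Longrightarrow> 0 < e \<Longrightarrow> \<exists>N. \<forall>m\<ge>N. \<forall>n\<ge>N. d (x m) (x n) < e"
  by (simp add: cauchy_seqs_def)

text \<open>Distances may be infinite, so the real Cauchy criterion is replaced by the comparison
  \<open>close\<close> of any two late terms up to \<open>e\<close>, which makes the upper and lower
  limits agree.\<close>

lemma d_cauchy_tendsto:
  assumes x: "x \<in> cauchy_seqs d" and y: "y \<in> cauchy_seqs d"
  shows "\<exists>l. (\<lambda>n. d (x n) (y n)) \<longlonglongrightarrow> l"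
proof -
  let ?a = "\<lambda>n. d (x n) (y n)"
  have close: "\<exists>N. \<forall>m\<ge>N. \<forall>n\<ge>N. ?a m \<le> ?a n + ennreal e" if e: "0 < e" for e
  proof -
    have pos: "ennreal (e / 2) > 0" using e by simp
    obtain N where N1: "\<And>m n. m \<ge> N \<Longrightarrow> n \<ge> N \<Longrightarrow> d (x m) (x n) < ennreal (e / 2)"
      using cauchy_seqsD[OF x pos] by blast
    obtain N' where N2: "\<And>m n. m \<ge> N' \<Longrightarrow> n \<ge> N' \<Longrightarrow> d (y m) (y n) < ennreal (e / 2)"
      using cauchy_seqsD[OF y pos] by blast
    have "?a m \<le> ?a n + ennreal e" if "m \<ge> max N N'" "n \<ge> max N N'" for m n
    proof -
      have "?a m \<le> d (x m) (x n) + (d (x n) (y n) + d (y n) (y m))"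
        by (rule order_trans[OF d_triangle[of _ _ "x n"] add_left_mono[OF d_triangle]])
      also have "\<dots> \<le> ennreal (e / 2) + (?a n + ennreal (e / 2))"
        using N1[of m n] N2[of n m] that by (intro add_mono) auto
      also have "\<dots> = ?a n + (ennreal (e / 2) + ennreal (e / 2))" by (simp add: ac_simps)
      also have "ennreal (e / 2) + ennreal (e / 2) = ennreal e"
        using e by (simp flip: ennreal_plus)
      finally show ?thesis .
    qed
    then show ?thesis by blast
  qed
  have "limsup ?a \<le> liminf ?a"
  proof (rule ennreal_le_epsilon)
    fix e :: real assume "0 < e"
    then have e: "0 < e / 2" by simp
    obtain N where N: "\<And>m n. m \<ge> N \<Longrightarrow> n \<ge> N \<Longrightarrow> ?a m \<le> ?a n + ennreal e"
      using close[OF \<open>0 < e\<close>] by blast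
    have 1: "limsup ?a \<le> ?a n + ennreal e" if "n \<ge> N" for n
      by (rule Limsup_bounded) (use N that in \<open>auto simp: eventually_sequentially\<close>)
    have "limsup ?a - ennreal e \<le> liminf ?a"
    proof (rule Liminf_bounded[OF eventually_sequentiallyI[of N]])
      fix n assume "n \<ge> N"
      show "limsup ?a - ennreal e \<le> ?a n"
        using 1[OF \<open>n \<ge> N\<close>] by (simp only: ennreal_minus_le_iff add.commute) simp
    qed
    then show "limsup ?a \<le> liminf ?a + ennreal e"
      unfolding ennreal_minus_le_iff by (simp only: add.commute)
  qed
  then have "liminf ?a = limsup ?a" using Liminf_le_Limsup[of sequentially ?a] by simp
  then show ?thesis using tendsto_iff_Liminf_eq_Limsup[of sequentially ?a "limsup ?a"] by auto
qed

text \<open>Used in both directions, this makes the distance of two classes independent of the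
  representatives.\<close>

lemma cauchy_rel_tendsto_le:
  assumes x: "(x, x') \<in> cauchy_rel d" and y: "(y, y') \<in> cauchy_rel d"
    and l: "(\<lambda>n. d (x n) (y n)) \<longlonglongrightarrow> l" and l': "(\<lambda>n. d (x' n) (y' n)) \<longlonglongrightarrow> l'"
  shows "l' \<le> l"
proof (rule LIMSEQ_le[OF l'])
  have "(\<lambda>n. d (x n) (x' n) + (d (x n) (y n) + d (y n) (y' n))) \<longlonglongrightarrow> 0 + (l + 0)"
    using x y l by (intro tendsto_add) (auto simp: cauchy_rel_def)
  then show "(\<lambda>n. d (x n) (x' n) + (d (x n) (y n) + d (y n) (y' n))) \<longlonglongrightarrow> l" by simp
  have "d (x' n) (y' n) \<le> d (x n) (x' n) + (d (x n) (y n) + d (y n) (y' n))" for n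
    using order_trans[OF d_triangle[of "x' n" "y' n" "x n"] add_left_mono[OF d_triangle[of "x n" "y' n" "y n"]]]
    by (simp add: d_sym)
  then show "\<exists>N. \<forall>n\<ge>N. d (x' n) (y' n) \<le> d (x n) (x' n) + (d (x n) (y n) + d (y n) (y' n))" by blast
qed

lemma equiv_cauchy_rel: "equiv (cauchy_seqs d) (cauchy_rel d)"
proof (rule equivI)
  show "refl_on (cauchy_seqs d) (cauchy_rel d)"
    by (auto simp: refl_on_def cauchy_rel_def d_refl)
  show "sym (cauchy_rel d)"
    unfolding sym_def cauchy_rel_def using d_sym by auto
  show "trans (cauchy_rel d)"
  proof (rule transI)
    fix x y z assume xy: "(x, y) \<in> cauchy_rel d" and yz: "(y, z) \<in> cauchy_rel d"
    have "(\<lambda>n. d (x n) (z n)) \<longlonglongrightarrow> 0"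
    proof (rule tendsto_sandwich[OF _ _ tendsto_const])
      show "(\<lambda>n. d (x n) (y n) + d (y n) (z n)) \<longlonglongrightarrow> 0"
        using xy yz tendsto_add[of "\<lambda>n. d (x n) (y n)" 0 sequentially "\<lambda>n. d (y n) (z n)" 0]
        by (auto simp: cauchy_rel_def)
    qed (auto simp: d_triangle)
    then show "(x, z) \<in> cauchy_rel d" using xy yz by (auto simp: cauchy_rel_def)
  qed
qed (auto simp: cauchy_rel_def)

lemma completion_class:
  assumes "X \<in> metric_completion d"
  shows "\<exists>x. x \<in> X" and "x \<in> X \<Longrightarrow> x \<in> cauchy_seqs d" and "x \<in> X \<Longrightarrow> x' \<in> X \<Longrightarrow> (x, x') \<in> cauchy_rel d"
    and "x \<in> X \<Longrightarrow> X = cauchy_rel d `` {x}"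
proof -
  obtain z where z: "z \<in> cauchy_seqs d" "X = cauchy_rel d `` {z}"
    using assms unfolding metric_completion_def by (rule quotientE)
  show "\<exists>x. x \<in> X" using z equiv_class_self[OF equiv_cauchy_rel] by blast
  show "x \<in> X \<Longrightarrow> x \<in> cauchy_seqs d" using z by (auto simp: cauchy_rel_def)
  show "x \<in> X \<Longrightarrow> x' \<in> X \<Longrightarrow> (x, x') \<in> cauchy_rel d"
    using assms quotient_eq_iff[OF equiv_cauchy_rel, of X X x x'] unfolding metric_completion_def by blast
  show "x \<in> X \<Longrightarrow> X = cauchy_rel d `` {x}"
    using z equiv_class_eq[OF equiv_cauchy_rel] by blast
qed

lemma completion_dist_tendsto:
  assumes X: "X \<in> metric_completion d" and Y: "Y \<in> metric_completion d" and x: "x \<in> X" and y: "y \<in> Y"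
  shows "(\<lambda>n. d (x n) (y n)) \<longlonglongrightarrow> completion_dist d X Y"
proof -
  obtain l where l: "(\<lambda>n. d (x n) (y n)) \<longlonglongrightarrow> l"
    using d_cauchy_tendsto completion_class(2)[OF X x] completion_class(2)[OF Y y] by blast
  have all: "(\<lambda>n. d (x' n) (y' n)) \<longlonglongrightarrow> l" if x': "x' \<in> X" and y': "y' \<in> Y" for x' y'
  proof -
    obtain l' where l': "(\<lambda>n. d (x' n) (y' n)) \<longlonglongrightarrow> l'"
      using d_cauchy_tendsto completion_class(2)[OF X x'] completion_class(2)[OF Y y'] by blast
    have "l' = l"
      using cauchy_rel_tendsto_le[OF _ _ l l'] cauchy_rel_tendsto_le[OF _ _ l' l]
        completion_class(3)[OF X] completion_class(3)[OF Y] x y x' y' by (intro antisym) auto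
    then show ?thesis using l' by simp
  qed
  have "completion_dist d X Y = l"
    unfolding completion_dist_def
    by (rule the_equality) (use all x y l LIMSEQ_unique in blast)+
  then show ?thesis using l by simp
qed

lemma const_cauchy: "(\<lambda>_. v) \<in> cauchy_seqs d"
  by (auto simp: cauchy_seqs_def d_refl)

lemma completion_embed:
  "completion_embed d v \<in> metric_completion d" "(\<lambda>_. v) \<in> completion_embed d v"
  unfolding completion_embed_def metric_completion_def
  using const_cauchy equiv_class_self[OF equiv_cauchy_rel] by (auto intro: quotientI)

text \<open>An extension exists because \<open>\<phi>\<close> is eventually constant along Cauchy
  sequences and the eventual value is locally constant on the completion. Whichever extension was
  chosen takes this value, because the embedded points \<open>x n\<close> converge to
  \<open>X\<close>.\<close>

lemma locally_constant_extension:
  fixes \<phi> :: "'v \<Rightarrow> real"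
  assumes r: "0 < r" "\<And>u v. d u v < r \<Longrightarrow> \<phi> u = \<phi> v"
    and X: "X \<in> metric_completion d" and x: "x \<in> X"
  shows "\<forall>\<^sub>F n in sequentially. \<phi> (x n) = continuous_extension d \<phi> X"
proof -
  have evc: "\<exists>c. \<forall>\<^sub>F n in sequentially. \<phi> (y n) = c" if y: "y \<in> cauchy_seqs d" for y
  proof -
    obtain N where "\<And>m n. m \<ge> N \<Longrightarrow> n \<ge> N \<Longrightarrow> d (y m) (y n) < r"
      using cauchy_seqsD[OF y r(1)] by blast
    then have "\<phi> (y n) = \<phi> (y N)" if "n \<ge> N" for n using r(2) that by blast
    then show ?thesis unfolding eventually_sequentially by blast
  qed
  have same: "\<forall>\<^sub>F n in sequentially. \<phi> (z n) = c"
    if "\<forall>\<^sub>F n in sequentially. \<phi> (y n) = c" "(\<lambda>n. d (y n) (z n)) \<longlonglongrightarrow> l" "l < r" for y z c l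
  proof -
    have "\<forall>\<^sub>F n in sequentially. d (y n) (z n) < r" by (rule order_tendstoD(2)[OF that(2,3)])
    with that(1) show "\<forall>\<^sub>F n in sequentially. \<phi> (z n) = c"
      by eventually_elim (metis r(2))
  qed
  define F where "F Y = (SOME c. \<exists>y\<in>Y. \<forall>\<^sub>F n in sequentially. \<phi> (y n) = c)" for Y
  have F: "\<forall>\<^sub>F n in sequentially. \<phi> (y n) = F Y" if Y: "Y \<in> metric_completion d" and y: "y \<in> Y" for Y y
  proof -
    have "\<exists>c. \<exists>y\<in>Y. \<forall>\<^sub>F n in sequentially. \<phi> (y n) = c" using evc completion_class(2)[OF Y y] y by blast
    then have "\<exists>y\<in>Y. \<forall>\<^sub>F n in sequentially. \<phi> (y n) = F Y" unfolding F_def by (rule someI_ex)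
    then obtain z where z: "z \<in> Y" "\<forall>\<^sub>F n in sequentially. \<phi> (z n) = F Y" by blast
    have "(\<lambda>n. d (z n) (y n)) \<longlonglongrightarrow> 0" using completion_class(3)[OF Y z(1) y] by (simp add: cauchy_rel_def)
    then show ?thesis using same[OF z(2)] r(1) by simp
  qed
  have "continuous_map (completion_topology d) euclideanreal F"
    unfolding continuous_map_def openin_completion_topology topspace_completion_topology completion_open_def
  proof (intro conjI allI impI ballI)
    fix U Y assume Y: "Y \<in> {x \<in> metric_completion d. F x \<in> U}"
    have "F Z = F Y" if Z: "Z \<in> metric_completion d" "completion_dist d Y Z < r" for Z
    proof -
      obtain y z where yz: "y \<in> Y" "z \<in> Z" using completion_class(1) Y Z by blast
      have "\<forall>\<^sub>F n in sequentially. \<phi> (z n) = F Y"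
        using same[OF F[of Y y] completion_dist_tendsto[of Y Z y z]] Y Z yz by simp
      moreover have "\<forall>\<^sub>F n in sequentially. \<phi> (z n) = F Z" using F Z yz by blast
      ultimately have "\<forall>\<^sub>F n in sequentially. F Z = F Y" by eventually_elim simp
      then show ?thesis by simp
    qed
    then show "\<exists>r>0. \<forall>Z\<in>metric_completion d. completion_dist d Y Z < r \<longrightarrow> Z \<in> {x \<in> metric_completion d. F x \<in> U}"
      using Y r(1) by (intro exI[of _ r]) auto
  qed auto
  moreover have "F (completion_embed d v) = \<phi> v" for v
    using F[OF completion_embed] by simp
  ultimately have "\<exists>F. continuous_map (completion_topology d) euclideanreal F \<and> (\<forall>v. F (completion_embed d v) = \<phi> v)"
    by blast
  then have "continuous_map (completion_topology d) euclideanreal (continuous_extension d \<phi>) \<and>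
      (\<forall>v. continuous_extension d \<phi> (completion_embed d v) = \<phi> v)"
    unfolding continuous_extension_def by (rule someI_ex)
  then have cont: "continuous_map (completion_topology d) euclideanreal (continuous_extension d \<phi>)"
    and emb: "\<And>v. continuous_extension d \<phi> (completion_embed d v) = \<phi> v" by auto
  let ?G = "continuous_extension d \<phi>"
  have "(\<lambda>n. \<phi> (x n)) \<longlonglongrightarrow> ?G X"
  proof (rule tendstoI)
    fix e :: real assume e: "0 < e"
    have "completion_open d {Y \<in> metric_completion d. ?G Y \<in> ball (?G X) e}"
      using openin_continuous_map_preimage[OF cont, of "ball (?G X) e"]
      by (simp add: openin_completion_topology topspace_completion_topology del: mem_ball)
    then obtain s where s: "0 < s" "\<And>Y. Y \<in> metric_completion d \<Longrightarrow> completion_dist d X Y < s \<Longrightarrow> ?G Y \<in> ball (?G X) e"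
      unfolding completion_open_def using X e by fastforce
    \<comment> \<open>Distances below \<open>s'\<close> have a limit known only to be at most
      \<open>s'\<close>; the gap to \<open>s\<close> restores strictness.\<close>
    obtain s' where s': "0 < s'" "s' < s" using s(1) dense by blast
    obtain N where N: "\<And>m n. m \<ge> N \<Longrightarrow> n \<ge> N \<Longrightarrow> d (x m) (x n) < s'"
      using cauchy_seqsD[OF completion_class(2)[OF X x] s'(1)] by blast
    have "dist (\<phi> (x n)) (?G X) < e" if n: "n \<ge> N" for n
    proof -
      have "completion_dist d X (completion_embed d (x n)) \<le> s'"
        by (rule LIMSEQ_le_const2[OF completion_dist_tendsto[OF X completion_embed(1) x completion_embed(2)]])
          (use N[OF _ n] in \<open>auto intro: less_imp_le\<close>)
      then show ?thesis
        using s(2)[OF completion_embed(1), of "x n"] s'(2) by (simp add: emb dist_commute)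
    qed
    then show "\<forall>\<^sub>F n in sequentially. dist (\<phi> (x n)) (?G X) < e"
      unfolding eventually_sequentially by blast
  qed
  moreover obtain c where c: "\<forall>\<^sub>F n in sequentially. \<phi> (x n) = c"
    using evc completion_class(2)[OF X x] by blast
  moreover have "(\<lambda>n. \<phi> (x n)) \<longlonglongrightarrow> c" by (rule tendsto_eventually[OF c])
  ultimately show ?thesis using LIMSEQ_unique by blast
qed

end

section \<open>The path metric of a graph\<close>

lemma graph_dist_refl: "graph_dist E R u u = 0"
proof -
  have "[u] \<in> graph_paths E u u" by (simp add: graph_paths_def)
  then have "graph_dist E R u u \<le> ennreal (path_length R [u])"
    unfolding graph_dist_def by (rule INF_lower)
  then show ?thesis by (simp add: path_length_def)
qed

context weighted_graph
begin

lemma path_length_nonneg: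
  assumes "p \<in> graph_paths E u v" shows "0 \<le> path_length R p"
  unfolding path_length_def
  by (rule sum_nonneg) (use assms length_pos in \<open>auto simp: graph_paths_def intro: less_imp_le\<close>)

lemma rev_path:
  assumes p: "p \<in> graph_paths E u v"
  shows "rev p \<in> graph_paths E v u" "path_length R (rev p) = path_length R p"
proof -
  have edge: "{p ! k, p ! Suc k} \<in> E" if "Suc k < length p" for k
    using p that by (auto simp: graph_paths_def)
  \<comment> \<open>Reversal moves the edge at position \<open>k\<close> to
    \<open>length p - Suc (Suc k)\<close>; the truncated subtraction is exact because
    \<open>Suc k < length p\<close>.\<close>
  have idx: "rev p ! k = p ! Suc (length p - Suc (Suc k))" "rev p ! Suc k = p ! (length p - Suc (Suc k))"
    if "Suc k < length p" for k
    using that by (auto simp: rev_nth Suc_diff_Suc)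
  show "rev p \<in> graph_paths E v u"
    using p edge by (auto simp: graph_paths_def idx hd_rev last_rev insert_commute)
  have "path_length R (rev p) = (\<Sum>k<length p - 1. R (p ! (length p - Suc (Suc k))) (p ! Suc (length p - Suc (Suc k))))"
    unfolding path_length_def
    by (auto intro!: sum.cong length_sym simp: idx insert_commute edge)
  also have "\<dots> = path_length R p"
    unfolding path_length_def
    by (rule sum.reindex_bij_witness[where i = "\<lambda>k. length p - Suc (Suc k)" and j = "\<lambda>k. length p - Suc (Suc k)"]) auto
  finally show "path_length R (rev p) = path_length R p" .
qed

lemma path_length_Cons: "p \<noteq> [] \<Longrightarrow> path_length R (a # p) = R a (hd p) + path_length R p"
proof -
  assume "p \<noteq> []"
  then obtain n where n: "length p = Suc n" by (cases p) auto
  show ?thesis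
    unfolding path_length_def using n \<open>p \<noteq> []\<close>
    by (simp only: length_Cons diff_Suc_1 sum.lessThan_Suc_shift) (simp add: hd_conv_nth)
qed

lemma graph_paths_Cons:
  "p \<noteq> [] \<Longrightarrow> a # p \<in> graph_paths E u v \<longleftrightarrow> a = u \<and> {a, hd p} \<in> E \<and> p \<in> graph_paths E (hd p) v"
  unfolding graph_paths_def
  by (auto simp: hd_conv_nth nth_Cons split: nat.splits)

lemma path_append:
  assumes "p \<in> graph_paths E u v" "q \<in> graph_paths E v w"
  shows "\<exists>r\<in>graph_paths E u w. path_length R r = path_length R p + path_length R q"
  using assms
proof (induction p arbitrary: u)
  case Nil
  then show ?case by (simp add: graph_paths_def)
next
  case (Cons a p)
  show ?case
  proof (cases "p = []")
    case True
    then have "u = v" "path_length R [a] = 0" using Cons.prems by (auto simp: graph_paths_def path_length_def)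
    then show ?thesis using Cons.prems True by auto
  next
    case False
    then have a: "a = u" "{a, hd p} \<in> E" "p \<in> graph_paths E (hd p) v"
      using Cons.prems graph_paths_Cons by auto
    obtain r where r: "r \<in> graph_paths E (hd p) w" "path_length R r = path_length R p + path_length R q"
      using Cons.IH[OF a(3) Cons.prems(2)] by blast
    have "r \<noteq> []" "hd r = hd p" using r by (auto simp: graph_paths_def)
    then show ?thesis
      using r a False by (intro bexI[of _ "a # r"]) (auto simp: path_length_Cons graph_paths_Cons)
  qed
qed

sublocale distance "graph_dist E R"
proof
  show "graph_dist E R x x = 0" for x by (rule graph_dist_refl)
  have "graph_dist E R x y \<le> graph_dist E R y x" for x y
    unfolding graph_dist_def using rev_path by (intro INF_mono) (metis order_refl)
  then show "graph_dist E R x y = graph_dist E R y x" for x y by (intro antisym)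
  show "graph_dist E R x z \<le> graph_dist E R x y + graph_dist E R y z" for x y z
  proof -
    have le: "graph_dist E R x z \<le> ennreal (path_length R p) + ennreal (path_length R q)"
      if p: "p \<in> graph_paths E x y" and q: "q \<in> graph_paths E y z" for p q
    proof -
      obtain r where r: "r \<in> graph_paths E x z" "path_length R r = path_length R p + path_length R q"
        using path_append[OF p q] by blast
      have "graph_dist E R x z \<le> ennreal (path_length R r)"
        unfolding graph_dist_def by (rule INF_lower[OF r(1)])
      then show ?thesis using r(2) path_length_nonneg[OF p] path_length_nonneg[OF q] by simp
    qed
    show ?thesis
    proof (rule ennreal_le_epsilon)
      fix e :: real
      assume fin: "graph_dist E R x y + graph_dist E R y z < top" and e: "0 < e"
      \<comment> \<open>Both distances are finite here, so adding \<open>e / 2\<close> makes them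
        strictly larger and near-optimal paths exist.\<close>
      have "graph_dist E R x y < graph_dist E R x y + ennreal (e / 2)"
        "graph_dist E R y z < graph_dist E R y z + ennreal (e / 2)"
        using fin e by (auto simp: ennreal_add_left_cancel_less)
      then obtain p q where pq: "p \<in> graph_paths E x y" "ennreal (path_length R p) < graph_dist E R x y + ennreal (e / 2)"
          "q \<in> graph_paths E y z" "ennreal (path_length R q) < graph_dist E R y z + ennreal (e / 2)"
        unfolding graph_dist_def INF_less_iff by blast
      have "graph_dist E R x z \<le> ennreal (path_length R p) + ennreal (path_length R q)"
        by (rule le[OF pq(1,3)])
      also have "\<dots> \<le> (graph_dist E R x y + ennreal (e / 2)) + (graph_dist E R y z + ennreal (e / 2))"
        by (intro add_mono less_imp_le pq)
      also have "\<dots> = graph_dist E R x y + graph_dist E R y z + (ennreal (e / 2) + ennreal (e / 2))"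
        by (simp add: ac_simps)
      also have "ennreal (e / 2) + ennreal (e / 2) = ennreal e"
        using e by (simp flip: ennreal_plus)
      finally show "graph_dist E R x z \<le> graph_dist E R x y + graph_dist E R y z + ennreal e" .
    qed
  qed
qed

section \<open>Functions with finitely many jumps\<close>

definition "jumps \<phi> = {(u, v). {u, v} \<in> E \<and> \<phi> u \<noteq> (\<phi> v :: real)}"

text \<open>Ordered pairs count every jump edge twice but keep finiteness; the energy below is
  summed over such pairs and therefore halved.\<close>

lemma algebra_A_iff: "\<phi> \<in> algebra_A E \<longleftrightarrow> finite (jumps \<phi>)"
proof -
  let ?F = "{e \<in> E. \<exists>u v. e = {u, v} \<and> \<phi> u \<noteq> \<phi> v}"
  show ?thesis
  proof
    assume "\<phi> \<in> algebra_A E"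
    then have F: "finite ?F" by (simp add: algebra_A_def)
    have "finite e" if "e \<in> E" for e using edges[OF that] card.infinite[of e] by fastforce
    then have "finite (\<Union> ?F)" using F by (intro finite_Union) blast+
    moreover have "jumps \<phi> \<subseteq> \<Union> ?F \<times> \<Union> ?F"
    proof
      fix e assume "e \<in> jumps \<phi>"
      then obtain u v where e: "e = (u, v)" "{u, v} \<in> E" "\<phi> u \<noteq> \<phi> v" by (auto simp: jumps_def)
      then have "{u, v} \<in> ?F" by blast
      then show "e \<in> \<Union> ?F \<times> \<Union> ?F" unfolding e(1) by blast
    qed
    ultimately show "finite (jumps \<phi>)" using finite_subset[OF _ finite_cartesian_product] by blast
  next
    assume "finite (jumps \<phi>)"
    then have "finite ((\<lambda>(u, v). {u, v}) ` jumps \<phi>)" by (rule finite_imageI)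
    moreover have "?F \<subseteq> (\<lambda>(u, v). {u, v}) ` jumps \<phi>"
    proof
      fix e assume "e \<in> ?F"
      then obtain u v where "e = {u, v}" "(u, v) \<in> jumps \<phi>" by (auto simp: jumps_def)
      then show "e \<in> (\<lambda>(u, v). {u, v}) ` jumps \<phi>" by (intro image_eqI[of _ _ "(u, v)"]) auto
    qed
    ultimately have "finite ?F" by (rule finite_subset[rotated])
    then show "\<phi> \<in> algebra_A E" by (simp add: algebra_A_def)
  qed
qed

text \<open>A path shorter than every jump edge cannot cross one, so \<open>\<phi>\<close> is
  constant along it.\<close>

lemma algebra_A_locally_constant:
  assumes \<phi>: "\<phi> \<in> algebra_A E"
  shows "\<exists>r>0. \<forall>u v. graph_dist E R u v < r \<longrightarrow> \<phi> u = \<phi> v"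
proof -
  have fin: "finite (jumps \<phi>)" using \<phi> by (simp add: algebra_A_iff)
  \<comment> \<open>The inserted 1 provides a minimum also for functions without jumps.\<close>
  define r where "r = Min (insert 1 ((\<lambda>(u, v). R u v) ` jumps \<phi>))"
  have r0: "0 < r"
  proof -
    have "0 < x" if "x \<in> insert 1 ((\<lambda>(u, v). R u v) ` jumps \<phi>)" for x
      using that by (auto simp: jumps_def intro: length_pos)
    then show ?thesis unfolding r_def using fin by (subst Min_gr_iff) auto
  qed
  have rle: "r \<le> R u v" if "(u, v) \<in> jumps \<phi>" for u v
  proof -
    have "R u v \<in> (\<lambda>(u, v). R u v) ` jumps \<phi>" using that by (rule rev_image_eqI) simp
    then show ?thesis unfolding r_def using fin by (intro Min_le) simp_all
  qed
  have "\<phi> u = \<phi> v" if d: "graph_dist E R u v < ennreal r" for u v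
  proof (rule ccontr)
    assume neq: "\<phi> u \<noteq> \<phi> v"
    obtain p where p: "p \<in> graph_paths E u v" "ennreal (path_length R p) < ennreal r"
      using d unfolding graph_dist_def INF_less_iff by blast
    note length_p = path_length_nonneg[OF p(1)]
    have edge: "{p ! k, p ! Suc k} \<in> E" if "Suc k < length p" for k
      using p(1) that by (simp add: graph_paths_def)
    have "\<exists>k. Suc k < length p \<and> \<phi> (p ! k) \<noteq> \<phi> (p ! Suc k)"
    proof (rule ccontr)
      assume H: "\<not> ?thesis"
      have const: "\<phi> (p ! k) = \<phi> (p ! 0)" if "k < length p" for k
        using that
      proof (induction k)
        case (Suc k)
        then have "\<phi> (p ! k) = \<phi> (p ! Suc k)" using H by blast
        then show ?case using Suc by simp
      qed simp
      have "p \<noteq> []" "hd p = u" "last p = v" using p(1) by (simp_all add: graph_paths_def)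
      then have "\<phi> v = \<phi> u"
        using const[of "length p - 1"] last_conv_nth[of p] hd_conv_nth[of p] by simp
      then show False using neq by simp
    qed
    then obtain k where k: "Suc k < length p" "\<phi> (p ! k) \<noteq> \<phi> (p ! Suc k)" by blast
    have "r \<le> R (p ! k) (p ! Suc k)" using k edge by (intro rle) (auto simp: jumps_def)
    also have "\<dots> \<le> path_length R p"
      unfolding path_length_def
      using k by (intro member_le_sum[of k]) (auto intro!: less_imp_le[OF length_pos] edge)
    finally show False using p(2) by (simp add: ennreal_less_iff length_p)
  qed
  then show ?thesis using r0 by (intro exI[of _ "ennreal r"]) auto
qed

lemma algebra_A_extension:
  assumes "\<phi> \<in> algebra_A E" "X \<in> metric_completion (graph_dist E R)" "x \<in> X"
  shows "\<forall>\<^sub>F n in sequentially. \<phi> (x n) = continuous_extension (graph_dist E R) \<phi> X"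
  using algebra_A_locally_constant[OF assms(1)] locally_constant_extension assms(2,3) by blast

lemma finite_incident: "finite {u. {u, v} \<in> E}"
proof -
  have "(\<lambda>u. {u, v}) ` {u. {u, v} \<in> E} \<subseteq> {e \<in> E. v \<in> e}" by auto
  then have "finite ((\<lambda>u. {u, v}) ` {u. {u, v} \<in> E})" using incident_finite finite_subset by blast
  moreover have "inj_on (\<lambda>u. {u, v}) {u. {u, v} \<in> E}" by (auto simp: inj_on_def doubleton_eq_iff)
  ultimately show ?thesis by (rule finite_imageD)
qed

text \<open>Every jump has an end in the support, and each vertex has finitely many edges.\<close>

lemma finite_support_algebra_A:
  assumes "finite {v. \<phi> v \<noteq> 0}" shows "\<phi> \<in> algebra_A E"
proof -
  let ?S = "{v. \<phi> v \<noteq> 0}"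
  have "jumps \<phi> \<subseteq> (\<Union>v\<in>?S. {u. {u, v} \<in> E} \<times> {v} \<union> {v} \<times> {u. {u, v} \<in> E})"
  proof
    fix e assume "e \<in> jumps \<phi>"
    then obtain u v where e: "e = (u, v)" "{u, v} \<in> E" "{v, u} \<in> E" "\<phi> u \<noteq> \<phi> v"
      by (auto simp: jumps_def insert_commute)
    then have "u \<in> ?S \<or> v \<in> ?S" by auto
    then show "e \<in> (\<Union>v\<in>?S. {u. {u, v} \<in> E} \<times> {v} \<union> {v} \<times> {u. {u, v} \<in> E})"
      using e by blast
  qed
  moreover have "finite (\<Union>v\<in>?S. {u. {u, v} \<in> E} \<times> {v} \<union> {v} \<times> {u. {u, v} \<in> E})"
    using assms finite_incident by auto
  ultimately show ?thesis unfolding algebra_A_iff by (rule finite_subset)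
qed

text \<open>The indicator of \<open>v\<close> is eventually constant along \<open>x\<close>. Were
  its eventual value 1, the class \<open>X\<close> would be the embedded vertex
  \<open>v\<close>.\<close>

lemma eventually_not_vertex:
  assumes X: "X \<in> metric_completion (graph_dist E R) - range (completion_embed (graph_dist E R))"
    and x: "x \<in> X"
  shows "\<forall>\<^sub>F n in sequentially. x n \<noteq> v"
proof (rule ccontr)
  let ?d = "graph_dist E R"
  let ?\<phi> = "\<lambda>w. if w = v then 1 else 0 :: real"
  assume H: "\<not> ?thesis"
  have A: "?\<phi> \<in> algebra_A E" by (rule finite_support_algebra_A) auto
  have ev: "\<forall>\<^sub>F n in sequentially. ?\<phi> (x n) = continuous_extension ?d ?\<phi> X"
    using algebra_A_extension[OF A] X x by blast
  have "\<forall>\<^sub>F n in sequentially. x n = v"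
  proof (cases "continuous_extension ?d ?\<phi> X = 1")
    case True
    show ?thesis using ev by (rule eventually_mono) (use True in \<open>auto split: if_splits\<close>)
  next
    case False
    have "\<forall>\<^sub>F n in sequentially. x n \<noteq> v"
      using ev by (rule eventually_mono) (use False in \<open>auto split: if_splits\<close>)
    then show ?thesis using H by simp
  qed
  then have "\<forall>\<^sub>F n in sequentially. ?d (x n) v = 0"
    by (rule eventually_mono) (simp add: d_refl)
  then have "(x, \<lambda>_. v) \<in> cauchy_rel ?d"
    using completion_class(2)[of X x] X x const_cauchy by (auto simp: cauchy_rel_def tendsto_eventually)
  then have "cauchy_rel ?d `` {x} = cauchy_rel ?d `` {\<lambda>_. v}"
    by (rule equiv_class_eq[OF equiv_cauchy_rel])
  then have "X = completion_embed ?d v"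
    using completion_class(4)[of X x] X x by (simp add: completion_embed_def)
  then show False using X by blast
qed

text \<open>This replaces the chosen extension by a condition on representing sequences that
  pointwise operations visibly preserve.\<close>

lemma algebra_A_vanishing_iff:
  assumes \<Omega>: "\<Omega> \<subseteq> metric_completion (graph_dist E R)"
  shows "\<phi> \<in> algebra_A_vanishing E R \<Omega> \<longleftrightarrow>
    finite (jumps \<phi>) \<and> (\<forall>X\<in>\<Omega>. \<forall>x\<in>X. \<forall>\<^sub>F n in sequentially. \<phi> (x n) = 0)"
proof -
  have "continuous_extension (graph_dist E R) \<phi> X = 0 \<longleftrightarrow> (\<forall>x\<in>X. \<forall>\<^sub>F n in sequentially. \<phi> (x n) = 0)"
    if A: "\<phi> \<in> algebra_A E" and X: "X \<in> \<Omega>" for X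
  proof
    assume "continuous_extension (graph_dist E R) \<phi> X = 0"
    then show "\<forall>x\<in>X. \<forall>\<^sub>F n in sequentially. \<phi> (x n) = 0"
      using algebra_A_extension[OF A, of X] \<Omega> X by auto
  next
    assume H: "\<forall>x\<in>X. \<forall>\<^sub>F n in sequentially. \<phi> (x n) = 0"
    obtain x where x: "x \<in> X" using completion_class(1) \<Omega> X by blast
    have "\<forall>\<^sub>F n in sequentially. \<phi> (x n) = 0" using H x by blast
    moreover have "\<forall>\<^sub>F n in sequentially. \<phi> (x n) = continuous_extension (graph_dist E R) \<phi> X"
      using algebra_A_extension[OF A _ x] \<Omega> X by blast
    ultimately have "\<forall>\<^sub>F n in sequentially. continuous_extension (graph_dist E R) \<phi> X = 0"
      by eventually_elim simp
    then show "continuous_extension (graph_dist E R) \<phi> X = 0" by simp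
  qed
  then show ?thesis unfolding algebra_A_vanishing_def algebra_A_iff[symmetric] by auto
qed

lemma algebra_A_vanishing_compose:
  assumes \<Omega>: "\<Omega> \<subseteq> metric_completion (graph_dist E R)"
    and f: "f \<in> algebra_A_vanishing E R \<Omega>" and g: "g \<in> algebra_A_vanishing E R \<Omega>" and \<psi>: "\<psi> 0 0 = 0"
  shows "(\<lambda>v. \<psi> (f v) (g v)) \<in> algebra_A_vanishing E R \<Omega>"
  unfolding algebra_A_vanishing_iff[OF \<Omega>]
proof (intro conjI ballI)
  have "jumps (\<lambda>v. \<psi> (f v) (g v)) \<subseteq> jumps f \<union> jumps g" by (auto simp: jumps_def)
  then show "finite (jumps (\<lambda>v. \<psi> (f v) (g v)))"
    using f g finite_subset unfolding algebra_A_vanishing_iff[OF \<Omega>] by blast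
  fix X x assume X: "X \<in> \<Omega>" "x \<in> X"
  then have "\<forall>\<^sub>F n in sequentially. f (x n) = 0" "\<forall>\<^sub>F n in sequentially. g (x n) = 0"
    using f g unfolding algebra_A_vanishing_iff[OF \<Omega>] by auto
  then show "\<forall>\<^sub>F n in sequentially. \<psi> (f (x n)) (g (x n)) = 0" by eventually_elim (simp add: \<psi>)
qed

text \<open>A sequence representing a point off the graph eventually avoids each of the finitely
  many vertices of the support.\<close>

lemma finite_support_vanishing:
  assumes \<Omega>: "\<Omega> \<subseteq> metric_completion (graph_dist E R) - range (completion_embed (graph_dist E R))"
    and fin: "finite {v. \<phi> v \<noteq> 0}"
  shows "\<phi> \<in> algebra_A_vanishing E R \<Omega>"
proof -
  have \<Omega>': "\<Omega> \<subseteq> metric_completion (graph_dist E R)" using \<Omega> by blast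
  show ?thesis
    unfolding algebra_A_vanishing_iff[OF \<Omega>']
  proof (intro conjI ballI)
    show "finite (jumps \<phi>)" using finite_support_algebra_A[OF fin] by (simp add: algebra_A_iff)
    fix X x assume X: "X \<in> \<Omega>" "x \<in> X"
    have "\<forall>\<^sub>F n in sequentially. \<forall>v\<in>{v. \<phi> v \<noteq> 0}. x n \<noteq> v"
      using eventually_not_vertex[of X x] \<Omega> X by (subst eventually_ball_finite_distrib[OF fin]) auto
    then show "\<forall>\<^sub>F n in sequentially. \<phi> (x n) = 0" by (rule eventually_mono) auto
  qed
qed

end

section \<open>Symmetric submarkovian operators on \<open>l\<^sup>2(\<mu>)\<close>\<close>

lemma infsum_finite_support:
  fixes g :: "'v \<Rightarrow> real"
  assumes "finite F" "\<And>v. v \<notin> F \<Longrightarrow> g v = 0"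
  shows "g summable_on UNIV" "infsum g UNIV = sum g F"
proof -
  have "{v. g v \<noteq> 0} \<subseteq> F" using assms(2) by auto
  then show "g summable_on UNIV"
    using assms(1) by (intro finite_nonzero_values_imp_summable_on) (auto intro: finite_subset)
  have "infsum g UNIV = infsum g F" by (rule infsum_cong_neutral) (use assms(2) in auto)
  then show "infsum g UNIV = sum g F" using assms(1) by simp
qed

text \<open>The tangent at \<open>m\<close> to a convex function. The point \<open>a = 0\<close> is
  treated by hand because the convexity in use is on the open half-line.\<close>

lemma powr_above_tangent:
  fixes q a m :: real
  assumes q: "1 \<le> q" and a: "0 \<le> a" and m: "0 < m"
  shows "m powr q + q * m powr (q - 1) * (a - m) \<le> a powr q"
proof (cases "a = 0")
  case True
  have "m powr (q - 1) * m = m powr q"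
    using powr_mult_base[of m "q - 1"] m by (simp add: mult.commute)
  then have "m powr q + q * m powr (q - 1) * (0 - m) = (1 - q) * m powr q" by (simp add: algebra_simps)
  also have "\<dots> \<le> 0" using q by (simp add: mult_nonpos_nonneg)
  finally show ?thesis using True by simp
next
  case False
  have "a powr q - m powr q \<ge> (q * m powr (q - 1)) * (a - m)"
  proof (rule convex_on_imp_above_tangent[OF powr_convex[OF q]])
    show "((\<lambda>x. x powr q) has_real_derivative q * m powr (q - 1)) (at m within {0<..})"
      using m by (intro DERIV_subset[OF has_real_derivative_powr]) auto
    show "m \<in> interior {0<..}" using m by (simp add: interior_open)
  qed (use m a False in auto)
  then show ?thesis by simp
qed

text \<open>Jensen by summing the tangent inequality at the mean \<open>m\<close>. The total weight
  may be less than 1; the missing mass is paid for by \<open>1 \<le> q\<close>, as seen in the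
  factor \<open>q * (1 - sum k F)\<close>.\<close>

lemma powr_sum_submean:
  fixes k a :: "'v \<Rightarrow> real" and q :: real
  assumes F: "finite F" and q: "1 \<le> q" and k: "\<And>w. w \<in> F \<Longrightarrow> 0 \<le> k w" and k1: "sum k F \<le> 1"
    and a: "\<And>w. w \<in> F \<Longrightarrow> 0 \<le> a w"
  shows "(\<Sum>w\<in>F. a w * k w) powr q \<le> (\<Sum>w\<in>F. a w powr q * k w)"
proof (cases "(\<Sum>w\<in>F. a w * k w) = 0")
  case True
  then show ?thesis using q k by (auto intro!: sum_nonneg)
next
  case False
  define m where "m = (\<Sum>w\<in>F. a w * k w)"
  have "0 \<le> m" unfolding m_def by (intro sum_nonneg mult_nonneg_nonneg a k)
  then have m: "0 < m" using False m_def by simp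
  have "m powr (q - 1) * m = m powr q"
    using powr_mult_base[of m "q - 1"] m by (simp add: mult.commute)
  then have "m powr q \<le> m powr q * sum k F + q * m powr (q - 1) * (m - m * sum k F)"
  proof -
    assume e: "m powr (q - 1) * m = m powr q"
    have "q * m powr (q - 1) * (m - m * sum k F) = q * (m powr (q - 1) * m) * (1 - sum k F)"
      by (simp add: algebra_simps)
    also have "\<dots> = q * (m powr q * (1 - sum k F))" unfolding e by simp
    also have "\<dots> \<ge> 1 * (m powr q * (1 - sum k F))"
      using q k1 by (intro mult_right_mono) auto
    finally show ?thesis by (simp add: algebra_simps)
  qed
  also have "\<dots> = (\<Sum>w\<in>F. (m powr q + q * m powr (q - 1) * (a w - m)) * k w)"
  proof -
    have "m - m * sum k F = (\<Sum>w\<in>F. (a w - m) * k w)"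
      unfolding sum_distrib_left by (simp add: m_def left_diff_distrib sum_subtractf)
    then show ?thesis by (simp add: distrib_right sum.distrib sum_distrib_left mult.assoc)
  qed
  also have "\<dots> \<le> (\<Sum>w\<in>F. a w powr q * k w)"
    by (intro sum_mono mult_right_mono powr_above_tangent q a m k)
  finally show ?thesis by (simp add: m_def)
qed

section \<open>Truncations and essential suprema\<close>

context weights
begin

definition "trunc F f = (\<lambda>v. if v \<in> F then f v else (0 :: real))"

lemma finite_support_l2: "finite F \<Longrightarrow> (\<And>v. v \<notin> F \<Longrightarrow> f v = 0) \<Longrightarrow> f \<in> l2_space \<mu>"
  unfolding l2_iff by (rule infsum_finite_support) auto

lemma trunc_l2: "finite F \<Longrightarrow> trunc F f \<in> l2_space \<mu>"
  by (rule finite_support_l2) (auto simp: trunc_def)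

text \<open>By Pythagoras the squared error is the squared norm minus a finite partial sum of the
  series for it.\<close>

lemma trunc_tendsto:
  assumes f: "f \<in> l2_space \<mu>"
  shows "((\<lambda>F. emb (trunc F f)) \<longlongrightarrow> emb f) (finite_subsets_at_top UNIV)"
proof -
  let ?x = "emb f"
  have n: "(norm (emb (trunc F f) - ?x))\<^sup>2 = (norm ?x)\<^sup>2 - (\<Sum>v\<in>F. (coord ?x v)\<^sup>2)" if F: "finite F" for F
  proof -
    let ?y = "emb (trunc F f)"
    have y: "coord ?y v = (if v \<in> F then coord ?x v else 0)" for v
      by (simp add: coord_emb trunc_l2 F f) (simp add: trunc_def)
    have "?y \<bullet> ?x = (\<Sum>v\<in>F. (coord ?x v)\<^sup>2)" "?y \<bullet> ?y = (\<Sum>v\<in>F. (coord ?x v)\<^sup>2)"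
      unfolding inner_ell2_def y by (subst infsum_finite_support(2)[OF F]; simp add: power2_eq_square)+
    then show ?thesis
      unfolding power2_norm_eq_inner by (simp add: inner_diff_left inner_diff_right inner_commute)
  qed
  have "((\<lambda>F. (norm ?x)\<^sup>2 - (\<Sum>v\<in>F. (coord ?x v)\<^sup>2)) \<longlongrightarrow> (norm ?x)\<^sup>2 - (norm ?x)\<^sup>2) (finite_subsets_at_top UNIV)"
    by (intro tendsto_diff tendsto_const) (simp add: norm_ell2_square infsum_tendsto coord_summable)
  then have "((\<lambda>F. (norm (emb (trunc F f) - ?x))\<^sup>2) \<longlongrightarrow> 0) (finite_subsets_at_top UNIV)"
    by (rule Lim_transform_eventually[THEN tendsto_eq_rhs])
      (auto intro!: eventually_finite_subsets_at_top_weakI simp: n)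
  from tendsto_real_sqrt[OF this]
  have "((\<lambda>F. norm (emb (trunc F f) - ?x)) \<longlongrightarrow> 0) (finite_subsets_at_top UNIV)" by simp
  then show ?thesis by (simp add: tendsto_norm_zero_iff LIM_zero_iff)
qed

lemma norm_emb_mono:
  assumes f: "f \<in> l2_space \<mu>" and g: "g \<in> l2_space \<mu>" and le: "\<And>v. \<bar>f v\<bar> \<le> \<bar>g v\<bar>"
  shows "norm (emb f) \<le> norm (emb g)"
proof (rule norm_ell2_leI)
  fix F :: "'v set" assume F: "finite F"
  have "(coord (emb f) v)\<^sup>2 \<le> (coord (emb g) v)\<^sup>2" for v
    using le[of v] \<mu>_nonneg[of v] by (simp add: coord_emb f g abs_le_square_iff power_mult_distrib mult_left_mono)
  then have "(\<Sum>v\<in>F. (coord (emb f) v)\<^sup>2) \<le> (\<Sum>v\<in>F. (coord (emb g) v)\<^sup>2)" by (rule sum_mono)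
  also have "\<dots> \<le> (norm (emb g))\<^sup>2" by (rule sum_coord_square_le[OF F])
  finally show "(\<Sum>v\<in>F. (coord (emb f) v)\<^sup>2) \<le> (norm (emb g))\<^sup>2" .
qed simp

lemma bounded_linear_fn: "bounded_linear (\<lambda>x. fn x v)"
  unfolding fn_def divide_inverse
  by (intro bounded_linear_compose[OF bounded_linear_mult_left bounded_linear_coord, unfolded o_def])

text \<open>All masses are positive, so almost everywhere means everywhere.\<close>

lemma esssup_iff:
  "esssup (vertex_measure \<mu>) (\<lambda>v. ereal \<bar>f v\<bar>) \<le> c \<longleftrightarrow> (\<forall>v. ereal \<bar>f v\<bar> \<le> c)"
proof -
  have AE: "(AE v in vertex_measure \<mu>. P v) \<longleftrightarrow> (\<forall>v. P v)" for P
    unfolding vertex_measure_def AE_point_measure using \<mu>_pos by simp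
  show ?thesis
    using esssup_AE[of "\<lambda>v. ereal \<bar>f v\<bar>" "vertex_measure \<mu>"] esssup_I[of "\<lambda>v. ereal \<bar>f v\<bar>" "vertex_measure \<mu>" c]
    unfolding AE by (auto simp: vertex_measure_def intro: order_trans)
qed

end

locale submarkovian = weights \<mu> for \<mu> :: "'v \<Rightarrow> real" +
  fixes T :: "'v ell2 \<Rightarrow> 'v ell2"
  assumes T_lin: "bounded_linear T"
    and T_symm: "T x \<bullet> y = x \<bullet> T y"
    and T_pos: "f \<in> l2_space \<mu> \<Longrightarrow> (\<And>v. 0 \<le> f v) \<Longrightarrow> 0 \<le> fn (T (emb f)) v"
    and T_le_1: "f \<in> l2_space \<mu> \<Longrightarrow> (\<And>v. f v \<le> 1) \<Longrightarrow> fn (T (emb f)) v \<le> 1"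
begin

definition "H f = fn (T (emb f))"
text \<open>A density with respect to counting measure, so it becomes symmetric only after
  multiplication by \<open>\<mu> v\<close>.\<close>

definition "ker v w = H (trunc {w} (\<lambda>_. 1)) v"

lemma H_lincomb:
  "f \<in> l2_space \<mu> \<Longrightarrow> g \<in> l2_space \<mu> \<Longrightarrow> H (\<lambda>v. a * f v + b * g v) v = a * H f v + b * H g v"
  by (simp add: H_def emb_lincomb linear_simps[OF T_lin] fn_lincomb)

lemma H_trunc: "finite F \<Longrightarrow> H (trunc F f) v = (\<Sum>w\<in>F. f w * ker v w)"
proof (induction F rule: finite_induct)
  case empty
  show ?case using H_lincomb[of "trunc {} f" "trunc {} f" 0 0 v] by (simp add: trunc_l2) (simp add: trunc_def)
next
  case (insert w F)
  have "trunc (insert w F) f = (\<lambda>v. f w * trunc {w} (\<lambda>_. 1) v + 1 * trunc F f v)"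
    using insert by (auto simp: trunc_def fun_eq_iff)
  then show ?case
    using insert H_lincomb[of "trunc {w} (\<lambda>_. 1)" "trunc F f" "f w" 1 v] by (simp add: trunc_l2 ker_def)
qed

lemma ker_nonneg: "0 \<le> ker v w"
  unfolding ker_def H_def by (rule T_pos) (auto simp: trunc_l2, simp add: trunc_def)

text \<open>The constant function 1 need not be square summable; the indicator of \<open>F\<close>
  stands in for it.\<close>

lemma sum_ker_le: "finite F \<Longrightarrow> (\<Sum>w\<in>F. ker v w) \<le> 1"
  using T_le_1[of "trunc F (\<lambda>_. 1)" v] H_trunc[of F "\<lambda>_. 1" v]
  by (simp add: trunc_l2 H_def) (simp add: trunc_def)

text \<open>Both sides are the matrix entry of \<open>T\<close> between the indicators of
  \<open>v\<close> and \<open>w\<close> in the weighted inner product.\<close>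

lemma ker_symmetric: "\<mu> v * ker v w = \<mu> w * ker w v"
proof -
  have "T (emb (trunc {w} (\<lambda>_. 1))) \<bullet> emb (trunc {v} (\<lambda>_. 1)) = \<mu> v * ker v w" for v w
  proof -
    let ?x = "T (emb (trunc {w} (\<lambda>_. 1)))"
    have "?x \<bullet> emb (trunc {v} (\<lambda>_. 1)) = (\<Sum>u\<in>{v}. coord ?x u * (sqrt (\<mu> u) * trunc {v} (\<lambda>_. 1) u))"
      unfolding inner_ell2_def
      by (simp only: coord_emb trunc_l2 finite.intros, rule infsum_finite_support) (auto simp: trunc_def)
    also have "\<dots> = coord ?x v * sqrt (\<mu> v)" by (simp add: trunc_def)
    also have "\<dots> = \<mu> v * (coord ?x v / sqrt (\<mu> v))"
      using \<mu>_pos[of v] by (simp add: field_simps)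
    finally show ?thesis by (simp add: ker_def H_def fn_def)
  qed
  from this[of w v] this[of v w] show ?thesis using T_symm inner_commute by metis
qed

text \<open>Symmetry turns the bound on rows into one on columns, the contraction property for p = 1
  in terms of the kernel.\<close>

lemma sum_\<mu>_ker_le:
  assumes "finite F" shows "(\<Sum>v\<in>F. \<mu> v * ker v w) \<le> \<mu> w"
proof -
  have "(\<Sum>v\<in>F. \<mu> v * ker v w) = \<mu> w * (\<Sum>v\<in>F. ker w v)"
    by (simp add: ker_symmetric[of _ w] sum_distrib_left)
  also have "\<dots> \<le> \<mu> w * 1" by (intro mult_left_mono sum_ker_le assms \<mu>_nonneg)
  finally show ?thesis by simp
qed

lemma H_trunc_tendsto:
  "f \<in> l2_space \<mu> \<Longrightarrow> ((\<lambda>F. H (trunc F f) v) \<longlongrightarrow> H f v) (finite_subsets_at_top UNIV)"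
  unfolding H_def
  by (intro bounded_linear.tendsto[OF bounded_linear_fn] bounded_linear.tendsto[OF T_lin] trunc_tendsto)

lemma abs_H_trunc_le: "finite F \<Longrightarrow> \<bar>H (trunc F f) v\<bar> \<le> (\<Sum>w\<in>F. \<bar>f w\<bar> * ker v w)"
  unfolding H_trunc by (rule order_trans[OF sum_abs]) (simp add: abs_mult ker_nonneg)

lemma H_bounded:
  assumes f: "f \<in> l2_space \<mu>" and c: "\<And>v. \<bar>f v\<bar> \<le> c"
  shows "\<bar>H f v\<bar> \<le> c"
proof (rule tendsto_upperbound)
  show "((\<lambda>F. \<bar>H (trunc F f) v\<bar>) \<longlongrightarrow> \<bar>H f v\<bar>) (finite_subsets_at_top UNIV)"
    by (intro tendsto_rabs H_trunc_tendsto f)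
  have "\<bar>H (trunc F f) v\<bar> \<le> c" if F: "finite F" for F
  proof -
    have "0 \<le> c" using c[of v] by (meson abs_ge_zero order_trans)
    have "\<bar>H (trunc F f) v\<bar> \<le> (\<Sum>w\<in>F. \<bar>f w\<bar> * ker v w)" by (rule abs_H_trunc_le[OF F])
    also have "\<dots> \<le> (\<Sum>w\<in>F. c * ker v w)" by (intro sum_mono mult_right_mono c ker_nonneg)
    also have "\<dots> = c * (\<Sum>w\<in>F. ker v w)" by (simp add: sum_distrib_left)
    also have "\<dots> \<le> c * 1" by (intro mult_left_mono sum_ker_le F \<open>0 \<le> c\<close>)
    finally show ?thesis by simp
  qed
  then show "\<forall>\<^sub>F F in finite_subsets_at_top UNIV. \<bar>H (trunc F f) v\<bar> \<le> c"
    by (intro eventually_finite_subsets_at_top_weakI)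
qed simp

text \<open>Two finite sets are used: \<open>F\<close> truncates the input so that the kernel
  formula applies, and \<open>G\<close> truncates the sum over the output so that the limit in
  \<open>F\<close> may be taken inside it. Jensen needs the row sums, the interchange of summations
  the column sums.\<close>

lemma H_powr_le:
  assumes q: "1 \<le> q" and f: "f \<in> l2_space \<mu>" and fq: "(\<lambda>v. \<mu> v * \<bar>f v\<bar> powr q) summable_on UNIV"
  shows "(\<lambda>v. \<mu> v * \<bar>H f v\<bar> powr q) summable_on UNIV"
    and "(\<Sum>\<^sub>\<infinity>v. \<mu> v * \<bar>H f v\<bar> powr q) \<le> (\<Sum>\<^sub>\<infinity>v. \<mu> v * \<bar>f v\<bar> powr q)"
proof -
  let ?N = "\<Sum>\<^sub>\<infinity>v. \<mu> v * \<bar>f v\<bar> powr q"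
  have fin: "(\<Sum>v\<in>G. \<mu> v * \<bar>H f v\<bar> powr q) \<le> ?N" if G: "finite G" for G
  proof (rule tendsto_upperbound)
    show "((\<lambda>F. \<Sum>v\<in>G. \<mu> v * \<bar>H (trunc F f) v\<bar> powr q) \<longlongrightarrow> (\<Sum>v\<in>G. \<mu> v * \<bar>H f v\<bar> powr q))
        (finite_subsets_at_top UNIV)"
      by (intro tendsto_sum tendsto_mult tendsto_const tendsto_powr' tendsto_rabs H_trunc_tendsto f) (use q in auto)
    have "(\<Sum>v\<in>G. \<mu> v * \<bar>H (trunc F f) v\<bar> powr q) \<le> ?N" if F: "finite F" for F
    proof -
      have "(\<Sum>v\<in>G. \<mu> v * \<bar>H (trunc F f) v\<bar> powr q) \<le> (\<Sum>v\<in>G. \<mu> v * (\<Sum>w\<in>F. \<bar>f w\<bar> powr q * ker v w))"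
      proof (intro sum_mono mult_left_mono \<mu>_nonneg)
        fix v
        have "\<bar>H (trunc F f) v\<bar> powr q \<le> (\<Sum>w\<in>F. \<bar>f w\<bar> * ker v w) powr q"
          using q by (intro powr_mono2 abs_H_trunc_le F) auto
        also have "\<dots> \<le> (\<Sum>w\<in>F. \<bar>f w\<bar> powr q * ker v w)"
          by (intro powr_sum_submean F q ker_nonneg sum_ker_le) auto
        finally show "\<bar>H (trunc F f) v\<bar> powr q \<le> (\<Sum>w\<in>F. \<bar>f w\<bar> powr q * ker v w)" .
      qed
      also have "\<dots> = (\<Sum>v\<in>G. \<Sum>w\<in>F. \<bar>f w\<bar> powr q * (\<mu> v * ker v w))"
        by (simp add: sum_distrib_left mult.left_commute)
      also have "\<dots> = (\<Sum>w\<in>F. \<bar>f w\<bar> powr q * (\<Sum>v\<in>G. \<mu> v * ker v w))"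
        by (subst sum.swap) (simp add: sum_distrib_left)
      also have "\<dots> \<le> (\<Sum>w\<in>F. \<bar>f w\<bar> powr q * \<mu> w)"
        by (intro sum_mono mult_left_mono sum_\<mu>_ker_le G) auto
      also have "\<dots> = (\<Sum>w\<in>F. \<mu> w * \<bar>f w\<bar> powr q)" by (simp add: mult.commute)
      also have "\<dots> \<le> ?N" by (rule finite_sum_le_infsum[OF fq F]) (auto simp: \<mu>_nonneg)
      finally show ?thesis .
    qed
    then show "\<forall>\<^sub>F F in finite_subsets_at_top UNIV. (\<Sum>v\<in>G. \<mu> v * \<bar>H (trunc F f) v\<bar> powr q) \<le> ?N"
      by (intro eventually_finite_subsets_at_top_weakI)
  qed simp
  show s: "(\<lambda>v. \<mu> v * \<bar>H f v\<bar> powr q) summable_on UNIV"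
    using fin by (intro nonneg_bdd_above_summable_on) (auto simp: \<mu>_nonneg intro!: bdd_aboveI2)
  show "(\<Sum>\<^sub>\<infinity>v. \<mu> v * \<bar>H f v\<bar> powr q) \<le> ?N"
    by (rule infsum_le_finite_sums[OF s]) (rule fin)
qed

lemma lp_contraction_H:
  assumes p: "1 \<le> (p :: ennreal)"
  shows "lp_contraction \<mu> p H"
  unfolding lp_contraction_def
proof (intro ballI)
  fix f assume "f \<in> l2_space \<mu> \<inter> lp_space \<mu> p"
  then have f: "f \<in> l2_space \<mu>" and fp: "f \<in> lp_space \<mu> p" by auto
  show "H f \<in> lp_space \<mu> p \<and> lp_norm \<mu> p (H f) \<le> lp_norm \<mu> p f"
  proof (cases "p = \<infinity>")
    case True
    let ?e = "\<lambda>f. esssup (vertex_measure \<mu>) (\<lambda>v. ereal \<bar>f v\<bar>)"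
    have nn: "0 \<le> ?e g" for g
    proof -
      \<comment> \<open>Any vertex shows that the essential supremum is nonnegative, which the
        monotonicity of \<open>real_of_ereal\<close> requires.\<close>
      have "ereal \<bar>g undefined\<bar> \<le> ?e g" using esssup_iff[of g "?e g"] by blast
      then show ?thesis by (rule order_trans[rotated]) simp
    qed
    have "?e f < \<infinity>" using fp True by (simp add: lp_space_def)
    then obtain c where c: "?e f = ereal c" using nn[of f] by (cases "?e f") auto
    have "\<bar>f v\<bar> \<le> c" for v using esssup_iff[of f "ereal c"] c by simp
    then have "\<bar>H f v\<bar> \<le> c" for v by (rule H_bounded[OF f])
    then have le: "?e (H f) \<le> ereal c" by (simp add: esssup_iff)
    then have "?e (H f) < \<infinity>" by (rule order_le_less_trans) simp
    moreover have "real_of_ereal (?e (H f)) \<le> real_of_ereal (?e f)"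
      using le nn by (intro real_of_ereal_positive_mono) (auto simp: c)
    ultimately show ?thesis using True by (simp add: lp_space_def lp_norm_def)
  next
    case False
    define q where "q = enn2real p"
    have q: "1 \<le> q"
      using p False unfolding q_def
      by (cases p rule: ennreal_cases) (auto simp flip: ennreal_1)
    have fq: "(\<lambda>v. \<mu> v * \<bar>f v\<bar> powr q) summable_on UNIV"
      using fp False by (simp add: lp_space_iff q_def)
    have "(LINT v|vertex_measure \<mu>. \<bar>H f v\<bar> powr q) \<le> (LINT v|vertex_measure \<mu>. \<bar>f v\<bar> powr q)"
      using H_powr_le[OF q f fq] by (simp add: integral_vertex_measure fq)
    then have "lp_norm \<mu> p (H f) \<le> lp_norm \<mu> p f"
      using False q by (auto simp: lp_norm_def simp flip: q_def intro!: powr_mono2 integral_nonneg_AE)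
    then show ?thesis
      using H_powr_le(1)[OF q f fq] False by (simp add: lp_space_iff q_def)
  qed
qed

end

section \<open>Markovian forms\<close>

text \<open>The Beurling-Deny condition, imposed on the operator domain rather than the form domain.
  This is enough because the resolvent is a limit of minimising sequences inside
  \<open>D\<close>.\<close>

locale markovian_form = l2_form +
  assumes contraction_D: "f \<in> D \<Longrightarrow> \<psi> 0 = 0 \<Longrightarrow> (\<And>a b. \<bar>\<psi> a - \<psi> b\<bar> \<le> \<bar>a - b\<bar>) \<Longrightarrow> (\<lambda>v. \<psi> (f v)) \<in> D"
    and contraction_form: "f \<in> D \<Longrightarrow> \<psi> 0 = 0 \<Longrightarrow> (\<And>a b. \<bar>\<psi> a - \<psi> b\<bar> \<le> \<bar>a - b\<bar>) \<Longrightarrow>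
      l2_inner \<mu> (A (\<lambda>v. \<psi> (f v))) (\<lambda>v. \<psi> (f v)) \<le> l2_inner \<mu> (A f) f"
begin

text \<open>Iterates are covered because the exponential averages over all powers of the resolvent;
  it suffices that the closed set \<open>C\<close> is mapped into itself.\<close>

lemma J_retraction:
  assumes a: "0 < a" and \<psi>0: "\<psi> 0 = 0" and lip: "\<And>a b. \<bar>\<psi> a - \<psi> b\<bar> \<le> \<bar>a - b\<bar>"
    and idem: "\<And>a. \<psi> (\<psi> a) = \<psi> a" and x: "\<And>v. \<psi> (fn x v) = fn x v"
  shows "\<psi> (fn ((F.J a ^^ k) x) v) = fn ((F.J a ^^ k) x) v"
proof -
  define C where "C = {x. \<forall>v. \<psi> (fn x v) = fn x v}"
  have c\<psi>: "continuous_on UNIV \<psi>"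
  proof (rule continuous_onI)
    fix x e :: real assume "0 < e"
    then show "\<exists>d>0. \<forall>x'\<in>UNIV. dist x' x < d \<longrightarrow> dist (\<psi> x') (\<psi> x) \<le> e"
      using lip order_trans less_imp_le unfolding dist_real_def by (intro exI[of _ e]) blast
  qed
  have cfn: "continuous_on UNIV (\<lambda>x. fn x v)" for v
    by (rule linear_continuous_on[OF bounded_linear_fn])
  have "closed {x. \<psi> (fn x v) = fn x v}" for v
    by (rule closed_Collect_eq[OF continuous_on_compose2[OF c\<psi> cfn] cfn]) simp
  then have "closed C"
    unfolding C_def Collect_all_eq by blast
  have step: "F.J a y \<in> C" if y: "y \<in> C" for y
  proof (rule F.J_invariant[OF a \<open>closed C\<close>])
    fix g assume "g \<in> D'"
    then obtain h where h: "h \<in> D" and g: "g = emb h" by blast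
    define h' where "h' v = \<psi> (h v)" for v
    have h': "h' \<in> D" unfolding h'_def[abs_def] by (rule contraction_D[OF h \<psi>0 lip])
    have "F.q (emb h') (emb h') \<le> F.q g g"
      unfolding g q_emb[OF h h] q_emb[OF h' h'] unfolding h'_def[abs_def]
      by (rule contraction_form[OF h \<psi>0 lip])
    moreover have "emb h' \<in> C"
      by (simp add: C_def in_l2[OF h']) (simp add: h'_def idem)
    moreover have "norm (emb h' - y) \<le> norm (g - y)"
    proof -
      \<comment> \<open>The values of \<open>y\<close> are fixed by \<open>\<psi>\<close>, so the
        Lipschitz bound compares with \<open>y\<close> itself.\<close>
      have "\<bar>h' v - fn y v\<bar> \<le> \<bar>h v - fn y v\<bar>" for v
        using lip[of "h v" "fn y v"] y by (simp add: h'_def C_def)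
      then have "norm (emb (\<lambda>v. h' v - fn y v)) \<le> norm (emb (\<lambda>v. h v - fn y v))"
        by (intro norm_emb_mono l2_diff in_l2 h h' fn_in_l2)
      then show ?thesis by (simp add: emb_diff in_l2 h h' fn_in_l2 g)
    qed
    ultimately show "\<exists>g'\<in>D' \<inter> C. F.q g' g' \<le> F.q g g \<and> norm (g' - y) \<le> norm (g - y)"
      using h' by blast
  qed
  have "(F.J a ^^ k) x \<in> C"
    by (induction k) (use x step in \<open>auto simp: C_def\<close>)
  then show ?thesis by (simp add: C_def)
qed

text \<open>The two retractions are \<open>max 0\<close> and \<open>min 1\<close>: both are
  1-Lipschitz, idempotent and fix 0, and their fixed points are the half-lines in question.\<close>

lemma submarkovian_T:
  assumes t: "0 \<le> t"
  shows "submarkovian \<mu> (F.T t)"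
proof (intro submarkovian.intro submarkovian_axioms.intro)
  have lip: "\<bar>max 0 a - max 0 b\<bar> \<le> \<bar>a - b\<bar>" "\<bar>min 1 a - min 1 b\<bar> \<le> \<bar>a - b\<bar>" for a b :: real
    by linarith+
  show "weights \<mu>" by (rule weights_axioms)
  show "bounded_linear (F.T t)" by (rule F.bounded_linear_T[OF t])
  show "F.T t x \<bullet> y = x \<bullet> F.T t y" for x y by (rule F.T_symmetric[OF F.J_symmetric t])
  fix f v assume f: "f \<in> l2_space \<mu>"
  show "0 \<le> fn (F.T t (emb f)) v" if "\<And>v. 0 \<le> f v"
  proof -
    \<comment> \<open>\<open>T_functional_le\<close> yields upper bounds, hence the sign.\<close>
    have "- fn (F.T t (emb f)) v \<le> 0"
    proof (rule F.T_functional_le[OF bounded_linear_minus[OF bounded_linear_fn] _ t])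
      fix a :: real and k assume a: "0 < a"
      have "max 0 (fn ((F.J a ^^ k) (emb f)) v) = fn ((F.J a ^^ k) (emb f)) v"
        by (rule J_retraction[OF a]) (use that in \<open>simp_all add: f lip\<close>)
      then show "- fn ((F.J a ^^ k) (emb f)) v \<le> 0" by linarith
    qed
    then show ?thesis by simp
  qed
  show "fn (F.T t (emb f)) v \<le> 1" if "\<And>v. f v \<le> 1"
  proof (rule F.T_functional_le[OF bounded_linear_fn _ t])
    fix a :: real and k assume a: "0 < a"
    have "min 1 (fn ((F.J a ^^ k) (emb f)) v) = fn ((F.J a ^^ k) (emb f)) v"
      by (rule J_retraction[OF a]) (use that in \<open>simp_all add: f lip\<close>)
    then show "fn ((F.J a ^^ k) (emb f)) v \<le> 1" by linarith
  qed
qed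

theorem semigroup_exp_markovian:
  assumes t: "0 \<le> t"
  shows "positivity_preserving \<mu> (semigroup_exp \<mu> (friedrichs_extension \<mu> D A) t)"
    and "1 \<le> p \<Longrightarrow> lp_contraction \<mu> p (semigroup_exp \<mu> (friedrichs_extension \<mu> D A) t)"
proof -
  interpret S: submarkovian \<mu> "F.T t" by (rule submarkovian_T[OF t])
  have eq: "semigroup_exp \<mu> (friedrichs_extension \<mu> D A) t f = S.H f" if "f \<in> l2_space \<mu>" for f
    using semigroup_exp_eq(2)[OF t that] by (simp add: S.H_def Tf_def)
  show "positivity_preserving \<mu> (semigroup_exp \<mu> (friedrichs_extension \<mu> D A) t)"
    unfolding positivity_preserving_def by (simp add: eq S.H_def S.T_pos)
  show "lp_contraction \<mu> p (semigroup_exp \<mu> (friedrichs_extension \<mu> D A) t)" if "1 \<le> p"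
    using S.lp_contraction_H[OF that] unfolding lp_contraction_def by (simp add: eq)
qed

end

section \<open>The graph Laplacian\<close>

context weighted_graph
begin

sublocale weights \<mu> by unfold_locales (rule weight_pos)

lemma conductance_sym: "conductance E R u v = conductance E R v u"
  using length_sym by (auto simp: conductance_def insert_commute)

lemma conductance_nonneg: "0 \<le> conductance E R u v"
  using length_pos by (auto simp: conductance_def intro: less_imp_le)

lemma jumps_sym: "(u, v) \<in> jumps f \<longleftrightarrow> (v, u) \<in> jumps f"
  by (auto simp: jumps_def insert_commute)

lemma laplacian_eq_0: "v \<notin> snd ` jumps f \<Longrightarrow> laplacian E R \<mu> f v = 0"
  unfolding laplacian_def by (force simp: jumps_def intro: sum.neutral)

text \<open>Summation by parts: exchanging the ends of all pairs gives a second expression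
  \<open>2\<close> for the sum \<open>1\<close>, and the mean of the two is symmetric.
  \<open>P\<close> may exceed the jumps of \<open>f\<close>, so that different functions can be
  compared over one index set.\<close>

lemma l2_inner_laplacian:
  assumes P: "finite P" "jumps f \<subseteq> P" "P \<subseteq> {(u, v). {u, v} \<in> E}"
    and P_sym: "\<And>u v. (u, v) \<in> P \<Longrightarrow> (v, u) \<in> P"
  shows "l2_inner \<mu> (laplacian E R \<mu> f) g =
    (\<Sum>(u, v)\<in>P. conductance E R u v * (f v - f u) * (g v - g u)) / 2"
proof -
  let ?C = "conductance E R"
  let ?L = "laplacian E R \<mu> f"
  let ?V = "snd ` P"
  have L0: "?L v = 0" if "v \<notin> ?V" for v
    using that P(2) by (intro laplacian_eq_0) blast
  have "l2_inner \<mu> ?L g = (\<Sum>\<^sub>\<infinity>v. \<mu> v * (?L v * g v))"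
    unfolding l2_inner_def
    by (rule integral_vertex_measure, rule infsum_finite_support(1)[of ?V]) (use P(1) L0 in auto)
  also have "\<dots> = (\<Sum>v\<in>?V. \<mu> v * (?L v * g v))"
    by (rule infsum_finite_support(2)) (use P(1) L0 in auto)
  also have "\<dots> = (\<Sum>v\<in>?V. \<Sum>u | (u, v) \<in> P. ?C u v * (f v - f u) * g v)"
  proof (rule sum.cong[OF refl])
    fix v
    have "\<mu> v * (?L v * g v) = (\<Sum>u | {u, v} \<in> E. ?C u v * (f v - f u)) * g v"
      using weight_pos[of v] by (simp add: laplacian_def)
    \<comment> \<open>A neighbour of \<open>v\<close> not paired with it in \<open>P\<close> is not
      separated from it by a jump of \<open>f\<close>, so its term vanishes.\<close>
    also have "(\<Sum>u | {u, v} \<in> E. ?C u v * (f v - f u)) = (\<Sum>u | (u, v) \<in> P. ?C u v * (f v - f u))"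
      by (rule sum.mono_neutral_right[OF finite_incident]) (use P in \<open>auto simp: jumps_def\<close>)
    finally show "\<mu> v * (?L v * g v) = (\<Sum>u | (u, v) \<in> P. ?C u v * (f v - f u) * g v)"
      by (simp add: sum_distrib_right)
  qed
  also have "\<dots> = (\<Sum>(v, u)\<in>(SIGMA v:?V. {u. (u, v) \<in> P}). ?C u v * (f v - f u) * g v)"
  proof (rule sum.Sigma)
    have "{u. (u, v) \<in> P} \<subseteq> fst ` P" for v by force
    then show "\<forall>v\<in>?V. finite {u. (u, v) \<in> P}" using P(1) finite_subset by blast
  qed (use P(1) in auto)
  also have "\<dots> = (\<Sum>(u, v)\<in>P. ?C u v * (f v - f u) * g v)"
    by (rule sum.reindex_bij_witness[where i = prod.swap and j = prod.swap]) force+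
  finally have 1: "l2_inner \<mu> ?L g = (\<Sum>(u, v)\<in>P. ?C u v * (f v - f u) * g v)" .
  also have "\<dots> = (\<Sum>(u, v)\<in>P. ?C u v * (f u - f v) * g u)"
    by (rule sum.reindex_bij_witness[where i = prod.swap and j = prod.swap])
      (auto intro: P_sym simp: conductance_sym)
  finally have 2: "l2_inner \<mu> ?L g = (\<Sum>(u, v)\<in>P. ?C u v * (f u - f v) * g u)" .
  have "2 * l2_inner \<mu> ?L g = (\<Sum>(u, v)\<in>P. ?C u v * (f v - f u) * (g v - g u))"
    using arg_cong2[OF 1 2, of "(+)"]
    by (simp add: sum.distrib[symmetric] case_prod_unfold algebra_simps)
  then show ?thesis by simp
qed

lemma jumps_edges: "jumps f \<subseteq> {(u, v). {u, v} \<in> E}"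
  by (auto simp: jumps_def)

lemma laplace_markovian:
  assumes \<Omega>: "\<Omega> \<subseteq> metric_completion (graph_dist E R) - range (completion_embed (graph_dist E R))"
  shows "markovian_form \<mu> (laplace_domain E R \<mu> \<Omega>) (laplacian E R \<mu>)"
proof -
  let ?D = "laplace_domain E R \<mu> \<Omega>" and ?A = "laplacian E R \<mu>"
  have \<Omega>': "\<Omega> \<subseteq> metric_completion (graph_dist E R)" using \<Omega> by blast
  have fin: "finite (jumps f)" if "f \<in> ?D" for f
    using that algebra_A_vanishing_iff[OF \<Omega>'] by (simp add: laplace_domain_def)
  have comp: "(\<lambda>v. \<psi> (f v)) \<in> ?D"
    if f: "f \<in> ?D" and \<psi>: "\<psi> 0 = 0" "\<And>a b. \<bar>\<psi> a - \<psi> b\<bar> \<le> \<bar>a - b\<bar>" for f \<psi>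
  proof -
    have f2: "(\<lambda>v. \<mu> v * (f v)\<^sup>2) summable_on UNIV" using f by (simp add: laplace_domain_def l2_iff)
    have "(\<psi> (f v))\<^sup>2 \<le> (f v)\<^sup>2" for v
      using \<psi>(2)[of "f v" 0] \<psi>(1) by (simp add: abs_le_square_iff)
    then have "(\<lambda>v. \<mu> v * (\<psi> (f v))\<^sup>2) summable_on UNIV"
      by (intro summable_on_comparison_test[OF f2] mult_left_mono) (auto simp: \<mu>_nonneg)
    moreover have "(\<lambda>v. \<psi> (f v)) \<in> algebra_A_vanishing E R \<Omega>"
      using algebra_A_vanishing_compose[OF \<Omega>', of f f "\<lambda>a b. \<psi> a"] f \<psi>(1) by (simp add: laplace_domain_def)
    ultimately show ?thesis by (simp add: laplace_domain_def l2_iff)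
  qed
  show ?thesis
  proof
    show "?D \<subseteq> l2_space \<mu>" by (auto simp: laplace_domain_def)
    show "(\<lambda>v. 0) \<in> ?D"
      using finite_support_vanishing[OF \<Omega>, of "\<lambda>v. 0"] finite_support_l2[of "{}" "\<lambda>v. 0"]
      by (simp add: laplace_domain_def)
    show "closure (emb ` ?D) = UNIV"
    proof -
      have "x \<in> closure (emb ` ?D)" for x
      proof -
        \<comment> \<open>Truncations lie in the domain because \<open>\<Omega>\<close> contains no
          vertex, and they approximate every element of the space.\<close>
        have "trunc F f \<in> ?D" if F: "finite F" for F f
        proof -
          have "finite {v. trunc F f v \<noteq> 0}"
            by (rule finite_subset[OF _ F]) (auto simp: trunc_def)
          then show ?thesis
            using finite_support_vanishing[OF \<Omega>] trunc_l2[OF F] by (simp add: laplace_domain_def)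
        qed
        then have "\<forall>\<^sub>F F in finite_subsets_at_top UNIV. emb (trunc F (fn x)) \<in> closure (emb ` ?D)"
          by (intro eventually_finite_subsets_at_top_weakI subsetD[OF closure_subset] imageI)
        from Lim_in_closed_set[OF closed_closure this _ trunc_tendsto[OF fn_in_l2]]
        show ?thesis by simp
      qed
      then show ?thesis by blast
    qed
    fix f assume f: "f \<in> ?D"
    have ff: "l2_inner \<mu> (?A f) f = (\<Sum>(u, v)\<in>jumps f. conductance E R u v * (f v - f u) * (f v - f u)) / 2"
      by (rule l2_inner_laplacian[OF fin[OF f] order_refl jumps_edges]) (simp add: jumps_sym)
    show "?A f \<in> l2_space \<mu>"
      by (rule finite_support_l2[of "snd ` jumps f"]) (use fin[OF f] laplacian_eq_0 in auto)
    show "0 \<le> l2_inner \<mu> (?A f) f"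
      unfolding ff by (auto intro!: sum_nonneg simp: conductance_nonneg mult.assoc)
    show "(\<lambda>v. \<psi> (f v)) \<in> ?D" if "\<psi> 0 = 0" "\<And>a b. \<bar>\<psi> a - \<psi> b\<bar> \<le> \<bar>a - b\<bar>" for \<psi>
      by (rule comp[OF f that])
    show "l2_inner \<mu> (?A (\<lambda>v. \<psi> (f v))) (\<lambda>v. \<psi> (f v)) \<le> l2_inner \<mu> (?A f) f"
      if \<psi>: "\<psi> 0 = 0" "\<And>a b. \<bar>\<psi> a - \<psi> b\<bar> \<le> \<bar>a - b\<bar>" for \<psi>
    proof -
      \<comment> \<open>Composition creates no jumps, so both energies are sums over
        \<open>jumps f\<close> and can be compared term by term.\<close>
      have "jumps (\<lambda>v. \<psi> (f v)) \<subseteq> jumps f" by (auto simp: jumps_def)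
      then have "l2_inner \<mu> (?A (\<lambda>v. \<psi> (f v))) (\<lambda>v. \<psi> (f v)) =
          (\<Sum>(u, v)\<in>jumps f. conductance E R u v * (\<psi> (f v) - \<psi> (f u)) * (\<psi> (f v) - \<psi> (f u))) / 2"
        by (rule l2_inner_laplacian[OF fin[OF f] _ jumps_edges]) (simp add: jumps_sym)
      also have "\<dots> \<le> (\<Sum>(u, v)\<in>jumps f. conductance E R u v * (f v - f u) * (f v - f u)) / 2"
      proof (intro divide_right_mono sum_mono)
        fix e assume "e \<in> jumps f"
        have "(\<psi> (f v) - \<psi> (f u)) * (\<psi> (f v) - \<psi> (f u)) \<le> (f v - f u) * (f v - f u)" for u v
          using \<psi>(2)[of "f v" "f u"] by (simp add: abs_le_square_iff power2_eq_square)
        then show "(case e of (u, v) \<Rightarrow> conductance E R u v * (\<psi> (f v) - \<psi> (f u)) * (\<psi> (f v) - \<psi> (f u)))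
            \<le> (case e of (u, v) \<Rightarrow> conductance E R u v * (f v - f u) * (f v - f u))"
          by (auto simp: mult.assoc intro!: mult_left_mono conductance_nonneg split: prod.split)
      qed simp
      finally show ?thesis unfolding ff .
    qed
    fix g assume g: "g \<in> ?D"
    show "(\<lambda>v. a * f v + b * g v) \<in> ?D" for a b
      using f g algebra_A_vanishing_compose[OF \<Omega>', of f g "\<lambda>x y. a * x + b * y"] l2_lincomb[of f g a b]
      by (simp add: laplace_domain_def)
    show "?A (\<lambda>v. a * f v + b * g v) = (\<lambda>v. a * ?A f v + b * ?A g v)" for a b
    proof
      fix v
      have "(\<Sum>u | {u, v} \<in> E. conductance E R u v * ((a * f v + b * g v) - (a * f u + b * g u))) =
          a * (\<Sum>u | {u, v} \<in> E. conductance E R u v * (f v - f u)) + b * (\<Sum>u | {u, v} \<in> E. conductance E R u v * (g v - g u))"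
        by (simp add: sum_distrib_left sum.distrib[symmetric] algebra_simps)
      then show "?A (\<lambda>v. a * f v + b * g v) v = a * ?A f v + b * ?A g v"
        by (simp add: laplacian_def add_divide_distrib)
    qed
    show "l2_inner \<mu> (?A f) g = l2_inner \<mu> f (?A g)"
    proof -
      \<comment> \<open>Over the union of the two jump sets the energy is visibly symmetric in
        \<open>f\<close> and \<open>g\<close>.\<close>
      let ?P = "jumps f \<union> jumps g"
      have sum: "l2_inner \<mu> (?A h) k = (\<Sum>(u, v)\<in>?P. conductance E R u v * (h v - h u) * (k v - k u)) / 2"
        if "h = f \<or> h = g" for h k
        by (rule l2_inner_laplacian) (use that fin[OF f] fin[OF g] jumps_edges jumps_sym in auto)
      have "l2_inner \<mu> (?A f) g = l2_inner \<mu> (?A g) f"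
        by (simp add: sum) (simp add: mult.commute mult.left_commute)
      then show ?thesis by (simp add: l2_inner_def mult.commute)
    qed
  qed
qed

end

theorem theorem4p7:
  fixes E :: "'v set set" and R :: "'v \<Rightarrow> 'v \<Rightarrow> real" and \<mu> :: "'v \<Rightarrow> real"
    and \<Omega> :: "(nat \<Rightarrow> 'v) set set" and t :: real
  assumes "weighted_graph E R \<mu>"
    and "closedin (completion_topology (graph_dist E R)) \<Omega>"
    and "\<Omega> \<subseteq> metric_completion (graph_dist E R) - range (completion_embed (graph_dist E R))"
    and "0 \<le> t"
  shows "bounded_operator \<mu> (semigroup_exp \<mu> (friedrichs_laplacian E R \<mu> \<Omega>) t) \<and>
    positivity_preserving \<mu> (semigroup_exp \<mu> (friedrichs_laplacian E R \<mu> \<Omega>) t) \<and>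
    (\<forall>p::ennreal. 1 \<le> p \<longrightarrow> lp_contraction \<mu> p (semigroup_exp \<mu> (friedrichs_laplacian E R \<mu> \<Omega>) t))"
proof -
  interpret weighted_graph E R \<mu> by (rule assms(1))
  interpret M: markovian_form \<mu> "laplace_domain E R \<mu> \<Omega>" "laplacian E R \<mu>"
    by (rule laplace_markovian[OF assms(3)])
  show ?thesis
    unfolding friedrichs_laplacian_def
    using M.semigroup_exp_eq(1)[OF assms(4)] M.semigroup_exp_markovian[OF assms(4)] by blast
qed

end
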